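(* Let $k$ be a field and $K_2=\{\emptyset\}$ as a simplicial complex on $\{1,2\}$. If two torsion-free objects $M,N\in\mathcal{L}(K_2)$ satisfy $\mathrm{sirk}_M=\mathrm{sirk}_N$, then $M$ and $N$ are isomorphic. In other words, the function $M\mapsto \mathrm{sirk}_M$ from isomorphism classes of torsion-free objects of $\mathcal{L}(K_2)$ to functions $\mathbb{N}^2\to\mathbb{N}$ is injective.
   Context: $R=k[t_1,t_2]$ is $\mathbb{N}^2$-graded ($0\in\mathbb{N}$) with $|t_1|=(1,0)$, $|t_2|=(0,1)$; all modules are multigraded and morphisms preserve multidegree. Let $R_{\{1\}}=k[t_1^{\pm1},t_2]$ ($\mathbb{Z}\times\mathbb{N}$-graded), $R_{\{2\}}=k[t_1,t_2^{\pm1}]$ ($\mathbb{N}\times\mathbb{Z}$-graded), $R_{\{1,2\}}=k[t_1^{\pm1},t_2^{\pm1}]$ ($\mathbb{Z}^2$-graded). An object $M$ of $\mathcal{L}(K_2)$ consists of finitely generated graded modules $M_\sigma$ over $R_\sigma$ for $\sigma=\{1\},\{2\},\{1,2\}$ and $R_{\{i\}}$-linear maps $M_{\{i\}}\to M_{\{1,2\}}$ ($i=1,2$) inducing isomorphisms $R_{\{1,2\}}\otimes_{R_{\{i\}}}M_{\{i\}}\cong M_{\{1,2\}}$ (modules being extended by zero to a $\mathbb{Z}^2$-grading). Morphisms are compatible families of module maps. $M$ is torsion-free if $t_2$ acts injectively on $M_{\{1\}}$ and $t_1$ acts injectively on $M_{\{2\}}$. The functor $L_{K_2}$ from finitely generated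 $\mathbb{N}^2$-graded $R$-modules to $\mathcal{L}(K_2)$ sends $A$ to $(R_\sigma\otimes_RA)_\sigma$ with the canonical maps; it is essentially surjective. For an $R$-module $A$, write $A(\vec d)$ for its part in bidegree $\vec d$ and, for $\vec d\le\vec e$ (componentwise), $t^{\vec e-\vec d}\colon A(\vec d)\to A(\vec e)$ for multiplication by the monomial. The intersection rank invariant is, for $\vec a=(a_1,a_2)\le\vec c=(c_1,c_2)$ and $\vec b=(b_1,b_2)\le\vec c$ in $\mathbb{N}^2$, $$\mathrm{irk}_A(\vec a,\vec b,\vec c)=\dim_k\Big(\mathrm{im}\big(t^{\vec c-\vec a}\colon A(\vec a)\to A(\vec c)\big)\cap\mathrm{im}\big(t^{\vec c-\vec b}\colon A(\vec b)\to A(\vec c)\big)\Big).$$ For finitely generated $A$, the stabilized intersection rank invariant is the function $\mathrm{sirk}_A\colon\mathbb{N}^2\to\mathbb{N}$, $$\mathrm{sirk}_A(a_1,b_2)=\lim_{a_2,b_1\to\infty}\ \lim_{c_1,c_2\to\infty}\mathrm{irk}_A((a_1,a_2),(b_1,b_2),(c_1,c_2)).$$ It depends only on the isomorphism class of $L_{K_2}(A)$ in $\mathcal{L}(K_2)$, so for an object $M$ of $\mathcal{L}(K_2)$ one sets $\mathrm{sirk}_M:=\mathrm{sirk}_A$ for any finitely generated $A$ with $L_{K_2}(A)\cong M$. *)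

theory Defs
  imports
    "HOL-Library.Poly_Mapping"
    "HOL-Library.Product_Plus"
    "HOL-Algebra.Free_Abelian_Groups"
    "Jordan_Normal_Form.VS_Connect"
begin

text \<open>The Laurent polynomial ring \<open>k[t\<^sub>1\<^sup>\<plusminus>\<^sup>1, t\<^sub>2\<^sup>\<plusminus>\<^sup>1]\<close> is the group algebra of \<open>\<int>\<^sup>2\<close>: the monomial
  \<open>c t\<^sup>d\<close> is \<open>Poly_Mapping.single d c\<close>, and multiplication is convolution.  All rings \<open>R\<^sub>\<sigma>\<close>, for
  \<open>\<sigma> \<subseteq> {1,2}\<close>, are its subrings spanned by the monomials with exponent in \<open>degs \<sigma>\<close>; in particular
  \<open>R = k[t\<^sub>1,t\<^sub>2]\<close> is the case \<open>\<sigma> = {}\<close>.\<close>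

type_synonym 'k laurent = "(int \<times> int) \<Rightarrow>\<^sub>0 'k"

definition degs :: "nat set \<Rightarrow> (int \<times> int) set" where
  "degs \<sigma> = {(d1, d2). (1 \<notin> \<sigma> \<longrightarrow> 0 \<le> d1) \<and> (2 \<notin> \<sigma> \<longrightarrow> 0 \<le> d2)}"

definition locR :: "nat set \<Rightarrow> 'k::field laurent ring" where
  "locR \<sigma> = \<lparr>carrier = {p. Poly_Mapping.keys p \<subseteq> degs \<sigma>},
             mult = (*), one = 1, zero = 0, add = (+)\<rparr>"

text \<open>A module together with its homogeneous parts, indexed by \<open>\<int>\<^sup>2\<close>.  A grading by the smaller monoid
  \<open>degs \<sigma>\<close> is extended by zero to \<open>\<int>\<^sup>2\<close>.\<close>

record ('r, 'm) gmodule = "('r, 'm) module" +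
  hpart :: "int \<times> int \<Rightarrow> 'm set"

locale graded_module = Module.module "locR \<sigma> :: 'k laurent ring" A
  for \<sigma> :: "nat set" and A :: "('k::field laurent, 'm) gmodule" (structure) +
  assumes hpart_subgroup: "subgroup (hpart A d) (add_monoid A)"
    and hpart_smult: "\<lbrakk>e \<in> degs \<sigma>; x \<in> hpart A d\<rbrakk>
          \<Longrightarrow> Poly_Mapping.single e c \<odot>\<^bsub>A\<^esub> x \<in> hpart A (e + d)"
    and hpart_outside: "d \<notin> degs \<sigma> \<Longrightarrow> hpart A d = {\<zero>\<^bsub>A\<^esub>}"
    and hpart_direct_sum: "x \<in> carrier A \<Longrightarrow>
          \<exists>!f. (\<forall>d. f d \<in> hpart A d) \<and> finite {d. f d \<noteq> \<zero>\<^bsub>A\<^esub>} \<and>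
               x = (\<Oplus>\<^bsub>A\<^esub>d\<in>{d. f d \<noteq> \<zero>\<^bsub>A\<^esub>}. f d)"

definition fg_graded_module :: "nat set \<Rightarrow> ('k::field laurent, 'm) gmodule \<Rightarrow> bool" where
  "fg_graded_module \<sigma> A \<longleftrightarrow> graded_module \<sigma> A \<and>
     (\<exists>X. finite X \<and> X \<subseteq> carrier A \<and> LinearCombinations.module.span (locR \<sigma>) A X = carrier A)"

text \<open>\<open>B\<close> may be a graded module over a larger ring \<open>R\<^sub>\<tau>\<close>, \<open>\<sigma> \<subseteq> \<tau>\<close>; it is then viewed as an
  \<open>R\<^sub>\<sigma>\<close>-module by restriction of scalars.\<close>

definition graded_hom ::
  "nat set \<Rightarrow> ('k::field laurent, 'm) gmodule \<Rightarrow> ('k laurent, 'n) gmodule \<Rightarrow> ('m \<Rightarrow> 'n) set" where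
  "graded_hom \<sigma> A B =
     {f \<in> LinearCombinations.module_hom (locR \<sigma>) A B. \<forall>d. f ` hpart A d \<subseteq> hpart B d}"

definition graded_iso ::
  "nat set \<Rightarrow> ('k::field laurent, 'm) gmodule \<Rightarrow> ('k laurent, 'n) gmodule \<Rightarrow> ('m \<Rightarrow> 'n) set" where
  "graded_iso \<sigma> A B =
     {f \<in> graded_hom \<sigma> A B. \<exists>g \<in> graded_hom \<sigma> B A.
        (\<forall>x\<in>carrier A. g (f x) = x) \<and> (\<forall>y\<in>carrier B. f (g y) = y)}"

text \<open>For \<open>\<sigma> \<subseteq> \<tau>\<close>, \<open>R\<^sub>\<tau> \<otimes>\<^bsub>R\<^sub>\<sigma>\<^esub> A\<close> is the free abelian group on \<open>R\<^sub>\<tau> \<times> A\<close> modulo the bilinearity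
  and balancing relations.\<close>

definition tensor_free ::
  "nat set \<Rightarrow> ('k::field laurent, 'm) gmodule \<Rightarrow> (('k laurent \<times> 'm) \<Rightarrow>\<^sub>0 int) monoid" where
  "tensor_free \<tau> A = free_Abelian_group (carrier (locR \<tau>) \<times> carrier A)"

definition tensor_relations ::
  "nat set \<Rightarrow> nat set \<Rightarrow> ('k::field laurent, 'm) gmodule \<Rightarrow> (('k laurent \<times> 'm) \<Rightarrow>\<^sub>0 int) set" where
  "tensor_relations \<sigma> \<tau> A = generate (tensor_free \<tau> A)
     ({frag_of (r + r', a) - frag_of (r, a) - frag_of (r', a) | r r' a.
         r \<in> carrier (locR \<tau>) \<and> r' \<in> carrier (locR \<tau>) \<and> a \<in> carrier A} \<union>
      {frag_of (r, a \<oplus>\<^bsub>A\<^esub> a') - frag_of (r, a) - frag_of (r, a') | r a a'.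
         r \<in> carrier (locR \<tau>) \<and> a \<in> carrier A \<and> a' \<in> carrier A} \<union>
      {frag_of (r * s, a) - frag_of (r, s \<odot>\<^bsub>A\<^esub> a) | r s a.
         r \<in> carrier (locR \<tau>) \<and> s \<in> carrier (locR \<sigma>) \<and> a \<in> carrier A})"

definition tensor_class ::
  "nat set \<Rightarrow> nat set \<Rightarrow> ('k::field laurent, 'm) gmodule \<Rightarrow>
     (('k laurent \<times> 'm) \<Rightarrow>\<^sub>0 int) \<Rightarrow> (('k laurent \<times> 'm) \<Rightarrow>\<^sub>0 int) set" where
  "tensor_class \<sigma> \<tau> A x = tensor_relations \<sigma> \<tau> A #>\<^bsub>tensor_free \<tau> A\<^esub> x"

definition tens ::
  "nat set \<Rightarrow> nat set \<Rightarrow> ('k::field laurent, 'm) gmodule \<Rightarrow>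
     'k laurent \<Rightarrow> 'm \<Rightarrow> (('k laurent \<times> 'm) \<Rightarrow>\<^sub>0 int) set" where
  "tens \<sigma> \<tau> A r a = tensor_class \<sigma> \<tau> A (frag_of (r, a))"

text \<open>A map defined on representatives is written as a union over all representatives \<open>x\<close> of the
  class \<open>X\<close>.  Scalar multiplication is \<open>r (r' \<otimes> a) = (r r') \<otimes> a\<close>; the part of degree \<open>d\<close> is spanned by
  the \<open>r \<otimes> a\<close> with \<open>r\<close>, \<open>a\<close> homogeneous of degrees adding up to \<open>d\<close>.  The fields \<open>mult\<close> and \<open>one\<close>,
  inherited from the ring record, play no role in a module.\<close>

definition ext_scalars ::
  "nat set \<Rightarrow> nat set \<Rightarrow> ('k::field laurent, 'm) gmodule \<Rightarrow>
     ('k laurent, (('k laurent \<times> 'm) \<Rightarrow>\<^sub>0 int) set) gmodule" where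
  "ext_scalars \<sigma> \<tau> A =
     (let T = tensor_free \<tau> A Mod tensor_relations \<sigma> \<tau> A in
      \<lparr>carrier = carrier T, mult = undefined, one = undefined,
       zero = one T, add = mult T,
       smult = (\<lambda>r X. \<Union>x\<in>X. tensor_class \<sigma> \<tau> A (frag_extend (\<lambda>(r', a). frag_of (r * r', a)) x)),
       hpart = (\<lambda>d. generate T
         {tens \<sigma> \<tau> A (Poly_Mapping.single e c) a | e c a. e \<in> degs \<tau> \<and> a \<in> hpart A (d - e)})\<rparr>)"

text \<open>The canonical map \<open>R\<^sub>\<tau> \<otimes> A \<rightarrow> R\<^sub>\<tau>\<^sub>' \<otimes> A\<close>, \<open>r \<otimes> a \<mapsto> r \<otimes> a\<close>, for \<open>\<tau> \<subseteq> \<tau>'\<close>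
  (the representatives of \<open>X\<close> are supported in \<open>R\<^sub>\<tau> \<times> A \<subseteq> R\<^sub>\<tau>\<^sub>' \<times> A\<close>).\<close>

definition ext_map ::
  "nat set \<Rightarrow> nat set \<Rightarrow> ('k::field laurent, 'm) gmodule \<Rightarrow>
     (('k laurent \<times> 'm) \<Rightarrow>\<^sub>0 int) set \<Rightarrow> (('k laurent \<times> 'm) \<Rightarrow>\<^sub>0 int) set" where
  "ext_map \<sigma> \<tau>' A X = (\<Union>x\<in>X. tensor_class \<sigma> \<tau>' A x)"

text \<open>The data of an object of \<open>\<L>(K\<^sub>2)\<close>, \<open>K\<^sub>2 = {\<emptyset>}\<close> on the vertices \<open>1, 2\<close>: the components \<open>M\<^sub>\<sigma>\<close> for the
  nonempty \<open>\<sigma> \<subseteq> {1,2}\<close> and the two structure maps.  The axioms are in \<open>is_LK2\<close>.\<close>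

record ('r, 'a, 'b, 'c) LK2_object =
  mod1 :: "('r, 'a) gmodule"
  mod2 :: "('r, 'b) gmodule"
  mod12 :: "('r, 'c) gmodule"
  map1 :: "'a \<Rightarrow> 'c"
  map2 :: "'b \<Rightarrow> 'c"

text \<open>The map \<open>\<phi>\<close> induces an isomorphism \<open>R\<^sub>\<tau> \<otimes>\<^bsub>R\<^sub>\<sigma>\<^esub> A \<cong> B\<close>, \<open>r \<otimes> a \<mapsto> r \<phi>(a)\<close>.\<close>

definition induces_iso ::
  "nat set \<Rightarrow> nat set \<Rightarrow> ('k::field laurent, 'm) gmodule \<Rightarrow> ('k laurent, 'n) gmodule \<Rightarrow>
     ('m \<Rightarrow> 'n) \<Rightarrow> bool" where
  "induces_iso \<sigma> \<tau> A B \<phi> \<longleftrightarrow>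
     (\<exists>h \<in> graded_iso \<tau> (ext_scalars \<sigma> \<tau> A) B.
        \<forall>r\<in>carrier (locR \<tau>). \<forall>a\<in>carrier A. h (tens \<sigma> \<tau> A r a) = r \<odot>\<^bsub>B\<^esub> \<phi> a)"

definition is_LK2 :: "('k::field laurent, 'a, 'b, 'c) LK2_object \<Rightarrow> bool" where
  "is_LK2 M \<longleftrightarrow>
     fg_graded_module {1} (mod1 M) \<and> fg_graded_module {2} (mod2 M) \<and>
     fg_graded_module {1, 2} (mod12 M) \<and>
     map1 M \<in> graded_hom {1} (mod1 M) (mod12 M) \<and>
     map2 M \<in> graded_hom {2} (mod2 M) (mod12 M) \<and>
     induces_iso {1} {1, 2} (mod1 M) (mod12 M) (map1 M) \<and>
     induces_iso {2} {1, 2} (mod2 M) (mod12 M) (map2 M)"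

definition LK2_hom ::
  "('k::field laurent, 'a, 'b, 'c) LK2_object \<Rightarrow> ('k laurent, 'd, 'e, 'f) LK2_object \<Rightarrow>
     (('a \<Rightarrow> 'd) \<times> ('b \<Rightarrow> 'e) \<times> ('c \<Rightarrow> 'f)) set" where
  "LK2_hom M N = {(f1, f2, f12).
     f1 \<in> graded_hom {1} (mod1 M) (mod1 N) \<and>
     f2 \<in> graded_hom {2} (mod2 M) (mod2 N) \<and>
     f12 \<in> graded_hom {1, 2} (mod12 M) (mod12 N) \<and>
     (\<forall>x\<in>carrier (mod1 M). f12 (map1 M x) = map1 N (f1 x)) \<and>
     (\<forall>x\<in>carrier (mod2 M). f12 (map2 M x) = map2 N (f2 x))}"

definition LK2_isomorphic ::
  "('k::field laurent, 'a, 'b, 'c) LK2_object \<Rightarrow> ('k laurent, 'd, 'e, 'f) LK2_object \<Rightarrow> bool" where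
  "LK2_isomorphic M N \<longleftrightarrow>
     (\<exists>f1 f2 f12 g1 g2 g12. (f1, f2, f12) \<in> LK2_hom M N \<and> (g1, g2, g12) \<in> LK2_hom N M \<and>
        (\<forall>x\<in>carrier (mod1 M). g1 (f1 x) = x) \<and> (\<forall>y\<in>carrier (mod1 N). f1 (g1 y) = y) \<and>
        (\<forall>x\<in>carrier (mod2 M). g2 (f2 x) = x) \<and> (\<forall>y\<in>carrier (mod2 N). f2 (g2 y) = y) \<and>
        (\<forall>x\<in>carrier (mod12 M). g12 (f12 x) = x) \<and> (\<forall>y\<in>carrier (mod12 N). f12 (g12 y) = y))"

definition LK2_torsion_free :: "('k::field laurent, 'a, 'b, 'c) LK2_object \<Rightarrow> bool" where
  "LK2_torsion_free M \<longleftrightarrow>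
     inj_on (\<lambda>x. Poly_Mapping.single (0, 1) 1 \<odot>\<^bsub>mod1 M\<^esub> x) (carrier (mod1 M)) \<and>
     inj_on (\<lambda>x. Poly_Mapping.single (1, 0) 1 \<odot>\<^bsub>mod2 M\<^esub> x) (carrier (mod2 M))"

definition L_functor ::
  "('k::field laurent, 'm) gmodule \<Rightarrow>
     ('k laurent, (('k laurent \<times> 'm) \<Rightarrow>\<^sub>0 int) set, (('k laurent \<times> 'm) \<Rightarrow>\<^sub>0 int) set,
      (('k laurent \<times> 'm) \<Rightarrow>\<^sub>0 int) set) LK2_object" where
  "L_functor A =
     \<lparr>mod1 = ext_scalars {} {1} A, mod2 = ext_scalars {} {2} A, mod12 = ext_scalars {} {1, 2} A,
      map1 = ext_map {} {1, 2} A, map2 = ext_map {} {1, 2} A\<rparr>"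

definition int_deg :: "nat \<times> nat \<Rightarrow> int \<times> int" where
  "int_deg d = (int (fst d), int (snd d))"

text \<open>The dimension over \<open>k\<close> of a \<open>k\<close>-subspace \<open>W\<close> of \<open>A\<close>, where \<open>c \<in> k\<close> acts as the constant
  polynomial \<open>c\<close>.\<close>

definition dim_k :: "('k::field laurent, 'm) gmodule \<Rightarrow> 'm set \<Rightarrow> nat" where
  "dim_k A W = vectorspace.dim (class_ring :: 'k ring)
     \<lparr>carrier = W, mult = undefined, one = undefined, zero = \<zero>\<^bsub>A\<^esub>, add = (\<oplus>\<^bsub>A\<^esub>),
      smult = (\<lambda>c x. Poly_Mapping.single 0 c \<odot>\<^bsub>A\<^esub> x)\<rparr>"

text \<open>The image of \<open>t\<^bsup>c-a\<^esup> : A(a) \<rightarrow> A(c)\<close>, and \<open>irk\<close>; both are meaningful for \<open>a \<le> c\<close>, \<open>b \<le> c\<close> only.\<close>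

definition mon_image ::
  "('k::field laurent, 'm) gmodule \<Rightarrow> nat \<times> nat \<Rightarrow> nat \<times> nat \<Rightarrow> 'm set" where
  "mon_image A a c =
     (\<lambda>x. Poly_Mapping.single (int_deg c - int_deg a) 1 \<odot>\<^bsub>A\<^esub> x) ` hpart A (int_deg a)"

definition irk ::
  "('k::field laurent, 'm) gmodule \<Rightarrow> nat \<times> nat \<Rightarrow> nat \<times> nat \<Rightarrow> nat \<times> nat \<Rightarrow> nat" where
  "irk A a b c = dim_k A (mon_image A a c \<inter> mon_image A b c)"

definition sirk :: "('k::field laurent, 'm) gmodule \<Rightarrow> nat \<times> nat \<Rightarrow> nat" where
  "sirk A = (\<lambda>(a1, b2).
     Lim (sequentially \<times>\<^sub>F sequentially) (\<lambda>(a2, b1).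
       Lim (sequentially \<times>\<^sub>F sequentially) (\<lambda>(c1, c2). irk A (a1, a2) (b1, b2) (c1, c2))))"

text \<open>\<open>sirk\<close> of an object \<open>M\<close> is \<open>sirk A\<close> for any finitely generated \<open>A\<close> with \<open>L(A) \<cong> M\<close>; such \<open>A\<close> exist
  as \<open>L\<close> is essentially surjective, and \<open>sirk A\<close> does not depend on the choice of \<open>A\<close>.  The carrier of \<open>A\<close> may be taken in the fixed type
  \<open>nat \<Rightarrow> 'k laurent\<close>: a finitely generated \<open>R\<close>-module is a quotient of some \<open>R\<^sup>n\<close>, hence injects as a
  set into \<open>R\<^sup>n\<close>, hence into this type, and its structure can be transported along the injection.\<close>

definition sirk_obj :: "('k::field laurent, 'a, 'b, 'c) LK2_object \<Rightarrow> nat \<times> nat \<Rightarrow> nat" where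
  "sirk_obj M = sirk (SOME A :: ('k laurent, nat \<Rightarrow> 'k laurent) gmodule.
     fg_graded_module {} A \<and> LK2_isomorphic (L_functor A) M)"

end

theory Submission
  imports Defs "HOL-Library.Function_Algebras"
begin

text \<open>Let \<open>V\<close> be the part of degree \<open>0\<close> of \<open>M\<^sub>1\<^sub>2\<close>, a finite-dimensional vector space.  The structure maps of
  \<open>M\<close> are localizations, hence injective when \<open>M\<close> is torsion-free, so multiplication by \<open>t\<^sup>-\<^sup>d\<close> embeds
  \<open>M\<^sub>1(d)\<close> and \<open>M\<^sub>2(d)\<close> into \<open>V\<close>.  As \<open>t\<^sub>1\<close> is invertible on \<open>M\<^sub>1\<close>, the image of \<open>M\<^sub>1(d)\<close> depends on the second
  coordinate of \<open>d\<close> only: \<open>M\<^sub>1\<close> amounts to an increasing exhaustive filtration \<open>F\<^sub>1\<close> of \<open>V\<close>, and \<open>M\<^sub>2\<close> to a second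
  one, \<open>F\<^sub>2\<close>.  Conversely, a linear isomorphism of the spaces \<open>V\<close> that respects both filtrations extends
  to an isomorphism of objects (\<open>graded_iso_of_deg0_iso\<close>).

  Two filtrations of one finite-dimensional space always have a common adapted basis
  (\<open>adapted_basis_exists\<close>).  Each basis vector has a level in either filtration, and \<open>dim (F\<^sub>2 i \<inter> F\<^sub>1 j)\<close>
  counts the basis vectors of levels at most \<open>i\<close> and \<open>j\<close>.  These dimensions therefore determine the
  number of basis vectors of every bilevel, and so the pair of filtrations up to isomorphism
  (\<open>filtration_pair_iso\<close>).

  It remains to see that \<open>sirk\<^sub>M(i, j) = dim (F\<^sub>2 i \<inter> F\<^sub>1 j)\<close>.  Let \<open>L(A)\<close> be isomorphic to \<open>M\<close>.  For large
  \<open>c\<close> the map \<open>A(c) \<rightarrow> V\<close> is injective, which turns the intersection of the images of \<open>A(a)\<close> and \<open>A(b)\<close> in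
  \<open>A(c)\<close> into the intersection of their images in \<open>V\<close> (\<open>irk_eventually\<close>).  When \<open>a\<^sub>2\<close> grows, the image of
  \<open>A(a\<^sub>1, a\<^sub>2)\<close> grows to \<open>F\<^sub>2 a\<^sub>1\<close>, because \<open>M\<^sub>2\<close> is the localization of \<open>A\<close> at \<open>t\<^sub>2\<close>, and it gets there after
  finitely many steps, because \<open>V\<close> is finite-dimensional (\<open>deg0_image_stabilises\<close>); likewise for \<open>b\<^sub>1\<close>.

  Since \<open>sirk\<close> of an object is defined through the choice of a module \<open>A\<close>, such an \<open>A\<close> has to exist on the
  prescribed type.  One takes \<open>A(d) = F\<^sub>2(d\<^sub>1) \<inter> F\<^sub>1(d\<^sub>2)\<close>, placed in degree \<open>d\<close> of a power of
  \<open>k[t\<^sub>1\<^sup>\<plusminus>\<^sup>1, t\<^sub>2\<^sup>\<plusminus>\<^sup>1]\<close> by means of coordinates on \<open>V\<close>; this is the intersection of \<open>M\<^sub>1\<close> and \<open>M\<^sub>2\<close> inside \<open>M\<^sub>1\<^sub>2\<close>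
  (\<open>model_exists\<close>).

  Throughout, tensor products are handled through one criterion: \<open>R\<^sub>\<tau> \<otimes> A\<close> is the localization of \<open>A\<close> at the
  variables that become invertible (\<open>localizes_of_graded_iso\<close>, \<open>graded_iso_of_localizes\<close>).\<close>

section \<open>Pairs of filtrations of a vector space\<close>

context vector_space
begin

lemma finite_basis_of_subset:
  assumes "finite X" "S \<subseteq> span X"
  obtains B where "finite B" "B \<subseteq> S" "independent B" "S \<subseteq> span B"
proof -
  obtain B where B: "B \<subseteq> S" "independent B" "S \<subseteq> span B"
    using basis_exists by metis
  then have "finite B" using independent_span_bound[OF assms(1)] assms(2) by blast
  with B show thesis using that by blast
qed

text \<open>The union of the chain is a subspace with a finite basis, and finitely many vectors of an increasing
  union lie in one of its members.\<close>

lemma subspace_chain_stabilises: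
  assumes sub: "\<And>n::nat. subspace (S n)" and mono: "mono S"
    and X: "finite X" "\<And>n. S n \<subseteq> span X"
  shows "\<exists>N. \<forall>n. S n \<subseteq> S N"
proof -
  obtain B where B: "finite B" "B \<subseteq> (\<Union>n. S n)" "(\<Union>n. S n) \<subseteq> span B"
  proof (rule finite_basis_of_subset[OF X(1)])
    show "(\<Union>n. S n) \<subseteq> span X" using X(2) by blast
  qed
  have "\<exists>N. B \<subseteq> S N"
    using B(1,2)
  proof (induction B)
    case (insert b B)
    then obtain N where N: "B \<subseteq> S N" by blast
    from insert obtain M where M: "b \<in> S M" by blast
    have "S N \<subseteq> S (max M N)" "S M \<subseteq> S (max M N)" using mono by (auto simp: mono_def)
    with N M show ?case by (intro exI[of _ "max M N"]) blast
  qed simp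
  then obtain N where "B \<subseteq> S N" by blast
  then have "span B \<subseteq> S N" by (intro span_minimal sub)
  with B(3) show ?thesis by blast
qed

text \<open>One step in the construction of an adapted basis: adjoining \<open>v\<close> keeps \<open>B\<close> adapted to \<open>S\<close> as soon as \<open>v\<close>
  lies in \<open>S\<close>, or no new vector of \<open>S\<close> enters the span.\<close>

lemma adapted_insert:
  assumes ad: "span B \<inter> S \<subseteq> span (B \<inter> S)" and S: "subspace S"
    and v: "v \<in> S \<or> span (insert v B) \<inter> S \<subseteq> span B"
  shows "span (insert v B) \<inter> S \<subseteq> span (insert v B \<inter> S)"
proof
  fix x assume x: "x \<in> span (insert v B) \<inter> S"
  show "x \<in> span (insert v B \<inter> S)"
  proof (cases "v \<in> S")
    case True
    from x obtain k where k: "x - k *s v \<in> span B" using span_breakdown_eq by blast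
    have "x - k *s v \<in> S" using S x True by (auto intro: subspace_diff subspace_scale)
    with ad k have "x - k *s v \<in> span (B \<inter> S)" by blast
    then have "x \<in> span (insert v (B \<inter> S))" using span_breakdown_eq by blast
    with True show ?thesis by simp
  next
    case False
    with v x ad have "x \<in> span (B \<inter> S)" by blast
    then show ?thesis by (rule rev_subsetD) (intro span_mono, auto)
  qed
qed

text \<open>Choose an independent set \<open>B\<close> of maximal size among those that are adapted to all \<open>F i \<inter> G j\<close> and whose span
  is comparable with every \<open>F i\<close>.  If its span were not all of \<open>E\<close>, take the lexicographically least
  \<open>(i, j)\<close> with \<open>F i \<inter> G j\<close> not in the span, and adjoin a vector of \<open>F i \<inter> G j\<close>.  By minimality of \<open>(i, j)\<close> the larger
  set still qualifies.\<close>

lemma adapted_basis_exists: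
  assumes F: "\<And>i::nat. subspace (F i)" "mono F" "F n = E"
    and G: "\<And>j::nat. subspace (G j)" "mono G" "G m = E"
    and sub: "\<And>i. F i \<subseteq> E" "\<And>j. G j \<subseteq> E"
    and X: "finite X" "E \<subseteq> span X"
  obtains B where "finite B" "independent B" "B \<subseteq> E"
    "\<And>i j. F i \<inter> G j \<subseteq> span (B \<inter> (F i \<inter> G j))"
proof -
  define good where "good B \<longleftrightarrow> independent B \<and> B \<subseteq> E \<and>
      (\<forall>i. F i \<subseteq> span B \<or> span B \<subseteq> F i) \<and>
      (\<forall>i j. span B \<inter> (F i \<inter> G j) \<subseteq> span (B \<inter> (F i \<inter> G j)))" for B
  have bound: "finite B \<and> card B \<le> card X" if "good B" for B
    using that X independent_span_bound[OF X(1), of B] unfolding good_def by blast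
  have g0: "good {}"
    using F(1) unfolding good_def by (auto simp: subspace_0 independent_empty)
  obtain B where B: "good B" and max: "\<And>C. good C \<Longrightarrow> card C \<le> card B"
    using ex_has_greatest_nat[of good "{}" card "Suc (card X)"] g0 bound le_imp_less_Suc by blast
  have E: "subspace E" using F(1,3) by metis
  have "E \<subseteq> span B"
  proof (rule ccontr)
    assume no: "\<not> E \<subseteq> span B"
    then have "\<exists>i. \<not> F i \<subseteq> span B" using F(3) by metis
    define i where "i = (LEAST i. \<not> F i \<subseteq> span B)"
    have i: "\<not> F i \<subseteq> span B" unfolding i_def by (rule LeastI_ex) fact
    have il: "F i' \<subseteq> span B" if "i' < i" for i'
      using not_less_Least[of i' "\<lambda>i. \<not> F i \<subseteq> span B"] that unfolding i_def by blast
    have "\<exists>j. \<not> F i \<inter> G j \<subseteq> span B" using i G(3) sub(1) by (metis inf.absorb1)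
    define j where "j = (LEAST j. \<not> F i \<inter> G j \<subseteq> span B)"
    have j: "\<not> F i \<inter> G j \<subseteq> span B" unfolding j_def by (rule LeastI_ex) fact
    have jl: "F i \<inter> G j' \<subseteq> span B" if "j' < j" for j'
      using not_less_Least[of j' "\<lambda>j. \<not> F i \<inter> G j \<subseteq> span B"] that unfolding j_def by blast
    from j obtain v where v: "v \<in> F i" "v \<in> G j" "v \<notin> span B" by blast
    \<comment> \<open>Comparability with \<open>F i\<close> is what keeps the enlarged span inside \<open>F i\<close>: an \<open>F l\<close> either contains \<open>F i\<close>, hence
      the whole span, or precedes \<open>i\<close> and gains no vector.\<close>
    have BF: "span B \<subseteq> F i" using B i unfolding good_def by blast
    then have BvF: "span (insert v B) \<subseteq> F i"
      using v(1) F(1) span_superset by (intro span_minimal) blast+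
    have "good (insert v B)"
      unfolding good_def
    proof (intro conjI allI)
      show "independent (insert v B)"
        using B v(3) unfolding good_def by (simp add: independent_insertI)
      show "insert v B \<subseteq> E" using B v sub unfolding good_def by blast
      fix i'
      show "F i' \<subseteq> span (insert v B) \<or> span (insert v B) \<subseteq> F i'"
      proof (cases "i' < i")
        case True
        then show ?thesis using il span_mono[of B "insert v B"] by blast
      next
        case False
        then have "F i \<subseteq> F i'" using F(2) by (auto simp: mono_def)
        then show ?thesis using BvF by blast
      qed
      fix j'
      show "span (insert v B) \<inter> (F i' \<inter> G j') \<subseteq> span (insert v B \<inter> (F i' \<inter> G j'))"
      proof (rule adapted_insert)
        show "span B \<inter> (F i' \<inter> G j') \<subseteq> span (B \<inter> (F i' \<inter> G j'))"
          using B unfolding good_def by blast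
        show "subspace (F i' \<inter> G j')" by (intro subspace_inter F G)
        show "v \<in> F i' \<inter> G j' \<or> span (insert v B) \<inter> (F i' \<inter> G j') \<subseteq> span B"
        proof (cases "i' < i \<or> j' < j")
          case True
          then show ?thesis using il jl BvF by blast
        next
          case False
          then have "F i \<subseteq> F i'" "G j \<subseteq> G j'" using F(2) G(2) by (auto simp: mono_def)
          with v show ?thesis by blast
        qed
      qed
    qed
    then have "card (insert v B) \<le> card B" by (rule max)
    moreover have "v \<notin> B" using v(3) span_base by blast
    ultimately show False using bound[OF B] by simp
  qed
  then have "F i \<inter> G j \<subseteq> span (B \<inter> (F i \<inter> G j))" for i j
    using B sub unfolding good_def by blast
  with B bound[OF B] show thesis unfolding good_def by (intro that) auto
qed

end

text \<open>Moebius inversion on \<open>\<nat> \<times> \<nat>\<close>, by induction on the sum of the two coordinates: a lower rectangle consists of its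
  top corner and of points with a smaller sum.\<close>

lemma cumulative_counts_determine_fibres:
  fixes p :: "'b \<Rightarrow> nat \<times> nat" and q :: "'c \<Rightarrow> nat \<times> nat"
  assumes fin: "finite B" "finite C"
    and eq: "\<And>i j. card {b\<in>B. fst (p b) \<le> i \<and> snd (p b) \<le> j} =
                     card {c\<in>C. fst (q c) \<le> i \<and> snd (q c) \<le> j}"
  shows "card {b\<in>B. p b = z} = card {c\<in>C. q c = z}"
proof -
  have split: "card {b\<in>B. fst (p b) \<le> i \<and> snd (p b) \<le> j} =
      (\<Sum>w\<in>{..i} \<times> {..j}. card {b\<in>B. p b = w})"
    if "finite B" for B :: "'x set" and p :: "'x \<Rightarrow> nat \<times> nat" and i j
  proof -
    have "{b\<in>B. fst (p b) \<le> i \<and> snd (p b) \<le> j} = (\<Union>w\<in>{..i} \<times> {..j}. {b\<in>B. p b = w})"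
    proof  (intro Set.set_eqI)
      fix b
      obtain k l where "p b = (k, l)" by fastforce
      then show "b \<in> {b\<in>B. fst (p b) \<le> i \<and> snd (p b) \<le> j} \<longleftrightarrow>
          b \<in> (\<Union>w\<in>{..i} \<times> {..j}. {b\<in>B. p b = w})" by simp
    qed
    then show ?thesis using that by (simp add: card_UN_disjoint disjoint_iff)
  qed
  show ?thesis
  proof (induction "fst z + snd z" arbitrary: z rule: less_induct)
    case less
    obtain i j where z: "z = (i, j)" by fastforce
    have IH: "card {b\<in>B. p b = w} = card {c\<in>C. q c = w}" if "w \<in> {..i} \<times> {..j} - {z}" for w
      using that z by (intro less) auto
    have "card {b\<in>B. p b = z} + (\<Sum>w\<in>{..i} \<times> {..j} - {z}. card {b\<in>B. p b = w}) =
          card {c\<in>C. q c = z} + (\<Sum>w\<in>{..i} \<times> {..j} - {z}. card {c\<in>C. q c = w})"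
      using eq[of i j] unfolding split[OF fin(1)] split[OF fin(2)]
      by (subst (asm) (1 2) sum.remove[of _ z]) (auto simp: z)
    then show ?case using IH by simp
  qed
qed

lemma bij_betw_of_fibre_cards:
  assumes fin: "finite B" "finite C"
    and eq: "\<And>z. card {b\<in>B. p b = z} = card {c\<in>C. q c = z}"
  obtains \<pi> where "bij_betw \<pi> B C" "\<And>b. b \<in> B \<Longrightarrow> q (\<pi> b) = p b"
proof -
  have "\<forall>z. \<exists>h. bij_betw h {b\<in>B. p b = z} {c\<in>C. q c = z}"
    using fin eq by (intro allI finite_same_card_bij) auto
  then obtain h where h: "\<And>z. bij_betw (h z) {b\<in>B. p b = z} {c\<in>C. q c = z}" by metis
  define \<pi> where "\<pi> b = h (p b) b" for b
  have \<pi>: "\<pi> b \<in> C \<and> q (\<pi> b) = p b" if "b \<in> B" for b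
    using bij_betwE[OF h[of "p b"]] that by (auto simp: \<pi>_def)
  have "bij_betw \<pi> B C"
    unfolding bij_betw_def
  proof
    show "inj_on \<pi> B"
    proof (rule inj_onI)
      fix x y assume xy: "x \<in> B" "y \<in> B" "\<pi> x = \<pi> y"
      then have "p x = p y" using \<pi> by metis
      then show "x = y" using xy h[of "p y"]
        by (auto simp: bij_betw_def \<pi>_def inj_on_def)
    qed
    have "c \<in> \<pi> ` B" if "c \<in> C" for c
    proof -
      have "c \<in> h (q c) ` {b\<in>B. p b = q c}" using h[of "q c"] that by (auto simp: bij_betw_def)
      then show ?thesis by (force simp: \<pi>_def)
    qed
    then show "\<pi> ` B = C" using \<pi> by blast
  qed
  then show thesis using \<pi> that by blast
qed

text \<open>Adapted bases of both sides have, by \<open>cumulative_counts_determine_fibres\<close>, equally many vectors of each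
  bilevel; a bijection of the bases that preserves bilevels extends linearly to the required map.\<close>

lemma (in vector_space) filtration_pair_iso:
  assumes F: "\<And>i::nat. subspace (F i)" "mono F" "F n = E" "\<And>i. F i \<subseteq> E"
    and G: "\<And>j::nat. subspace (G j)" "mono G" "G m = E" "\<And>j. G j \<subseteq> E"
    and X: "finite X" "E \<subseteq> span X"
    and F': "\<And>i::nat. subspace (F' i)" "mono F'" "F' n' = E'" "\<And>i. F' i \<subseteq> E'"
    and G': "\<And>j::nat. subspace (G' j)" "mono G'" "G' m' = E'" "\<And>j. G' j \<subseteq> E'"
    and X': "finite X'" "E' \<subseteq> span X'"
    and dim: "\<And>i j. dim (F i \<inter> G j) = dim (F' i \<inter> G' j)"
  obtains \<theta> where "Vector_Spaces.linear scale scale \<theta>" "inj_on \<theta> E" "\<theta> ` E = E'"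
    "\<And>i. \<theta> ` F i = F' i" "\<And>j. \<theta> ` G j = G' j"
proof -
  interpret vv: vector_space_pair scale scale ..
  define lev where "lev F G b = (LEAST i. b \<in> F i, LEAST j. b \<in> G j)"
    for F G :: "nat \<Rightarrow> 'b set" and b
  have lev: "b \<in> F i \<inter> G j \<longleftrightarrow> fst (lev F G b) \<le> i \<and> snd (lev F G b) \<le> j"
    if "b \<in> F n" "b \<in> G m" "mono F" "mono G" for F G b i j n m
  proof -
    have "b \<in> F (LEAST i. b \<in> F i)" "b \<in> G (LEAST j. b \<in> G j)"
      using that(1,2) by (auto intro: LeastI)
    then show ?thesis
      using monoD[OF that(3)] monoD[OF that(4)] unfolding lev_def
      by (auto intro: Least_le) blast+
  qed
  obtain B where B: "finite B" "independent B" "B \<subseteq> E"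
    "\<And>i j. F i \<inter> G j \<subseteq> span (B \<inter> (F i \<inter> G j))"
    using adapted_basis_exists[OF F(1-3) G(1-3) F(4) G(4) X] by metis
  obtain B' where B': "finite B'" "independent B'" "B' \<subseteq> E'"
    "\<And>i j. F' i \<inter> G' j \<subseteq> span (B' \<inter> (F' i \<inter> G' j))"
    using adapted_basis_exists[OF F'(1-3) G'(1-3) F'(4) G'(4) X'] by metis
  have levB: "b \<in> F i \<inter> G j \<longleftrightarrow> fst (lev F G b) \<le> i \<and> snd (lev F G b) \<le> j" if "b \<in> B" for b i j
    using that B(3) F(2,3) G(2,3) by (intro lev[of b F n G m]) auto
  have levB': "b \<in> F' i \<inter> G' j \<longleftrightarrow> fst (lev F' G' b) \<le> i \<and> snd (lev F' G' b) \<le> j" if "b \<in> B'" for b i j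
    using that B'(3) F'(2,3) G'(2,3) by (intro lev[of b F' n' G' m']) auto
  have card: "card {b\<in>B. fst (lev F G b) \<le> i \<and> snd (lev F G b) \<le> j} =
    card {c\<in>B'. fst (lev F' G' c) \<le> i \<and> snd (lev F' G' c) \<le> j}" for i j
  proof -
    have "{b\<in>B. fst (lev F G b) \<le> i \<and> snd (lev F G b) \<le> j} = B \<inter> (F i \<inter> G j)"
      using levB by blast
    moreover have "{b\<in>B'. fst (lev F' G' b) \<le> i \<and> snd (lev F' G' b) \<le> j} = B' \<inter> (F' i \<inter> G' j)"
      using levB' by blast
    moreover have "card (B \<inter> (F i \<inter> G j)) = dim (F i \<inter> G j)"
      using B independent_mono by (intro basis_card_eq_dim) blast+
    moreover have "card (B' \<inter> (F' i \<inter> G' j)) = dim (F' i \<inter> G' j)"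
      using B' independent_mono by (intro basis_card_eq_dim) blast+
    ultimately show ?thesis using dim by metis
  qed
  obtain \<pi> where \<pi>: "bij_betw \<pi> B B'" "\<And>b. b \<in> B \<Longrightarrow> lev F' G' (\<pi> b) = lev F G b"
    using bij_betw_of_fibre_cards[OF B(1) B'(1) cumulative_counts_determine_fibres[OF B(1) B'(1) card]]
    by metis
  obtain \<theta> where \<theta>: "Vector_Spaces.linear scale scale \<theta>" "\<And>b. b \<in> B \<Longrightarrow> \<theta> b = \<pi> b"
    using vv.linear_independent_extend[OF B(2)] by metis
  have im: "\<theta> ` (F i \<inter> G j) = F' i \<inter> G' j" for i j
  proof -
    have "F i \<inter> G j = span (B \<inter> (F i \<inter> G j))"
      using B(4) by (intro antisym span_minimal subspace_inter F G) auto
    then have "\<theta> ` (F i \<inter> G j) = \<theta> ` span (B \<inter> (F i \<inter> G j))" by simp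
    also have "\<dots> = span (\<theta> ` (B \<inter> (F i \<inter> G j)))" using vv.linear_span_image[OF \<theta>(1)] by simp
    also have "\<theta> ` (B \<inter> (F i \<inter> G j)) = \<pi> ` (B \<inter> (F i \<inter> G j))" using \<theta>(2) by auto
    also have "\<dots> = B' \<inter> (F' i \<inter> G' j)"
    proof -
      have "\<pi> b \<in> F' i \<inter> G' j \<longleftrightarrow> b \<in> F i \<inter> G j" if "b \<in> B" for b
        using levB[OF that] levB'[of "\<pi> b"] \<pi> that bij_betwE by metis
      then show ?thesis using \<pi>(1) unfolding bij_betw_def by blast
    qed
    also have "span \<dots> = F' i \<inter> G' j"
      using B'(4) by (intro antisym span_minimal subspace_inter F' G') auto
    finally show ?thesis .
  qed
  \<comment> \<open>Both sides are exhausted at a common index, which recovers the single filtrations from the intersections.\<close>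
  have FE: "F i = F i \<inter> G (max m m')" "F' i = F' i \<inter> G' (max m m')" for i
    using monoD[OF G(2), of m "max m m'"] G(3) F(4)[of i]
      monoD[OF G'(2), of m' "max m m'"] G'(3) F'(4)[of i] by auto
  have GE: "G i = F (max n n') \<inter> G i" "G' i = F' (max n n') \<inter> G' i" for i
    using monoD[OF F(2), of n "max n n'"] F(3) G(4)[of i]
      monoD[OF F'(2), of n' "max n n'"] F'(3) G'(4)[of i] by auto
  have \<theta>F: "\<theta> ` F i = F' i" for i using im FE by metis
  have \<theta>G: "\<theta> ` G i = G' i" for i using im GE by metis
  have FM: "F (max n n') = E" "F' (max n n') = E'"
    using monoD[OF F(2), of n "max n n'"] F(3) F(4)[of "max n n'"]
      monoD[OF F'(2), of n' "max n n'"] F'(3) F'(4)[of "max n n'"] by auto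
  have "inj_on \<theta> (span B)"
  proof (rule vv.linear_inj_on_span_independent_image[OF \<theta>(1)])
    have "\<theta> ` B = B'" using \<pi>(1) \<theta>(2) by (auto simp: bij_betw_def)
    then show "independent (\<theta> ` B)" using B'(2) by simp
    show "inj_on \<theta> B" using \<pi>(1) \<theta>(2) by (auto simp: bij_betw_def inj_on_def)
  qed
  moreover have "E \<subseteq> span B" 
    using B(4)[of n m] F(3) G(3) span_mono[of "B \<inter> E" B] by auto
  ultimately have "inj_on \<theta> E" using inj_on_subset by blast
  then show thesis using \<theta>(1) \<theta>F \<theta>G FM that by metis
qed

section \<open>Coordinates\<close>

definition kscale :: "'k::field \<Rightarrow> (nat \<Rightarrow> 'k) \<Rightarrow> nat \<Rightarrow> 'k" where
  "kscale c f = (\<lambda>i. c * f i)"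

lemma vector_space_kscale: "Vector_Spaces.vector_space (kscale :: 'k::field \<Rightarrow> _)"
  by unfold_locales (auto simp: kscale_def fun_eq_iff algebra_simps)

interpretation kv: vector_space "kscale :: 'k::field \<Rightarrow> _"
  by (rule vector_space_kscale)

definition unit_vec :: "nat \<Rightarrow> nat \<Rightarrow> 'k::field" where
  "unit_vec i = (\<lambda>j. if j = i then 1 else 0)"

lemma sum_fun_apply: "(\<Sum>a\<in>A. f a) i = (\<Sum>a\<in>A. f a i)"
  for f :: "'b \<Rightarrow> nat \<Rightarrow> 'k::comm_monoid_add"
  by (induction A rule: infinite_finite_induct) auto

lemma finite_coordinates_span:
  "{f. \<forall>i\<ge>n. f i = 0} \<subseteq> kv.span ((unit_vec :: nat \<Rightarrow> nat \<Rightarrow> 'k::field) ` {..<n})"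
proof
  fix f :: "nat \<Rightarrow> 'k" assume f: "f \<in> {f. \<forall>i\<ge>n. f i = 0}"
  have "f = (\<Sum>i<n. kscale (f i) (unit_vec i))"
  proof
    fix j
    have "(\<Sum>i<n. kscale (f i) (unit_vec i)) j = (\<Sum>i<n. if j = i then f j else 0)"
      by (simp add: kscale_def unit_vec_def sum_fun_apply if_distrib cong: if_cong)
    also have "\<dots> = f j" using f by simp
    finally show "f j = (\<Sum>i<n. kscale (f i) (unit_vec i)) j" by simp
  qed
  also have "\<dots> \<in> kv.span (unit_vec ` {..<n})"
    by (intro kv.span_sum kv.span_scale kv.span_base) auto
  finally show "f \<in> kv.span (unit_vec ` {..<n})" .
qed

text \<open>Vector spaces that occur as carriers of records are compared inside the single type \<open>nat \<Rightarrow> 'k\<close>, on which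
  subspaces of different spaces, their bases and their dimensions can be handled together.\<close>

locale linear_coordinates = vectorspace "class_ring :: 'k::field ring" V
  for V :: "('k::field, 'm) module" +
  fixes \<phi> :: "'m \<Rightarrow> nat \<Rightarrow> 'k"
  assumes add: "\<lbrakk>v \<in> carrier V; w \<in> carrier V\<rbrakk> \<Longrightarrow> \<phi> (v \<oplus>\<^bsub>V\<^esub> w) = \<phi> v + \<phi> w"
    and scale: "v \<in> carrier V \<Longrightarrow> \<phi> (c \<odot>\<^bsub>V\<^esub> v) = kscale c (\<phi> v)"
    and inj: "inj_on \<phi> (carrier V)"
begin

lemma zero: "\<phi> \<zero>\<^bsub>V\<^esub> = 0"
  using add[of "\<zero>\<^bsub>V\<^esub>" "\<zero>\<^bsub>V\<^esub>"] by simp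

lemma image_lincomb:
  assumes "finite A" "A \<subseteq> carrier V"
  shows "\<phi> (lincomb a A) = (\<Sum>v\<in>A. kscale (a v) (\<phi> v))"
  using assms
proof (induction A)
  case empty
  then show ?case by (simp add: lincomb_def zero)
next
  case (insert v A)
  have "lincomb a (insert v A) = (a v \<odot>\<^bsub>V\<^esub> v) \<oplus>\<^bsub>V\<^esub> lincomb a A"
    using lincomb_insert[of A a v] insert by simp
  then show ?case using insert by (simp add: add scale)
qed

text \<open>A finite basis of the image pulls back, by injectivity, to a basis of the space itself.\<close>

lemma dim_eq:
  assumes X: "finite X" "\<phi> ` carrier V \<subseteq> kv.span X"
  shows "dim = kv.dim (\<phi> ` carrier V)"
proof -
  obtain C where C: "finite C" "C \<subseteq> \<phi> ` carrier V" "kv.independent C" "\<phi> ` carrier V \<subseteq> kv.span C"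
    using kv.finite_basis_of_subset[OF X] by metis
  from C(2) obtain B where B: "B \<subseteq> carrier V" "C = \<phi> ` B" by (meson subset_imageE)
  then have injB: "inj_on \<phi> B" using inj inj_on_subset by blast
  then have fin: "finite B" using B(2) C(1) finite_image_iff by blast
  have card: "card C = card B" using B(2) injB by (simp add: card_image)
  have reindex: "(\<Sum>c\<in>C. kscale (r c) c) = (\<Sum>b\<in>B. kscale (r (\<phi> b)) (\<phi> b))" for r
    unfolding B(2) by (simp add: sum.reindex[OF injB])
  have "lin_indpt B"
  proof (rule finite_lin_indpt2[OF fin B(1)])
    fix a assume "lincomb a B = \<zero>\<^bsub>V\<^esub>"
    then have "(\<Sum>b\<in>B. kscale (a b) (\<phi> b)) = 0"
      using image_lincomb[OF fin B(1), of a] zero by simp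
    then have "(\<Sum>c\<in>C. kscale (a (the_inv_into B \<phi> c)) c) = 0"
      unfolding reindex by (simp add: the_inv_into_f_f[OF injB])
    from kv.independentD[OF C(3,1) subset_refl this]
    have "\<forall>c\<in>C. a (the_inv_into B \<phi> c) = 0" by blast
    then show "\<forall>v\<in>B. a v = \<zero>\<^bsub>class_ring\<^esub>"
      using B(2) by (simp add: the_inv_into_f_f[OF injB])
  qed
  moreover have "span B = carrier V"
  proof
    show "span B \<subseteq> carrier V" using B(1) by (rule span_is_subset2)
    show "carrier V \<subseteq> span B"
    proof
      fix v assume v: "v \<in> carrier V"
      then have "\<phi> v \<in> kv.span C" using C(4) by blast
      then obtain r where "\<phi> v = (\<Sum>c\<in>C. kscale (r c) c)" unfolding kv.span_finite[OF C(1)] by blast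
      then have "\<phi> v = \<phi> (lincomb (\<lambda>b. r (\<phi> b)) B)"
        using reindex[of r] image_lincomb[OF fin B(1)] by simp
      then have "v = lincomb (\<lambda>b. r (\<phi> b)) B" using inj v B(1) by (auto dest: inj_onD)
      then show "v \<in> span B" using fin by (auto simp: span_def)
    qed
  qed
  ultimately have "basis B" using B(1) by (simp add: basis_def)
  then have "dim = card B" by (rule dim_basis[OF fin])
  also have "\<dots> = kv.dim (\<phi> ` carrier V)"
    using kv.basis_card_eq_dim[OF C(2,4,3)] card by simp
  finally show ?thesis .
qed

end

text \<open>The coordinates with respect to an enumerated basis, continued by \<open>0\<close>.\<close>

lemma linear_coordinates_exist:
  fixes V :: "('k::field, 'm) module"
  assumes vs: "vectorspace class_ring V" and fd: "vectorspace.fin_dim class_ring V"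
  obtains \<phi> n where "linear_coordinates V \<phi>" "\<And>v i. v \<in> carrier V \<Longrightarrow> n \<le> i \<Longrightarrow> \<phi> v i = 0"
proof -
  define K :: "'k ring" where K: "K = class_ring"
  interpret vectorspace K V using vs K by simp
  obtain B where B: "finite B" "basis B" using finite_basis_exists fd K by blast
  then have BV: "B \<subseteq> carrier V" by (simp add: basis_def)
  have ex1: "\<exists>!a. a \<in> B \<rightarrow>\<^sub>E carrier K \<and> lincomb a B = v" if "v \<in> carrier V" for v
    using basis_criterion[OF B(1) BV] B(2) that by blast
  define co where "co v = (THE a. a \<in> B \<rightarrow>\<^sub>E carrier K \<and> lincomb a B = v)" for v
  have co: "co v \<in> B \<rightarrow>\<^sub>E carrier K" "lincomb (co v) B = v" if "v \<in> carrier V" for v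
    using theI'[OF ex1[OF that]] unfolding co_def by auto
  have co_eq: "co v b = a b" if "v \<in> carrier V" "lincomb a B = v" "b \<in> B" for v a b
  proof -
    have "lincomb (restrict a B) B = lincomb a B" using BV K by (intro lincomb_cong) auto
    then have "co v = restrict a B"
      using ex1[OF that(1)] co[OF that(1)] that(2) K by (metis (no_types, lifting) UNIV_I partial_object.select_convs(1) restrict_PiE_iff)
    then show ?thesis using that(3) by simp
  qed
  obtain e where e: "bij_betw e {0..<card B} B" using ex_bij_betw_nat_finite[OF B(1)] by blast
  define \<phi> where "\<phi> v i = (if i < card B then co v (e i) else 0)" for v i
  have eB: "e i \<in> B" if "i < card B" for i using e that by (auto simp: bij_betw_def)
  have cB: "co v \<in> B \<rightarrow> carrier K" if "v \<in> carrier V" for v using co(1)[OF that] by auto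
  have "linear_coordinates V \<phi>"
    unfolding linear_coordinates_def linear_coordinates_axioms_def
  proof (intro conjI allI impI)
    show "vectorspace class_ring V" using vectorspace_axioms K by simp
    fix v w c assume v: "v \<in> carrier V"
    {
      assume w: "w \<in> carrier V"
      have "lincomb (\<lambda>b. co v b \<oplus>\<^bsub>K\<^esub> co w b) B = v \<oplus>\<^bsub>V\<^esub> w"
        using lincomb_sum[OF B(1) BV cB[OF v] cB[OF w]] co(2)[OF v] co(2)[OF w] by simp
      then show "\<phi> (v \<oplus>\<^bsub>V\<^esub> w) = \<phi> v + \<phi> w"
        using co_eq[of "v \<oplus>\<^bsub>V\<^esub> w"] v w eB by (auto simp: \<phi>_def K fun_eq_iff)
    }
    have "lincomb (\<lambda>b. c \<otimes>\<^bsub>K\<^esub> co v b) B = c \<odot>\<^bsub>V\<^esub> v"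
      using lincomb_smult[OF BV cB[OF v], of c] co(2)[OF v] K by simp
    then show "\<phi> (c \<odot>\<^bsub>V\<^esub> v) = kscale c (\<phi> v)"
      using co_eq[of "c \<odot>\<^bsub>V\<^esub> v"] v eB K by (auto simp: \<phi>_def kscale_def fun_eq_iff)
  next
    show "inj_on \<phi> (carrier V)"
    proof (rule inj_onI)
      fix v w assume vw: "v \<in> carrier V" "w \<in> carrier V" "\<phi> v = \<phi> w"
      have "co v b = co w b" if "b \<in> B" for b
      proof -
        obtain i where "i < card B" "b = e i" using e \<open>b \<in> B\<close> unfolding bij_betw_def by (metis atLeastLessThan_iff imageE)
        then show ?thesis using fun_cong[OF vw(3), of i] by (simp add: \<phi>_def)
      qed
      then have "lincomb (co v) B = lincomb (co w) B" using cB[OF vw(2)] by (intro lincomb_cong[OF refl BV])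
      then show "v = w" using co(2) vw by simp
    qed
  qed
  moreover have "\<phi> v i = 0" if "card B \<le> i" for v i using that by (simp add: \<phi>_def)
  ultimately show thesis using that by blast
qed

section \<open>Graded modules\<close>

text \<open>Degrees are pairs, but they are treated as elements of a group rather than by coordinates.\<close>

declare split_paired_All [simp del] split_paired_Ex [simp del]

lemma zero_in_degs [simp]: "0 \<in> degs \<sigma>"
  by (auto simp: degs_def zero_prod_def)

lemma add_in_degs [intro]: "d \<in> degs \<sigma> \<Longrightarrow> e \<in> degs \<sigma> \<Longrightarrow> d + e \<in> degs \<sigma>"
  by (auto simp: degs_def)

lemma degs_mono: "\<sigma> \<subseteq> \<tau> \<Longrightarrow> degs \<sigma> \<subseteq> degs \<tau>"
  by (auto simp: degs_def)

lemma degs_12 [simp]: "degs {1, 2} = UNIV" "degs {Suc 0, 2} = UNIV"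
  by (auto simp: degs_def)

lemma locR_simps [simp]:
  "p \<in> carrier (locR \<sigma>) \<longleftrightarrow> Poly_Mapping.keys p \<subseteq> degs \<sigma>"
  "mult (locR \<sigma>) = (*)" "one (locR \<sigma>) = 1" "zero (locR \<sigma>) = 0" "add (locR \<sigma>) = (+)"
  by (auto simp: locR_def)

lemma single_in_locR: "e \<in> degs \<sigma> \<Longrightarrow> Poly_Mapping.keys (Poly_Mapping.single e c) \<subseteq> degs \<sigma>"
  by auto

lemma add_in_locR: "Poly_Mapping.keys p \<subseteq> degs \<sigma> \<Longrightarrow> Poly_Mapping.keys q \<subseteq> degs \<sigma>
    \<Longrightarrow> Poly_Mapping.keys (p + q) \<subseteq> degs \<sigma>"
  using Poly_Mapping.keys_add[of p q] by blast

lemma mult_in_locR: "Poly_Mapping.keys p \<subseteq> degs \<sigma> \<Longrightarrow> Poly_Mapping.keys q \<subseteq> degs \<sigma>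
    \<Longrightarrow> Poly_Mapping.keys (p * q) \<subseteq> degs \<sigma>"
proof
  fix d assume p: "Poly_Mapping.keys p \<subseteq> degs \<sigma>" and q: "Poly_Mapping.keys q \<subseteq> degs \<sigma>"
    and "d \<in> Poly_Mapping.keys (p * q)"
  then obtain a b where "d = a + b" "a \<in> Poly_Mapping.keys p" "b \<in> Poly_Mapping.keys q"
    using keys_mult[of p q] by blast
  with p q show "d \<in> degs \<sigma>" by blast
qed

lemma one_in_locR: "Poly_Mapping.keys (1 :: 'k::field laurent) \<subseteq> degs \<sigma>"
  by simp

lemma cring_locR: "cring (locR \<sigma> :: 'k::field laurent ring)"
proof (rule cringI)
  show "abelian_group (locR \<sigma> :: 'k laurent ring)"
  proof (rule abelian_groupI)
    fix x :: "'k laurent" assume "x \<in> carrier (locR \<sigma>)"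
    then show "\<exists>y\<in>carrier (locR \<sigma>). y \<oplus>\<^bsub>locR \<sigma>\<^esub> x = \<zero>\<^bsub>locR \<sigma>\<^esub>"
      by (intro bexI[of _ "- x"]) simp_all
  qed (simp_all add: add_in_locR add.assoc add.commute)
  show "comm_monoid (locR \<sigma> :: 'k laurent ring)"
    by (rule comm_monoidI) (simp_all add: mult_in_locR one_in_locR mult.assoc mult.commute)
qed (simp add: algebra_simps)

lemma locR_induct [consumes 1, case_names single add]:
  fixes p :: "'k::field laurent"
  assumes p: "Poly_Mapping.keys p \<subseteq> degs \<sigma>"
    and single: "\<And>e c. e \<in> degs \<sigma> \<Longrightarrow> P (Poly_Mapping.single e c)"
    and add: "\<And>p q. \<lbrakk>Poly_Mapping.keys p \<subseteq> degs \<sigma>; Poly_Mapping.keys q \<subseteq> degs \<sigma>; P p; P q\<rbrakk> \<Longrightarrow> P (p + q)"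
  shows "P p"
proof -
  have "Poly_Mapping.keys (\<Sum>e\<in>S. Poly_Mapping.single e (Poly_Mapping.lookup p e)) \<subseteq> degs \<sigma> \<and>
      P (\<Sum>e\<in>S. Poly_Mapping.single e (Poly_Mapping.lookup p e))"
    if "finite S" "S \<subseteq> degs \<sigma>" for S
    using that
  proof (induction S)
    case empty
    then show ?case using single[of 0 0] by simp
  next
    case (insert e S)
    then show ?case
      using add_in_locR[OF single_in_locR[of e \<sigma> "Poly_Mapping.lookup p e"]]
        add[OF single_in_locR[of e \<sigma> "Poly_Mapping.lookup p e"] _ single[of e "Poly_Mapping.lookup p e"]]
      by (subst (1 2) sum.insert) blast+
  qed
  moreover have "(\<Sum>e\<in>Poly_Mapping.keys p. Poly_Mapping.single e (Poly_Mapping.lookup p e)) = p"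
    by (rule poly_mapping_eqI)
      (simp add: lookup_sum lookup_single when_def not_in_keys_iff_lookup_eq_zero)
  ultimately show ?thesis using p by (metis finite_keys)
qed

text \<open>Multiplication by the monomial \<open>t\<^sup>d\<close> and by the constant \<open>c\<close>; every \<open>R\<^sub>\<sigma>\<close>-linearity statement reduces to these
  two, as \<open>c t\<^sup>d\<close> span \<open>R\<^sub>\<sigma>\<close> additively.\<close>

definition tpow :: "('k::field laurent, 'm) gmodule \<Rightarrow> int \<times> int \<Rightarrow> 'm \<Rightarrow> 'm" where
  "tpow A d x = Poly_Mapping.single d 1 \<odot>\<^bsub>A\<^esub> x"

definition kmul :: "('k::field laurent, 'm) gmodule \<Rightarrow> 'k \<Rightarrow> 'm \<Rightarrow> 'm" where
  "kmul A c x = Poly_Mapping.single 0 c \<odot>\<^bsub>A\<^esub> x"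

definition hcomp :: "('k::field laurent, 'm) gmodule \<Rightarrow> int \<times> int \<Rightarrow> 'm \<Rightarrow> 'm" where
  "hcomp A d x = (THE f. (\<forall>d. f d \<in> hpart A d) \<and> finite {d. f d \<noteq> \<zero>\<^bsub>A\<^esub>} \<and>
               x = (\<Oplus>\<^bsub>A\<^esub>d\<in>{d. f d \<noteq> \<zero>\<^bsub>A\<^esub>}. f d)) d"

context graded_module
begin

lemma hpart_carrier: "x \<in> hpart A d \<Longrightarrow> x \<in> carrier A"
  using subgroup.subset[OF hpart_subgroup[of d]] by auto

lemma hpart_zero [simp]: "\<zero>\<^bsub>A\<^esub> \<in> hpart A d"
  using subgroup.one_closed[OF hpart_subgroup[of d]] by simp

lemma hpart_add: "x \<in> hpart A d \<Longrightarrow> y \<in> hpart A d \<Longrightarrow> x \<oplus>\<^bsub>A\<^esub> y \<in> hpart A d"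
  using subgroup.m_closed[OF hpart_subgroup[of d]] by simp

lemma kmul_closed [simp]: "x \<in> carrier A \<Longrightarrow> kmul A c x \<in> carrier A"
  by (simp add: kmul_def)

lemma tpow_closed [simp]: "e \<in> degs \<sigma> \<Longrightarrow> x \<in> carrier A \<Longrightarrow> tpow A e x \<in> carrier A"
  by (simp add: tpow_def)

lemma kmul_hpart: "x \<in> hpart A d \<Longrightarrow> kmul A c x \<in> hpart A d"
  using hpart_smult[of 0 x d c] by (simp add: kmul_def)

lemma tpow_hpart: "e \<in> degs \<sigma> \<Longrightarrow> x \<in> hpart A d \<Longrightarrow> tpow A e x \<in> hpart A (e + d)"
  using hpart_smult[of e x d 1] by (simp add: tpow_def)

lemma single_smult:
  "e \<in> degs \<sigma> \<Longrightarrow> x \<in> carrier A \<Longrightarrow> Poly_Mapping.single e c \<odot>\<^bsub>A\<^esub> x = tpow A e (kmul A c x)"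
  unfolding tpow_def kmul_def by (subst smult_assoc1[symmetric]) (auto simp: mult_single)

lemma tpow_tpow: "\<lbrakk>d \<in> degs \<sigma>; e \<in> degs \<sigma>; x \<in> carrier A\<rbrakk> \<Longrightarrow> tpow A d (tpow A e x) = tpow A (d + e) x"
  unfolding tpow_def by (subst smult_assoc1[symmetric]) (auto simp: mult_single)

lemma tpow_kmul: "\<lbrakk>d \<in> degs \<sigma>; x \<in> carrier A\<rbrakk> \<Longrightarrow> tpow A d (kmul A c x) = kmul A c (tpow A d x)"
  unfolding tpow_def kmul_def
  by (subst (1 2) smult_assoc1[symmetric]) (auto simp: mult_single)

lemma tpow_0 [simp]: "x \<in> carrier A \<Longrightarrow> tpow A 0 x = x"
  using smult_one by (simp add: tpow_def)

lemma tpow_cancel: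
  "\<lbrakk>d \<in> degs \<sigma>; - d \<in> degs \<sigma>; x \<in> carrier A\<rbrakk> \<Longrightarrow> tpow A (- d) (tpow A d x) = x"
  "\<lbrakk>d \<in> degs \<sigma>; - d \<in> degs \<sigma>; x \<in> carrier A\<rbrakk> \<Longrightarrow> tpow A d (tpow A (- d) x) = x"
  by (simp_all add: tpow_tpow)

lemma tpow_add: "\<lbrakk>d \<in> degs \<sigma>; x \<in> carrier A; y \<in> carrier A\<rbrakk>
    \<Longrightarrow> tpow A d (x \<oplus>\<^bsub>A\<^esub> y) = tpow A d x \<oplus>\<^bsub>A\<^esub> tpow A d y"
  unfolding tpow_def by (rule smult_r_distr) auto

lemma kmul_add: "\<lbrakk>x \<in> carrier A; y \<in> carrier A\<rbrakk>
    \<Longrightarrow> kmul A c (x \<oplus>\<^bsub>A\<^esub> y) = kmul A c x \<oplus>\<^bsub>A\<^esub> kmul A c y"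
  unfolding kmul_def by (rule smult_r_distr) auto

lemma tpow_zero [simp]: "d \<in> degs \<sigma> \<Longrightarrow> tpow A d \<zero>\<^bsub>A\<^esub> = \<zero>\<^bsub>A\<^esub>"
  by (simp add: tpow_def)

lemma kmul_zero [simp]: "kmul A c \<zero>\<^bsub>A\<^esub> = \<zero>\<^bsub>A\<^esub>"
  by (simp add: kmul_def)

lemma hcomp_decomposition:
  assumes "x \<in> carrier A"
  shows "hcomp A d x \<in> hpart A d" "finite {d. hcomp A d x \<noteq> \<zero>\<^bsub>A\<^esub>}"
    "x = (\<Oplus>\<^bsub>A\<^esub>d\<in>{d. hcomp A d x \<noteq> \<zero>\<^bsub>A\<^esub>}. hcomp A d x)"
proof -
  define F where "F = (THE f. (\<forall>d. f d \<in> hpart A d) \<and> finite {d. f d \<noteq> \<zero>\<^bsub>A\<^esub>} \<and>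
               x = (\<Oplus>\<^bsub>A\<^esub>d\<in>{d. f d \<noteq> \<zero>\<^bsub>A\<^esub>}. f d))"
  have "(\<forall>d. F d \<in> hpart A d) \<and> finite {d. F d \<noteq> \<zero>\<^bsub>A\<^esub>} \<and>
               x = (\<Oplus>\<^bsub>A\<^esub>d\<in>{d. F d \<noteq> \<zero>\<^bsub>A\<^esub>}. F d)"
    unfolding F_def by (rule theI'[OF hpart_direct_sum[OF assms]])
  moreover have "hcomp A d x = F d" for d by (simp add: hcomp_def F_def)
  ultimately show "hcomp A d x \<in> hpart A d" "finite {d. hcomp A d x \<noteq> \<zero>\<^bsub>A\<^esub>}"
    "x = (\<Oplus>\<^bsub>A\<^esub>d\<in>{d. hcomp A d x \<noteq> \<zero>\<^bsub>A\<^esub>}. hcomp A d x)" by simp_all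
qed

text \<open>Any finite homogeneous decomposition, possibly with zero summands, is the one that defines \<open>hcomp\<close>.\<close>

lemma hcomp_unique:
  assumes S: "finite S" "\<And>d. f d \<in> hpart A d" "\<And>d. d \<notin> S \<Longrightarrow> f d = \<zero>\<^bsub>A\<^esub>"
    and x: "x = (\<Oplus>\<^bsub>A\<^esub>d\<in>S. f d)"
  shows "hcomp A d x = f d"
proof -
  have "{d. f d \<noteq> \<zero>\<^bsub>A\<^esub>} \<subseteq> S" using S(3) by blast
  moreover have "x = (\<Oplus>\<^bsub>A\<^esub>d\<in>{d. f d \<noteq> \<zero>\<^bsub>A\<^esub>}. f d)"
    unfolding x using S calculation
    by (intro add.finprod_mono_neutral_cong_right) (auto intro: hpart_carrier)
  moreover have "x \<in> carrier A" unfolding x using S(2) hpart_carrier by (intro finsum_closed) blast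
  ultimately have "(THE f. (\<forall>d. f d \<in> hpart A d) \<and> finite {d. f d \<noteq> \<zero>\<^bsub>A\<^esub>} \<and>
               x = (\<Oplus>\<^bsub>A\<^esub>d\<in>{d. f d \<noteq> \<zero>\<^bsub>A\<^esub>}. f d)) = f"
    using S(1,2) by (intro the1_equality hpart_direct_sum) (auto intro: finite_subset)
  then show ?thesis by (simp add: hcomp_def)
qed

lemma hcomp_carrier [simp]: "x \<in> carrier A \<Longrightarrow> hcomp A d x \<in> carrier A"
  using hcomp_decomposition(1) hpart_carrier by blast

lemma hcomp_sum:
  assumes "x \<in> carrier A" "finite S" "{d. hcomp A d x \<noteq> \<zero>\<^bsub>A\<^esub>} \<subseteq> S"
  shows "x = (\<Oplus>\<^bsub>A\<^esub>d\<in>S. hcomp A d x)"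
proof -
  have "(\<Oplus>\<^bsub>A\<^esub>d\<in>S. hcomp A d x) = (\<Oplus>\<^bsub>A\<^esub>d\<in>{d. hcomp A d x \<noteq> \<zero>\<^bsub>A\<^esub>}. hcomp A d x)"
    using assms by (intro add.finprod_mono_neutral_cong_right) auto
  then show ?thesis using hcomp_decomposition(3)[OF assms(1)] by simp
qed

lemma hcomp_add:
  assumes "x \<in> carrier A" "y \<in> carrier A"
  shows "hcomp A d (x \<oplus>\<^bsub>A\<^esub> y) = hcomp A d x \<oplus>\<^bsub>A\<^esub> hcomp A d y"
proof -
  define S where "S = {d. hcomp A d x \<noteq> \<zero>\<^bsub>A\<^esub>} \<union> {d. hcomp A d y \<noteq> \<zero>\<^bsub>A\<^esub>}"
  have S: "finite S" using assms hcomp_decomposition(2) by (simp add: S_def)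
  show ?thesis
  proof (rule hcomp_unique[OF S])
    have "x \<oplus>\<^bsub>A\<^esub> y = (\<Oplus>\<^bsub>A\<^esub>d\<in>S. hcomp A d x) \<oplus>\<^bsub>A\<^esub> (\<Oplus>\<^bsub>A\<^esub>d\<in>S. hcomp A d y)"
      using hcomp_sum[OF assms(1) S] hcomp_sum[OF assms(2) S] by (simp add: S_def)
    also have "\<dots> = (\<Oplus>\<^bsub>A\<^esub>d\<in>S. hcomp A d x \<oplus>\<^bsub>A\<^esub> hcomp A d y)"
      using S assms by (subst finsum_addf) auto
    finally show "x \<oplus>\<^bsub>A\<^esub> y = (\<Oplus>\<^bsub>A\<^esub>d\<in>S. hcomp A d x \<oplus>\<^bsub>A\<^esub> hcomp A d y)" .
  qed (use assms in \<open>auto simp: S_def hpart_add hcomp_decomposition(1)\<close>)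
qed

lemma hcomp_hpart: "x \<in> hpart A d \<Longrightarrow> hcomp A e x = (if e = d then x else \<zero>\<^bsub>A\<^esub>)"
  using hpart_carrier[of x d]
  by (intro hcomp_unique[of "{d}" "\<lambda>e. if e = d then x else \<zero>\<^bsub>A\<^esub>"]) auto

lemma hcomp_zero [simp]: "hcomp A d \<zero>\<^bsub>A\<^esub> = \<zero>\<^bsub>A\<^esub>"
  using hcomp_hpart[of "\<zero>\<^bsub>A\<^esub>" d d] by simp

lemma finsum_closed_induct:
  assumes "finite S" "P \<zero>\<^bsub>A\<^esub>" "\<And>d. d \<in> S \<Longrightarrow> f d \<in> carrier A \<and> P (f d)"
    "\<And>x y. \<lbrakk>x \<in> carrier A; y \<in> carrier A; P x; P y\<rbrakk> \<Longrightarrow> P (x \<oplus>\<^bsub>A\<^esub> y)"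
  shows "P (\<Oplus>\<^bsub>A\<^esub>d\<in>S. f d)"
  using assms(1,3)
proof (induction S)
  case (insert d S)
  have "(\<Oplus>\<^bsub>A\<^esub>d\<in>insert d S. f d) = f d \<oplus>\<^bsub>A\<^esub> (\<Oplus>\<^bsub>A\<^esub>d\<in>S. f d)"
    using insert by (intro finsum_insert) auto
  moreover have "(\<Oplus>\<^bsub>A\<^esub>d\<in>S. f d) \<in> carrier A" using insert by (intro finsum_closed) auto
  ultimately show ?case using insert assms(4) by auto
qed (simp add: assms(2))

lemma graded_induct [consumes 1, case_names hom add]:
  assumes x: "x \<in> carrier A"
    and hom: "\<And>d x. x \<in> hpart A d \<Longrightarrow> P x"
    and add: "\<And>x y. \<lbrakk>x \<in> carrier A; y \<in> carrier A; P x; P y\<rbrakk> \<Longrightarrow> P (x \<oplus>\<^bsub>A\<^esub> y)"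
  shows "P x"
proof -
  have "P (\<Oplus>\<^bsub>A\<^esub>d\<in>{d. hcomp A d x \<noteq> \<zero>\<^bsub>A\<^esub>}. hcomp A d x)"
  proof (rule finsum_closed_induct[where P = P])
    show "P \<zero>\<^bsub>A\<^esub>" by (rule hom[OF hpart_zero])
    show "hcomp A d x \<in> carrier A \<and> P (hcomp A d x)" for d
      using x hom[OF hcomp_decomposition(1)[OF x]] by simp
  qed (use hcomp_decomposition(2)[OF x] add in auto)
  then show ?thesis using hcomp_decomposition(3)[OF x] by simp
qed

lemma hcomp_ext:
  assumes "x \<in> carrier A" "y \<in> carrier A" "\<And>d. hcomp A d x = hcomp A d y"
  shows "x = y"
  using hcomp_decomposition(3)[OF assms(1)] hcomp_decomposition(3)[OF assms(2)] assms(3) by simp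

lemma hcomp_tpow:
  assumes x: "x \<in> carrier A" and e: "e \<in> degs \<sigma>"
  shows "hcomp A d (tpow A e x) = tpow A e (hcomp A (d - e) x)"
  using x
proof (induction rule: graded_induct)
  case (hom d' x)
  then show ?case
    using hcomp_hpart[OF tpow_hpart[OF e hom], of d] hcomp_hpart[OF hom, of "d - e"] e
    by (auto simp: algebra_simps)
next
  case (add x y)
  then show ?case using e by (simp add: tpow_add hcomp_add)
qed

lemma hcomp_kmul:
  assumes x: "x \<in> carrier A"
  shows "hcomp A d (kmul A c x) = kmul A c (hcomp A d x)"
  using x
proof (induction rule: graded_induct)
  case (hom d' x)
  then show ?case
    using hcomp_hpart[OF kmul_hpart[OF hom], of d] hcomp_hpart[OF hom, of d] by auto
next
  case (add x y)
  then show ?case by (simp add: kmul_add hcomp_add)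
qed

lemma submodule_eq_carrier:
  assumes N: "submodule (locR \<sigma>) N A" and hom: "\<And>d x. x \<in> hpart A d \<Longrightarrow> x \<in> N"
  shows "N = carrier A"
proof
  show "N \<subseteq> carrier A" using N by (simp add: submodule_def)
  show "carrier A \<subseteq> N"
  proof
    fix x assume "x \<in> carrier A"
    then show "x \<in> N"
    proof (induction rule: graded_induct)
      case (hom d x)
      then show ?case by (rule assms)
    next
      case (add x y)
      then show ?case using N by (simp add: submodule_def)
    qed
  qed
qed

lemma submoduleI_tpow:
  assumes N: "N \<subseteq> carrier A" "\<zero>\<^bsub>A\<^esub> \<in> N" and add: "\<And>x y. x \<in> N \<Longrightarrow> y \<in> N \<Longrightarrow> x \<oplus>\<^bsub>A\<^esub> y \<in> N"
    and k: "\<And>c x. x \<in> N \<Longrightarrow> kmul A c x \<in> N" and t: "\<And>e x. e \<in> degs \<sigma> \<Longrightarrow> x \<in> N \<Longrightarrow> tpow A e x \<in> N"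
  shows "submodule (locR \<sigma>) N A"
proof
  fix r v assume r: "r \<in> carrier (locR \<sigma> :: 'k laurent ring)" and v: "v \<in> N"
  from r have "Poly_Mapping.keys r \<subseteq> degs \<sigma>" by simp
  then show "r \<odot>\<^bsub>A\<^esub> v \<in> N"
  proof (induction rule: locR_induct)
    case (single e c)
    have "v \<in> carrier A" using v N(1) by blast
    with single v show ?case by (simp add: single_smult k t)
  next
    case (add p q)
    have "(p + q) \<odot>\<^bsub>A\<^esub> v = p \<odot>\<^bsub>A\<^esub> v \<oplus>\<^bsub>A\<^esub> q \<odot>\<^bsub>A\<^esub> v"
      using smult_l_distr[of p q v] add v N(1) by auto
    then show ?case using add assms(3) by simp
  qed
qed (use assms module_axioms in auto)

end

subsection \<open>Graded homomorphisms\<close>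

lemma graded_homD:
  assumes "f \<in> graded_hom \<sigma> A B"
  shows "x \<in> carrier A \<Longrightarrow> f x \<in> carrier B"
    "\<lbrakk>x \<in> carrier A; y \<in> carrier A\<rbrakk> \<Longrightarrow> f (x \<oplus>\<^bsub>A\<^esub> y) = f x \<oplus>\<^bsub>B\<^esub> f y"
    "\<lbrakk>Poly_Mapping.keys r \<subseteq> degs \<sigma>; x \<in> carrier A\<rbrakk> \<Longrightarrow> f (r \<odot>\<^bsub>A\<^esub> x) = r \<odot>\<^bsub>B\<^esub> f x"
    "x \<in> hpart A d \<Longrightarrow> f x \<in> hpart B d"
  using assms unfolding graded_hom_def LinearCombinations.module_hom_def image_subset_iff by auto

lemma graded_hom_tpow_kmul:
  assumes "f \<in> graded_hom \<sigma> A B"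
  shows "\<lbrakk>e \<in> degs \<sigma>; x \<in> carrier A\<rbrakk> \<Longrightarrow> f (tpow A e x) = tpow B e (f x)"
    "x \<in> carrier A \<Longrightarrow> f (kmul A c x) = kmul B c (f x)"
  by (simp_all add: tpow_def kmul_def graded_homD(3)[OF assms])

lemma graded_homI:
  assumes "\<And>x. x \<in> carrier A \<Longrightarrow> f x \<in> carrier B"
    "\<And>x y. \<lbrakk>x \<in> carrier A; y \<in> carrier A\<rbrakk> \<Longrightarrow> f (x \<oplus>\<^bsub>A\<^esub> y) = f x \<oplus>\<^bsub>B\<^esub> f y"
    "\<And>r x. \<lbrakk>Poly_Mapping.keys r \<subseteq> degs \<sigma>; x \<in> carrier A\<rbrakk> \<Longrightarrow> f (r \<odot>\<^bsub>A\<^esub> x) = r \<odot>\<^bsub>B\<^esub> f x"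
    "\<And>d x. x \<in> hpart A d \<Longrightarrow> f x \<in> hpart B d"
  shows "f \<in> graded_hom \<sigma> A B"
  using assms unfolding graded_hom_def LinearCombinations.module_hom_def by auto

text \<open>The module \<open>B\<close> may live over a larger ring than \<open>A\<close>; homomorphisms are then linear over the smaller one.\<close>

locale graded_module_pair = A: graded_module \<sigma> A + B: graded_module \<tau> B
  for \<sigma> :: "nat set" and A :: "('k::field laurent, 'm) gmodule"
    and \<tau> :: "nat set" and B :: "('k laurent, 'n) gmodule" +
  assumes sub: "\<sigma> \<subseteq> \<tau>"
begin

lemma degs_sub: "d \<in> degs \<sigma> \<Longrightarrow> d \<in> degs \<tau>"
  using degs_mono[OF sub] by blast

lemma graded_hom_zero: "f \<in> graded_hom \<sigma> A B \<Longrightarrow> f \<zero>\<^bsub>A\<^esub> = \<zero>\<^bsub>B\<^esub>"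
  using graded_homD(1)[of f \<sigma> A B "\<zero>\<^bsub>A\<^esub>"] graded_homD(2)[of f \<sigma> A B "\<zero>\<^bsub>A\<^esub>" "\<zero>\<^bsub>A\<^esub>"]
  by simp

lemma graded_hom_tpow_kmulI:
  assumes c: "\<And>x. x \<in> carrier A \<Longrightarrow> f x \<in> carrier B"
    and a: "\<And>x y. \<lbrakk>x \<in> carrier A; y \<in> carrier A\<rbrakk> \<Longrightarrow> f (x \<oplus>\<^bsub>A\<^esub> y) = f x \<oplus>\<^bsub>B\<^esub> f y"
    and t: "\<And>e x. \<lbrakk>e \<in> degs \<sigma>; x \<in> carrier A\<rbrakk> \<Longrightarrow> f (tpow A e x) = tpow B e (f x)"
    and k: "\<And>c x. x \<in> carrier A \<Longrightarrow> f (kmul A c x) = kmul B c (f x)"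
    and h: "\<And>d x. x \<in> hpart A d \<Longrightarrow> f x \<in> hpart B d"
  shows "f \<in> graded_hom \<sigma> A B"
proof (rule graded_homI[OF c a _ h])
  fix r :: "'k laurent" and x assume "Poly_Mapping.keys r \<subseteq> degs \<sigma>" and x: "x \<in> carrier A"
  then show "f (r \<odot>\<^bsub>A\<^esub> x) = r \<odot>\<^bsub>B\<^esub> f x"
  proof (induction rule: locR_induct)
    case (single e c)
    then show ?case
      using x by (simp add: A.single_smult B.single_smult degs_sub t k assms(1))
  next
    case (add p q)
    have pq: "Poly_Mapping.keys p \<subseteq> degs \<tau>" "Poly_Mapping.keys q \<subseteq> degs \<tau>"
      using add degs_mono[OF sub] by blast+
    have "f ((p + q) \<odot>\<^bsub>A\<^esub> x) = f (p \<odot>\<^bsub>A\<^esub> x) \<oplus>\<^bsub>B\<^esub> f (q \<odot>\<^bsub>A\<^esub> x)"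
      using A.smult_l_distr[of p q x] a[OF A.smult_closed A.smult_closed, of p x q x] add x by simp
    also have "\<dots> = (p + q) \<odot>\<^bsub>B\<^esub> f x"
      using B.smult_l_distr[of p q "f x"] add.IH c[OF x] x pq by simp
    finally show ?case .
  qed
qed

lemma hcomp_graded_hom:
  assumes f: "f \<in> graded_hom \<sigma> A B" and x: "x \<in> carrier A"
  shows "hcomp B d (f x) = f (hcomp A d x)"
  using x
proof (induction rule: A.graded_induct)
  case (hom d' x)
  then show ?case
    using A.hcomp_hpart[OF hom, of d] B.hcomp_hpart[OF graded_homD(4)[OF f hom], of d] graded_hom_zero[OF f]
    by auto
next
  case (add x y)
  then show ?case
    using graded_homD(1,2)[OF f] by (simp add: A.hcomp_add B.hcomp_add)
qed

lemma graded_hom_eq_onI: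
  assumes f: "f \<in> graded_hom \<sigma> A B" and g: "g \<in> graded_hom \<sigma> A B"
    and eq: "\<And>d x. x \<in> hpart A d \<Longrightarrow> f x = g x" and x: "x \<in> carrier A"
  shows "f x = g x"
  using x
proof (induction rule: A.graded_induct)
  case (hom d x)
  then show ?case by (rule eq)
next
  case (add x y)
  then show ?case by (simp add: graded_homD(2)[OF f] graded_homD(2)[OF g])
qed

text \<open>A family of maps on the homogeneous parts that commutes with monomials and constants extends by
  additivity over homogeneous components.\<close>

lemma graded_hom_extension:
  assumes h: "\<And>d x. x \<in> hpart A d \<Longrightarrow> \<theta> d x \<in> hpart B d"
    and a: "\<And>d x y. \<lbrakk>x \<in> hpart A d; y \<in> hpart A d\<rbrakk> \<Longrightarrow> \<theta> d (x \<oplus>\<^bsub>A\<^esub> y) = \<theta> d x \<oplus>\<^bsub>B\<^esub> \<theta> d y"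
    and t: "\<And>d e x. \<lbrakk>e \<in> degs \<sigma>; x \<in> hpart A d\<rbrakk> \<Longrightarrow> \<theta> (e + d) (tpow A e x) = tpow B e (\<theta> d x)"
    and k: "\<And>d c x. x \<in> hpart A d \<Longrightarrow> \<theta> d (kmul A c x) = kmul B c (\<theta> d x)"
  obtains f where "f \<in> graded_hom \<sigma> A B" "\<And>d x. x \<in> hpart A d \<Longrightarrow> f x = \<theta> d x"
proof -
  have z: "\<theta> d \<zero>\<^bsub>A\<^esub> = \<zero>\<^bsub>B\<^esub>" for d
    using a[of "\<zero>\<^bsub>A\<^esub>" d "\<zero>\<^bsub>A\<^esub>"] B.hpart_carrier[OF h[of "\<zero>\<^bsub>A\<^esub>" d]] by simp
  define f where "f x = (\<Oplus>\<^bsub>B\<^esub>d\<in>{d. hcomp A d x \<noteq> \<zero>\<^bsub>A\<^esub>}. \<theta> d (hcomp A d x))" for x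
  have cl: "\<theta> d (hcomp A d x) \<in> carrier B" if "x \<in> carrier A" for x d
    using that A.hcomp_decomposition(1) h B.hpart_carrier by blast
  have f_eq: "f x = (\<Oplus>\<^bsub>B\<^esub>d\<in>S. \<theta> d (hcomp A d x))"
    if "x \<in> carrier A" "finite S" "{d. hcomp A d x \<noteq> \<zero>\<^bsub>A\<^esub>} \<subseteq> S" for x S
    unfolding f_def using that cl[OF that(1)] z
    by (intro B.add.finprod_mono_neutral_cong_left) auto
  have fh: "f x = \<theta> d x" if "x \<in> hpart A d" for x d
  proof -
    have "f x = (\<Oplus>\<^bsub>B\<^esub>e\<in>{d}. \<theta> e (hcomp A e x))"
      using that by (intro f_eq) (auto simp: A.hcomp_hpart A.hpart_carrier split: if_splits)
    also have "\<dots> = \<theta> d x" using h[OF that] B.hpart_carrier[of "\<theta> d x" d] A.hcomp_hpart[OF that, of d]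
      by simp
    finally show ?thesis .
  qed
  have fa: "f (x \<oplus>\<^bsub>A\<^esub> y) = f x \<oplus>\<^bsub>B\<^esub> f y" if x: "x \<in> carrier A" and y: "y \<in> carrier A" for x y
  proof -
    define S where "S = {d. hcomp A d x \<noteq> \<zero>\<^bsub>A\<^esub>} \<union> {d. hcomp A d y \<noteq> \<zero>\<^bsub>A\<^esub>}"
    have S: "finite S" using x y A.hcomp_decomposition(2) by (simp add: S_def)
    have "{d. hcomp A d (x \<oplus>\<^bsub>A\<^esub> y) \<noteq> \<zero>\<^bsub>A\<^esub>} \<subseteq> S"
      using x y by (auto simp: S_def A.hcomp_add)
    then have "f (x \<oplus>\<^bsub>A\<^esub> y) = (\<Oplus>\<^bsub>B\<^esub>d\<in>S. \<theta> d (hcomp A d x) \<oplus>\<^bsub>B\<^esub> \<theta> d (hcomp A d y))"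
      using x y S f_eq[of "x \<oplus>\<^bsub>A\<^esub> y" S]
      by (simp add: A.hcomp_add a A.hcomp_decomposition(1))
    also have "\<dots> = f x \<oplus>\<^bsub>B\<^esub> f y"
      using f_eq[OF x S] f_eq[OF y S] x y S cl by (subst B.finsum_addf) (auto simp: S_def)
    finally show ?thesis .
  qed
  have fc: "f x \<in> carrier B" if "x \<in> carrier A" for x
    unfolding f_def using cl[OF that] by (intro B.finsum_closed) auto
  have "f \<in> graded_hom \<sigma> A B"
  proof (rule graded_hom_tpow_kmulI[OF fc fa])
    fix x assume "x \<in> carrier A"
    {
      fix e assume e: "e \<in> degs \<sigma>"
      from \<open>x \<in> carrier A\<close> show "f (tpow A e x) = tpow B e (f x)"
      proof (induction rule: A.graded_induct)
        case (hom d x)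
        then show ?case using fh[OF hom] fh[OF A.tpow_hpart[OF e hom]] t[OF e hom] by simp
      next
        case (add x y)
        then show ?case using e degs_sub[OF e] by (simp add: A.tpow_add B.tpow_add fa fc)
      qed
    }
    fix c
    from \<open>x \<in> carrier A\<close> show "f (kmul A c x) = kmul B c (f x)"
    proof (induction rule: A.graded_induct)
      case (hom d x)
      then show ?case using fh[OF hom] fh[OF A.kmul_hpart[OF hom]] k[OF hom] by simp
    next
      case (add x y)
      then show ?case by (simp add: A.kmul_add B.kmul_add fa fc)
    qed
  next
    fix d x assume "x \<in> hpart A d"
    then show "f x \<in> hpart B d" using fh h by simp
  qed
  with fh that show thesis by blast
qed

end

section \<open>Extension of scalars as localization\<close>

text \<open>The exponent of \<open>s\<^sup>N\<close>, where \<open>s\<close> is the product of the variables that are invertible over \<open>R\<^sub>\<tau>\<close> but not over \<open>R\<^sub>\<sigma>\<close>;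
  the ring \<open>R\<^sub>\<tau>\<close> is \<open>R\<^sub>\<sigma>\<close> with \<open>s\<close> inverted when \<open>\<sigma> \<subseteq> \<tau>\<close>.\<close>

definition inv_deg :: "nat set \<Rightarrow> nat set \<Rightarrow> nat \<Rightarrow> int \<times> int" where
  "inv_deg \<sigma> \<tau> N = (if 1 \<in> \<tau> - \<sigma> then int N else 0, if 2 \<in> \<tau> - \<sigma> then int N else 0)"

lemma inv_deg_in_degs [simp]: "inv_deg \<sigma> \<tau> N \<in> degs \<rho>" "- inv_deg \<sigma> \<tau> N \<in> degs \<tau>"
  by (auto simp: inv_deg_def degs_def)

lemma inv_deg_add: "inv_deg \<sigma> \<tau> (N + M) = inv_deg \<sigma> \<tau> N + inv_deg \<sigma> \<tau> M"
  by (auto simp: inv_deg_def)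

lemma inv_deg_eventually:
  assumes "d \<in> degs \<tau>"
  shows "\<exists>N0. \<forall>N\<ge>N0. inv_deg \<sigma> \<tau> N + d \<in> degs \<sigma>"
  using assms
  by (intro exI[of _ "nat \<bar>fst d\<bar> + nat \<bar>snd d\<bar>"]) (cases d, auto simp: inv_deg_def degs_def)

lemma locR_denominator:
  fixes r :: "'k::field laurent"
  assumes "Poly_Mapping.keys r \<subseteq> degs \<tau>"
  shows "\<exists>N0. \<forall>N\<ge>N0. Poly_Mapping.keys (Poly_Mapping.single (inv_deg \<sigma> \<tau> N) 1 * r) \<subseteq> degs \<sigma>"
  using assms
proof (induction rule: locR_induct)
  case (single e c)
  then show ?case using inv_deg_eventually[of e \<tau> \<sigma>] by (simp add: mult_single)
next
  case (add p q)
  then obtain N1 N2 where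
    "\<And>N. N \<ge> N1 \<Longrightarrow> Poly_Mapping.keys (Poly_Mapping.single (inv_deg \<sigma> \<tau> N) 1 * p) \<subseteq> degs \<sigma>"
    "\<And>N. N \<ge> N2 \<Longrightarrow> Poly_Mapping.keys (Poly_Mapping.single (inv_deg \<sigma> \<tau> N) 1 * q) \<subseteq> degs \<sigma>"
    by blast
  then show ?case
    by (intro exI[of _ "max N1 N2"]) (simp add: distrib_left add_in_locR)
qed

text \<open>The map \<open>\<psi>\<close> exhibits \<open>B\<close> as the localization of \<open>A\<close> at \<open>s\<close>: its kernel is \<open>s\<close>-power torsion, and every element of \<open>B\<close>
  enters its image after multiplication by a power of \<open>s\<close>.\<close>

definition localizes ::
  "nat set \<Rightarrow> nat set \<Rightarrow> ('k::field laurent, 'm) gmodule \<Rightarrow> ('k laurent, 'n) gmodule \<Rightarrow>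
     ('m \<Rightarrow> 'n) \<Rightarrow> bool" where
  "localizes \<sigma> \<tau> A B \<psi> \<longleftrightarrow> \<psi> \<in> graded_hom \<sigma> A B \<and>
     (\<forall>x\<in>carrier A. \<psi> x = \<zero>\<^bsub>B\<^esub> \<longrightarrow> (\<exists>N. tpow A (inv_deg \<sigma> \<tau> N) x = \<zero>\<^bsub>A\<^esub>)) \<and>
     (\<forall>y\<in>carrier B. \<exists>N. \<exists>x\<in>carrier A. tpow B (inv_deg \<sigma> \<tau> N) y = \<psi> x)"

lemma graded_isoI:
  fixes A :: "('k::field laurent, 'm) gmodule" and B :: "('k laurent, 'n) gmodule"
  assumes f: "f \<in> graded_hom \<sigma> A B" and inj: "inj_on f (carrier A)" and surj: "carrier B \<subseteq> f ` carrier A"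
    and hsurj: "\<And>d. hpart B d \<subseteq> f ` hpart A d"
    and add: "\<And>x y. \<lbrakk>x \<in> carrier A; y \<in> carrier A\<rbrakk> \<Longrightarrow> x \<oplus>\<^bsub>A\<^esub> y \<in> carrier A"
    and smult: "\<And>r x. \<lbrakk>Poly_Mapping.keys r \<subseteq> degs \<sigma>; x \<in> carrier A\<rbrakk> \<Longrightarrow> r \<odot>\<^bsub>A\<^esub> x \<in> carrier A"
    and hpart: "\<And>d. hpart A d \<subseteq> carrier A"
  shows "f \<in> graded_iso \<sigma> A B"
proof -
  define g where "g = inv_into (carrier A) f"
  have gf: "g (f x) = x" if "x \<in> carrier A" for x using inj that by (simp add: g_def)
  have fg: "g y \<in> carrier A" "f (g y) = y" if "y \<in> carrier B" for y
    using surj that by (auto simp: g_def inv_into_into f_inv_into_f)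
  have "g \<in> graded_hom \<sigma> B A"
  proof (rule graded_homI)
    fix x y assume xy: "x \<in> carrier B" "y \<in> carrier B"
    then have "x \<oplus>\<^bsub>B\<^esub> y = f (g x \<oplus>\<^bsub>A\<^esub> g y)" by (simp add: graded_homD(2)[OF f] fg)
    then show "g (x \<oplus>\<^bsub>B\<^esub> y) = g x \<oplus>\<^bsub>A\<^esub> g y" using xy by (simp add: gf fg add)
  next
    fix r :: "'k laurent" and x assume rx: "Poly_Mapping.keys r \<subseteq> degs \<sigma>" "x \<in> carrier B"
    then have "r \<odot>\<^bsub>B\<^esub> x = f (r \<odot>\<^bsub>A\<^esub> g x)" by (simp add: graded_homD(3)[OF f] fg)
    then show "g (r \<odot>\<^bsub>B\<^esub> x) = r \<odot>\<^bsub>A\<^esub> g x" using rx by (simp add: gf fg smult)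
  next
    fix d x assume "x \<in> hpart B d"
    then obtain y where "y \<in> hpart A d" "x = f y" using hsurj by blast
    moreover have "y \<in> carrier A" using hpart \<open>y \<in> hpart A d\<close> by blast
    ultimately show "g x \<in> hpart A d" by (simp add: gf)
  qed (use fg in auto)
  then show ?thesis using f gf fg unfolding graded_iso_def by blast
qed

text \<open>Homomorphisms from a free abelian group into the additive group of a module, in additive notation.\<close>

lemma hom_free:
  assumes B: "abelian_group B" and h: "h \<in> hom (free_Abelian_group S) (add_monoid B)"
    and x: "Poly_Mapping.keys x \<subseteq> S" and y: "Poly_Mapping.keys y \<subseteq> S"
  shows "h (x - y) = h x \<ominus>\<^bsub>B\<^esub> h y" "h x \<in> carrier B" "h 0 = \<zero>\<^bsub>B\<^esub>" "h (x + y) = h x \<oplus>\<^bsub>B\<^esub> h y"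
    "h (- x) = \<ominus>\<^bsub>B\<^esub> h x"
proof -
  interpret B: abelian_group B by (rule B)
  have hc: "h z \<in> carrier B" if "Poly_Mapping.keys z \<subseteq> S" for z
    using h that by (auto simp: hom_def)
  have ha: "h (z + w) = h z \<oplus>\<^bsub>B\<^esub> h w" if "Poly_Mapping.keys z \<subseteq> S" "Poly_Mapping.keys w \<subseteq> S" for z w
    using h that by (auto simp: hom_def)
  show h0: "h 0 = \<zero>\<^bsub>B\<^esub>" using ha[of 0 0] hc[of 0] by simp
  have hm: "h (- z) = \<ominus>\<^bsub>B\<^esub> h z" if "Poly_Mapping.keys z \<subseteq> S" for z
    using ha[of "- z" z] hc[of z] hc[of "- z"] h0 that by (intro B.minus_equality[symmetric]) auto
  show "h (x - y) = h x \<ominus>\<^bsub>B\<^esub> h y" using ha[of x "- y"] hm[OF y] x y by (simp add: a_minus_def)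
  show "h x \<in> carrier B" "h (x + y) = h x \<oplus>\<^bsub>B\<^esub> h y" "h (- x) = \<ominus>\<^bsub>B\<^esub> h x"
    using hc ha hm x y by auto
qed

lemma hom_free_relator:
  assumes B: "abelian_group B" and h: "h \<in> hom (free_Abelian_group S) (add_monoid B)"
    and x: "Poly_Mapping.keys x \<subseteq> S" and y: "Poly_Mapping.keys y \<subseteq> S"
  shows "h x = h y \<Longrightarrow> h (x - y) = \<zero>\<^bsub>B\<^esub>"
    "\<lbrakk>Poly_Mapping.keys z \<subseteq> S; h x = h y \<oplus>\<^bsub>B\<^esub> h z\<rbrakk> \<Longrightarrow> h (x - y - z) = \<zero>\<^bsub>B\<^esub>"
proof -
  interpret B: abelian_group B by (rule B)
  note hd = hom_free[OF B h]
  have *: "h (x - y) = \<zero>\<^bsub>B\<^esub>" if "Poly_Mapping.keys y \<subseteq> S" "h x = h y" for y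
    using hd(1)[OF x that(1)] hd(2)[OF that(1,1)] that(2) by (simp add: a_minus_def B.r_neg)
  show "h (x - y - z) = \<zero>\<^bsub>B\<^esub>" if z: "Poly_Mapping.keys z \<subseteq> S" "h x = h y \<oplus>\<^bsub>B\<^esub> h z"
    using *[of "y + z"] hd(4)[OF y z(1)] z y Poly_Mapping.keys_add[of y z]
    by (simp add: diff_diff_add subset_trans)
  show "h x = h y \<Longrightarrow> h (x - y) = \<zero>\<^bsub>B\<^esub>" using *[OF y] .
qed

text \<open>The extended module \<open>E = R\<^sub>\<tau> \<otimes> A\<close>, presented as the free group \<open>F\<close> modulo \<open>Rel\<close>, with \<open>cls\<close> the class of a
  representative; \<open>u N\<close> is the denominator \<open>s\<^sup>-\<^sup>N\<close>.\<close>

locale scalar_extension = graded_module \<sigma> A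
  for \<sigma> :: "nat set" and A :: "('k::field laurent, 'm) gmodule" (structure) +
  fixes \<tau> :: "nat set"
  assumes sub: "\<sigma> \<subseteq> \<tau>"
begin

abbreviation pairs :: "('k laurent \<times> 'm) set" where
  "pairs \<equiv> carrier (locR \<tau>) \<times> carrier A"

abbreviation F :: "(('k laurent \<times> 'm) \<Rightarrow>\<^sub>0 int) monoid" where
  "F \<equiv> tensor_free \<tau> A"

abbreviation Rel :: "(('k laurent \<times> 'm) \<Rightarrow>\<^sub>0 int) set" where
  "Rel \<equiv> tensor_relations \<sigma> \<tau> A"

abbreviation cls :: "(('k laurent \<times> 'm) \<Rightarrow>\<^sub>0 int) \<Rightarrow> (('k laurent \<times> 'm) \<Rightarrow>\<^sub>0 int) set" where
  "cls \<equiv> tensor_class \<sigma> \<tau> A"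

abbreviation E :: "('k laurent, (('k laurent \<times> 'm) \<Rightarrow>\<^sub>0 int) set) gmodule" where
  "E \<equiv> ext_scalars \<sigma> \<tau> A"

abbreviation u :: "nat \<Rightarrow> 'k laurent" where
  "u N \<equiv> Poly_Mapping.single (- inv_deg \<sigma> \<tau> N) 1"

lemma degs_sub: "d \<in> degs \<sigma> \<Longrightarrow> d \<in> degs \<tau>"
  using degs_mono[OF sub] by blast

lemma keys_sub: "Poly_Mapping.keys (r :: 'k laurent) \<subseteq> degs \<sigma> \<Longrightarrow> Poly_Mapping.keys r \<subseteq> degs \<tau>"
  using degs_mono[OF sub] by blast

lemma keys_diff_subset: "Poly_Mapping.keys x \<subseteq> S \<Longrightarrow> Poly_Mapping.keys y \<subseteq> S \<Longrightarrow>
    Poly_Mapping.keys (x - y :: 'z \<Rightarrow>\<^sub>0 int) \<subseteq> S"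
  using keys_diff[of x y] by blast

lemma keys_add_subset: "Poly_Mapping.keys x \<subseteq> S \<Longrightarrow> Poly_Mapping.keys y \<subseteq> S \<Longrightarrow>
    Poly_Mapping.keys (x + y :: 'z \<Rightarrow>\<^sub>0 int) \<subseteq> S"
  using Poly_Mapping.keys_add[of x y] by blast

lemma F_simps [simp]: "x \<in> carrier F \<longleftrightarrow> Poly_Mapping.keys x \<subseteq> pairs" "mult F = (+)" "one F = 0"
  by (simp_all add: tensor_free_def free_Abelian_group_def)

lemma comm_group_F: "comm_group F"
  by (simp add: tensor_free_def abelian_free_Abelian_group)

lemma inv_F: "Poly_Mapping.keys x \<subseteq> pairs \<Longrightarrow> inv\<^bsub>F\<^esub> x = - x"
  by (simp add: tensor_free_def)

definition relators :: "(('k laurent \<times> 'm) \<Rightarrow>\<^sub>0 int) set" where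
  "relators = {frag_of (r + r', a) - frag_of (r, a) - frag_of (r', a) | r r' a.
         r \<in> carrier (locR \<tau>) \<and> r' \<in> carrier (locR \<tau>) \<and> a \<in> carrier A} \<union>
      {frag_of (r, a \<oplus>\<^bsub>A\<^esub> a') - frag_of (r, a) - frag_of (r, a') | r a a'.
         r \<in> carrier (locR \<tau>) \<and> a \<in> carrier A \<and> a' \<in> carrier A} \<union>
      {frag_of (r * s, a) - frag_of (r, s \<odot>\<^bsub>A\<^esub> a) | r s a.
         r \<in> carrier (locR \<tau>) \<and> s \<in> carrier (locR \<sigma>) \<and> a \<in> carrier A}"

lemma Rel_eq: "Rel = generate F relators"
  by (simp add: tensor_relations_def relators_def)

lemma relators_cases:
  assumes "x \<in> relators"
  obtains (left) r r' a where "Poly_Mapping.keys r \<subseteq> degs \<tau>" "Poly_Mapping.keys r' \<subseteq> degs \<tau>" "a \<in> carrier A"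
      "x = frag_of (r + r', a) - frag_of (r, a) - frag_of (r', a)"
  | (right) r a a' where "Poly_Mapping.keys r \<subseteq> degs \<tau>" "a \<in> carrier A" "a' \<in> carrier A"
      "x = frag_of (r, a \<oplus>\<^bsub>A\<^esub> a') - frag_of (r, a) - frag_of (r, a')"
  | (balance) r s a where "Poly_Mapping.keys r \<subseteq> degs \<tau>" "Poly_Mapping.keys s \<subseteq> degs \<sigma>" "a \<in> carrier A"
      "x = frag_of (r * s, a) - frag_of (r, s \<odot>\<^bsub>A\<^esub> a)"
  using assms unfolding relators_def by auto

lemma keys_frag_pairs: "Poly_Mapping.keys r \<subseteq> degs \<tau> \<Longrightarrow> a \<in> carrier A \<Longrightarrow>
    Poly_Mapping.keys (frag_of (r, a)) \<subseteq> pairs"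
  by (simp add: keys_frag_of)

lemma relators_subset: "relators \<subseteq> carrier F"
proof
  fix x assume "x \<in> relators"
  then show "x \<in> carrier F"
    by (cases rule: relators_cases)
      (simp_all add: keys_diff_subset keys_frag_pairs add_in_locR mult_in_locR keys_sub)
qed

lemma subgroup_Rel: "subgroup Rel F"
  unfolding Rel_eq using comm_group_F relators_subset
  by (intro group.generate_is_subgroup) (simp_all add: comm_group_def)

lemma normal_Rel: "Rel \<lhd> F"
  using comm_group.subgroup_imp_normal[OF comm_group_F subgroup_Rel] .

lemma Rel_closed:
  "0 \<in> Rel" "x \<in> Rel \<Longrightarrow> y \<in> Rel \<Longrightarrow> x + y \<in> Rel" "x \<in> Rel \<Longrightarrow> - x \<in> Rel"
  "x \<in> Rel \<Longrightarrow> Poly_Mapping.keys x \<subseteq> pairs" "x \<in> relators \<Longrightarrow> x \<in> Rel"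
proof -
  show "0 \<in> Rel" using subgroup.one_closed[OF subgroup_Rel] by simp
  show "x \<in> Rel \<Longrightarrow> y \<in> Rel \<Longrightarrow> x + y \<in> Rel" using subgroup.m_closed[OF subgroup_Rel] by simp
  show *: "x \<in> Rel \<Longrightarrow> Poly_Mapping.keys x \<subseteq> pairs" for x
    using subsetD[OF subgroup.subset[OF subgroup_Rel]] by simp
  show "x \<in> Rel \<Longrightarrow> - x \<in> Rel" using subgroup.m_inv_closed[OF subgroup_Rel, of x] * inv_F by simp
  show "x \<in> relators \<Longrightarrow> x \<in> Rel" unfolding Rel_eq by (rule generate.incl)
qed

lemma Rel_diff: "x \<in> Rel \<Longrightarrow> y \<in> Rel \<Longrightarrow> x - y \<in> Rel"
  using Rel_closed(2)[of x "- y"] Rel_closed(3)[of y] by simp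

lemma relator_left: "\<lbrakk>Poly_Mapping.keys r \<subseteq> degs \<tau>; Poly_Mapping.keys r' \<subseteq> degs \<tau>; a \<in> carrier A\<rbrakk>
    \<Longrightarrow> frag_of (r + r', a) - frag_of (r, a) - frag_of (r', a) \<in> Rel"
  by (rule Rel_closed(5), unfold relators_def, intro UnI1 CollectI exI conjI) (rule refl, simp_all)

lemma relator_right: "\<lbrakk>Poly_Mapping.keys r \<subseteq> degs \<tau>; a \<in> carrier A; b \<in> carrier A\<rbrakk>
    \<Longrightarrow> frag_of (r, a \<oplus>\<^bsub>A\<^esub> b) - frag_of (r, a) - frag_of (r, b) \<in> Rel"
  by (rule Rel_closed(5), unfold relators_def, rule UnI1, rule UnI2, intro CollectI exI conjI)
    (rule refl, simp_all)

lemma relator_balance: "\<lbrakk>Poly_Mapping.keys r \<subseteq> degs \<tau>; Poly_Mapping.keys s \<subseteq> degs \<sigma>; a \<in> carrier A\<rbrakk>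
    \<Longrightarrow> frag_of (r * s, a) - frag_of (r, s \<odot>\<^bsub>A\<^esub> a) \<in> Rel"
  by (rule Rel_closed(5), unfold relators_def, rule UnI2, intro CollectI exI conjI)
    (rule refl, simp_all)

text \<open>The group generated by the relators is built up by sums and negatives, so an additive condition
  has to be tested on relators only.\<close>

lemma Rel_induct [consumes 1, case_names relator zero add uminus]:
  assumes "x \<in> Rel" "\<And>x. x \<in> relators \<Longrightarrow> P x" "P 0"
    "\<And>x y. \<lbrakk>x \<in> Rel; y \<in> Rel; P x; P y\<rbrakk> \<Longrightarrow> P (x + y)" "\<And>x. \<lbrakk>x \<in> Rel; P x\<rbrakk> \<Longrightarrow> P (- x)"
  shows "P x"
proof -
  have "x \<in> generate F relators" using assms(1) by (simp add: Rel_eq)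
  then have "P x \<and> x \<in> Rel"
  proof (induction rule: generate.induct)
    case one
    then show ?case using assms(3) Rel_closed(1) by simp
  next
    case (incl h)
    then show ?case using assms(2) Rel_closed(5) by simp
  next
    case (inv h)
    then show ?case using assms(2)[OF inv] assms(5)[of h] Rel_closed(3,4,5) inv_F[of h] by simp
  next
    case (eng h1 h2)
    then show ?case using assms(4) Rel_closed(2) by simp
  qed
  then show ?thesis by simp
qed

lemma in_cls: "y \<in> cls x \<longleftrightarrow> y - x \<in> Rel"
proof -
  have "y \<in> cls x \<longleftrightarrow> (\<exists>h\<in>Rel. y = h + x)"
    by (auto simp: tensor_class_def r_coset_def)
  also have "\<dots> \<longleftrightarrow> y - x \<in> Rel"
    by (metis add_diff_cancel diff_add_cancel)
  finally show ?thesis .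
qed

lemma cls_eq_iff: "cls x = cls y \<longleftrightarrow> x - y \<in> Rel"
proof
  assume "cls x = cls y"
  then show "x - y \<in> Rel" using in_cls[of x x] in_cls[of x y] Rel_closed(1) by simp
next
  assume xy: "x - y \<in> Rel"
  have "z - x \<in> Rel \<longleftrightarrow> z - y \<in> Rel" for z
    using Rel_closed(2)[OF _ xy, of "z - x"] Rel_diff[OF _ xy, of "z - y"] by auto
  then show "cls x = cls y" using in_cls by blast
qed

lemma E_simps:
  "carrier E = carrier (F Mod Rel)" "zero E = one (F Mod Rel)" "add E = mult (F Mod Rel)"
  "smult E = (\<lambda>r X. \<Union>x\<in>X. cls (frag_extend (\<lambda>(r', a). frag_of (r * r', a)) x))"
  "hpart E d = generate (F Mod Rel)
         {tens \<sigma> \<tau> A (Poly_Mapping.single e c) a | e c a. e \<in> degs \<tau> \<and> a \<in> hpart A (d - e)}"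
  by (simp_all add: ext_scalars_def Let_def)

lemma E_carrier: "X \<in> carrier E \<longleftrightarrow> (\<exists>x. Poly_Mapping.keys x \<subseteq> pairs \<and> X = cls x)"
proof -
  have "X \<in> carrier E \<longleftrightarrow> (\<exists>x\<in>carrier F. X = Rel #>\<^bsub>F\<^esub> x)"
    unfolding E_simps FactGroup_def RCOSETS_def by auto
  then show ?thesis by (simp add: tensor_class_def Bex_def)
qed

lemma cls_carrier: "Poly_Mapping.keys x \<subseteq> pairs \<Longrightarrow> cls x \<in> carrier E"
  using E_carrier by blast

lemma cls_add:
  assumes "Poly_Mapping.keys x \<subseteq> pairs" "Poly_Mapping.keys y \<subseteq> pairs"
  shows "cls x \<oplus>\<^bsub>E\<^esub> cls y = cls (x + y)"
  using normal.rcos_sum[OF normal_Rel, of x y] assms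
  by (simp add: E_simps FactGroup_def tensor_class_def)

lemma cls_zero: "\<zero>\<^bsub>E\<^esub> = cls 0"
proof -
  have "cls 0 = Rel" using in_cls[of _ 0] by auto
  then show ?thesis by (simp add: E_simps FactGroup_def)
qed

lemma mulmap_Rel:
  assumes x: "x \<in> Rel" and r: "Poly_Mapping.keys r \<subseteq> degs \<tau>"
  shows "frag_extend (\<lambda>(r', a). frag_of (r * r', a)) x \<in> Rel" (is "?\<mu> x \<in> Rel")
  using x
proof (induction rule: Rel_induct)
  case (relator x)
  then show ?case
  proof (cases rule: relators_cases)
    case (left r1 r2 a)
    then have "?\<mu> x = frag_of (r * r1 + r * r2, a) - frag_of (r * r1, a) - frag_of (r * r2, a)"
      by (simp add: frag_extend_diff distrib_left)
    then show ?thesis using relator_left[OF mult_in_locR[OF r left(1)] mult_in_locR[OF r left(2)] left(3)] by simp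
  next
    case (right r1 a b)
    then have "?\<mu> x = frag_of (r * r1, a \<oplus>\<^bsub>A\<^esub> b) - frag_of (r * r1, a) - frag_of (r * r1, b)"
      by (simp add: frag_extend_diff)
    then show ?thesis using relator_right[OF mult_in_locR[OF r right(1)] right(2,3)] by simp
  next
    case (balance r1 s a)
    then have "?\<mu> x = frag_of ((r * r1) * s, a) - frag_of (r * r1, s \<odot>\<^bsub>A\<^esub> a)"
      by (simp add: frag_extend_diff mult.assoc)
    then show ?thesis using relator_balance[OF mult_in_locR[OF r balance(1)] balance(2,3)] by simp
  qed
qed (auto simp: Rel_closed frag_extend_add frag_extend_minus)

lemma smult_cls:
  assumes r: "Poly_Mapping.keys r \<subseteq> degs \<tau>"
  shows "r \<odot>\<^bsub>E\<^esub> cls x = cls (frag_extend (\<lambda>(r', a). frag_of (r * r', a)) x)" (is "_ = cls (?\<mu> x)")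
proof -
  have "cls (?\<mu> y) = cls (?\<mu> x)" if "y \<in> cls x" for y
  proof -
    have "?\<mu> (y - x) \<in> Rel" using that mulmap_Rel[OF _ r] in_cls by blast
    then show ?thesis by (simp add: cls_eq_iff frag_extend_diff)
  qed
  moreover have "x \<in> cls x" using in_cls Rel_closed(1) by simp
  ultimately show ?thesis unfolding E_simps(4) by blast
qed

lemma tens_carrier: "Poly_Mapping.keys r \<subseteq> degs \<tau> \<Longrightarrow> a \<in> carrier A \<Longrightarrow> tens \<sigma> \<tau> A r a \<in> carrier E"
  unfolding tens_def by (intro cls_carrier keys_frag_pairs)

lemma smult_tens: "Poly_Mapping.keys r \<subseteq> degs \<tau> \<Longrightarrow> r \<odot>\<^bsub>E\<^esub> tens \<sigma> \<tau> A r' a = tens \<sigma> \<tau> A (r * r') a"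
  by (simp add: tens_def smult_cls)

lemma tens_add:
  assumes r: "Poly_Mapping.keys r \<subseteq> degs \<tau>" and a: "a \<in> carrier A" "b \<in> carrier A"
  shows "tens \<sigma> \<tau> A r (a \<oplus>\<^bsub>A\<^esub> b) = tens \<sigma> \<tau> A r a \<oplus>\<^bsub>E\<^esub> tens \<sigma> \<tau> A r b"
proof -
  have "frag_of (r, a \<oplus>\<^bsub>A\<^esub> b) - (frag_of (r, a) + frag_of (r, b)) \<in> Rel"
    using relator_right[OF assms] by (simp add: diff_diff_add)
  then show ?thesis using assms by (simp add: tens_def cls_add keys_frag_pairs cls_eq_iff)
qed

lemma tens_balance:
  assumes "Poly_Mapping.keys r \<subseteq> degs \<tau>" "Poly_Mapping.keys s \<subseteq> degs \<sigma>" "a \<in> carrier A"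
  shows "tens \<sigma> \<tau> A (r * s) a = tens \<sigma> \<tau> A r (s \<odot>\<^bsub>A\<^esub> a)"
  using relator_balance[OF assms] by (simp add: tens_def cls_eq_iff)

lemma tens_zero: "Poly_Mapping.keys r \<subseteq> degs \<tau> \<Longrightarrow> tens \<sigma> \<tau> A r \<zero>\<^bsub>A\<^esub> = \<zero>\<^bsub>E\<^esub>"
proof -
  assume r: "Poly_Mapping.keys r \<subseteq> degs \<tau>"
  have "- frag_of (r, \<zero>\<^bsub>A\<^esub>) \<in> Rel" using relator_right[OF r zero_closed zero_closed] by simp
  then show ?thesis using Rel_closed(3)[of "- frag_of (r, \<zero>\<^bsub>A\<^esub>)"] by (simp add: tens_def cls_zero cls_eq_iff)
qed

lemma keys_u: "Poly_Mapping.keys (u N) \<subseteq> degs \<tau>"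
  by simp

lemma tens_shift:
  assumes "a \<in> carrier A"
  shows "tens \<sigma> \<tau> A (u N) a = tens \<sigma> \<tau> A (u (N + M)) (tpow A (inv_deg \<sigma> \<tau> M) a)"
proof -
  have "u N = u (N + M) * Poly_Mapping.single (inv_deg \<sigma> \<tau> M) 1"
    by (simp add: mult_single inv_deg_add)
  then show ?thesis
    using tens_balance[of "u (N + M)" "Poly_Mapping.single (inv_deg \<sigma> \<tau> M) 1" a] assms
    by (simp add: tpow_def)
qed

text \<open>Every tensor is a single fraction \<open>s\<^sup>-\<^sup>N \<otimes> a\<close>: a pure tensor \<open>r \<otimes> a\<close> becomes one by moving \<open>s\<^sup>N r \<in> R\<^sub>\<sigma>\<close> across, and the
  difference of two fractions is brought to a common denominator.\<close>

lemma ext_scalars_elem: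
  assumes "X \<in> carrier E"
  obtains N a where "a \<in> carrier A" "X = tens \<sigma> \<tau> A (u N) a"
proof -
  obtain x where x: "Poly_Mapping.keys x \<subseteq> pairs" "X = cls x" using assms E_carrier by blast
  have "\<exists>N a. a \<in> carrier A \<and> cls x = tens \<sigma> \<tau> A (u N) a"
    using x(1)
  proof (induction rule: frag_induction)
    case zero
    then show ?case using tens_zero[OF keys_u, of 0] cls_zero by (metis zero_closed)
  next
    case (diff x y)
    then obtain N M a b where *: "a \<in> carrier A" "b \<in> carrier A"
      "cls x = tens \<sigma> \<tau> A (u N) a" "cls y = tens \<sigma> \<tau> A (u M) b" by blast
    define a' b' K where "a' = tpow A (inv_deg \<sigma> \<tau> M) a" and "b' = tpow A (inv_deg \<sigma> \<tau> N) b"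
      and "K = N + M"
    have cl: "a' \<in> carrier A" "b' \<in> carrier A" using * by (auto simp: a'_def b'_def)
    have "cls x = tens \<sigma> \<tau> A (u K) a'" "cls y = tens \<sigma> \<tau> A (u K) b'"
      using * tens_shift[of a N M] tens_shift[of b M N] by (simp_all add: a'_def b'_def K_def add.commute)
    then have "x - frag_of (u K, a') \<in> Rel" "y - frag_of (u K, b') \<in> Rel"
      by (simp_all add: tens_def cls_eq_iff)
    then have d: "(x - frag_of (u K, a')) - (y - frag_of (u K, b')) \<in> Rel" by (rule Rel_diff)
    have "(a' \<ominus>\<^bsub>A\<^esub> b') \<oplus>\<^bsub>A\<^esub> b' = a'" using cl by (simp add: a_minus_def a_assoc l_neg)
    then have "frag_of (u K, a') - frag_of (u K, a' \<ominus>\<^bsub>A\<^esub> b') - frag_of (u K, b') \<in> Rel"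
      using relator_right[OF keys_u, of "a' \<ominus>\<^bsub>A\<^esub> b'" b' K] cl by simp
    from Rel_closed(2)[OF d this]
    have "cls (x - y) = tens \<sigma> \<tau> A (u K) (a' \<ominus>\<^bsub>A\<^esub> b')"
      by (simp add: tens_def cls_eq_iff algebra_simps)
    then show ?case using cl by blast
  next
    case (one p)
    then obtain r a where p: "p = (r, a)" "Poly_Mapping.keys r \<subseteq> degs \<tau>" "a \<in> carrier A" by auto
    obtain N where N: "Poly_Mapping.keys (Poly_Mapping.single (inv_deg \<sigma> \<tau> N) 1 * r) \<subseteq> degs \<sigma>"
      using locR_denominator[OF p(2), of \<sigma>] by blast
    have "r = u N * (Poly_Mapping.single (inv_deg \<sigma> \<tau> N) 1 * r)"
      by (simp add: mult.assoc[symmetric] mult_single)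
    then have "cls (frag_of p) = tens \<sigma> \<tau> A (u N) ((Poly_Mapping.single (inv_deg \<sigma> \<tau> N) 1 * r) \<odot>\<^bsub>A\<^esub> a)"
      using tens_balance[OF keys_u N p(3), of N] p(1) by (simp add: tens_def)
    then show ?case using p N smult_closed by (metis locR_simps(1))
  qed
  then show thesis using that x(2) by blast
qed

text \<open>The only fractions that vanish are those with \<open>s\<close>-power torsion numerators.  For each \<open>M\<close> let \<open>h\<^sub>M\<close> be the additive
  map on representatives that sends \<open>(r, b)\<close> to \<open>(s\<^sup>M r) b\<close> when \<open>s\<^sup>M r\<close> lies in \<open>R\<^sub>\<sigma>\<close>, and to \<open>0\<close> otherwise.  A given relation
  involves finitely many \<open>r\<close>, so \<open>h\<^sub>M\<close> kills it for all large \<open>M\<close>; applied to a vanishing fraction with denominator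
  \<open>s\<^sup>N\<close> and a large \<open>M\<close>, this says that a power of \<open>s\<close> annihilates \<open>a\<close>.\<close>

lemma tens_eq_zero:
  assumes a: "a \<in> carrier A" and z: "tens \<sigma> \<tau> A (u N) a = \<zero>\<^bsub>E\<^esub>"
  obtains M where "tpow A (inv_deg \<sigma> \<tau> M) a = \<zero>\<^bsub>A\<^esub>"
proof -
  define s :: "nat \<Rightarrow> 'k laurent" where "s M = Poly_Mapping.single (inv_deg \<sigma> \<tau> M) 1" for M
  define G where "G M p = (if Poly_Mapping.keys (s M * fst p) \<subseteq> degs \<sigma>
    then (s M * fst p) \<odot>\<^bsub>A\<^esub> snd p else \<zero>\<^bsub>A\<^esub>)" for M p
  have "\<forall>M. \<exists>h. h \<in> hom F (add_monoid A) \<and> (\<forall>p\<in>pairs. h (frag_of p) = G M p)"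
  proof
    fix M
    have "G M ` pairs \<subseteq> carrier (add_monoid A)"
      by (auto simp: G_def)
    from comm_group.free_Abelian_group_universal[OF a_comm_group this]
    show "\<exists>h. h \<in> hom F (add_monoid A) \<and> (\<forall>p\<in>pairs. h (frag_of p) = G M p)"
      unfolding tensor_free_def by metis
  qed
  then obtain h where h: "\<And>M. h M \<in> hom F (add_monoid A)"
    and hG: "\<And>M p. p \<in> pairs \<Longrightarrow> h M (frag_of p) = G M p" by metis
  note hd = hom_free[OF abelian_group_axioms h[unfolded tensor_free_def]]
  note hr = hom_free_relator[OF abelian_group_axioms h[unfolded tensor_free_def]]
  have hval: "h M (frag_of (r, b)) = (s M * r) \<odot>\<^bsub>A\<^esub> b"
    if "Poly_Mapping.keys r \<subseteq> degs \<tau>" "b \<in> carrier A" "Poly_Mapping.keys (s M * r) \<subseteq> degs \<sigma>" for M r b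
    using that hG[of "(r, b)" M] by (simp add: G_def)
  have "\<exists>M0. \<forall>M\<ge>M0. h M x = \<zero>\<^bsub>A\<^esub>" if "x \<in> Rel" for x
    using that
  proof (induction rule: Rel_induct)
    case (relator x)
    then show ?case
    proof (cases rule: relators_cases)
      case (left r r' b)
      obtain M0 where M0: "\<And>M. M \<ge> M0 \<Longrightarrow> Poly_Mapping.keys (s M * r) \<subseteq> degs \<sigma>"
        using locR_denominator[OF left(1)] unfolding s_def by blast
      obtain M1 where M1: "\<And>M. M \<ge> M1 \<Longrightarrow> Poly_Mapping.keys (s M * r') \<subseteq> degs \<sigma>"
        using locR_denominator[OF left(2)] unfolding s_def by blast
      have "h M x = \<zero>\<^bsub>A\<^esub>" if "M \<ge> max M0 M1" for M
      proof -
        have k: "Poly_Mapping.keys (s M * r) \<subseteq> degs \<sigma>" "Poly_Mapping.keys (s M * r') \<subseteq> degs \<sigma>"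
          using M0 M1 that by auto
        have "h M (frag_of (r + r', b)) = h M (frag_of (r, b)) \<oplus>\<^bsub>A\<^esub> h M (frag_of (r', b))"
          using left k smult_l_distr[of "s M * r" "s M * r'" b]
          by (simp add: hval add_in_locR distrib_left)
        then show ?thesis
          unfolding left(4) using left by (intro hr(2) keys_frag_pairs add_in_locR)
      qed
      then show ?thesis by blast
    next
      case (right r b c)
      obtain M0 where M0: "\<And>M. M \<ge> M0 \<Longrightarrow> Poly_Mapping.keys (s M * r) \<subseteq> degs \<sigma>"
        using locR_denominator[OF right(1)] unfolding s_def by blast
      have "h M x = \<zero>\<^bsub>A\<^esub>" if "M \<ge> M0" for M
      proof -
        have "h M (frag_of (r, b \<oplus>\<^bsub>A\<^esub> c)) = h M (frag_of (r, b)) \<oplus>\<^bsub>A\<^esub> h M (frag_of (r, c))"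
          using right M0[OF that] by (simp add: hval smult_r_distr)
        then show ?thesis
          unfolding right(4) using right by (intro hr(2) keys_frag_pairs a_closed)
      qed
      then show ?thesis by blast
    next
      case (balance r t b)
      obtain M0 where M0: "\<And>M. M \<ge> M0 \<Longrightarrow> Poly_Mapping.keys (s M * r) \<subseteq> degs \<sigma>"
        using locR_denominator[OF balance(1)] unfolding s_def by blast
      have "h M x = \<zero>\<^bsub>A\<^esub>" if "M \<ge> M0" for M
      proof -
        have "h M (frag_of (r * t, b)) = h M (frag_of (r, t \<odot>\<^bsub>A\<^esub> b))"
          using balance M0[OF that] smult_assoc1[of "s M * r" t b]
          by (simp add: hval mult_in_locR keys_sub mult.assoc[symmetric])
        then show ?thesis
          unfolding balance(4) using balance
          by (intro hr(1)[OF keys_frag_pairs[OF mult_in_locR[OF balance(1) keys_sub[OF balance(2)]]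
              balance(3)] keys_frag_pairs[OF balance(1) smult_closed]]) simp_all
      qed
      then show ?thesis by blast
    qed
  next
    case zero
    then show ?case using hd(3)[of 0 0] by simp
  next
    case (add x y)
    then obtain M0 M1 where "\<And>M. M \<ge> M0 \<Longrightarrow> h M x = \<zero>\<^bsub>A\<^esub>" "\<And>M. M \<ge> M1 \<Longrightarrow> h M y = \<zero>\<^bsub>A\<^esub>"
      by blast
    then show ?case using hd(4)[OF Rel_closed(4)[OF add(1)] Rel_closed(4)[OF add(2)]]
      by (intro exI[of _ "max M0 M1"]) simp
  next
    case (uminus x)
    then obtain M0 where "\<And>M. M \<ge> M0 \<Longrightarrow> h M x = \<zero>\<^bsub>A\<^esub>" by blast
    then show ?case using hd(5)[OF Rel_closed(4)[OF uminus(1)], of 0]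
      by (intro exI[of _ M0]) simp
  qed
  moreover have "frag_of (u N, a) \<in> Rel"
    using z by (simp add: tens_def cls_zero cls_eq_iff)
  ultimately obtain M0 where M0: "\<And>M. M \<ge> M0 \<Longrightarrow> h M (frag_of (u N, a)) = \<zero>\<^bsub>A\<^esub>" by blast
  define M where "M = M0 + N"
  have su: "s M * u N = Poly_Mapping.single (inv_deg \<sigma> \<tau> M0) 1"
    by (simp add: s_def M_def mult_single inv_deg_add)
  have "h M (frag_of (u N, a)) = tpow A (inv_deg \<sigma> \<tau> M0) a"
    using hval[of "u N" a M] a unfolding su by (simp add: tpow_def)
  then show thesis using M0[of M] that by (simp add: M_def)
qed

end

lemma graded_isoE:
  assumes "f \<in> graded_iso \<sigma> A B"
  obtains g where "g \<in> graded_hom \<sigma> B A" "\<And>x. x \<in> carrier A \<Longrightarrow> g (f x) = x"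
    "\<And>y. y \<in> carrier B \<Longrightarrow> f (g y) = y"
  using assms unfolding graded_iso_def by blast

context scalar_extension
begin

lemma tens_hpart:
  assumes "e \<in> degs \<tau>" "a \<in> hpart A d"
  shows "tens \<sigma> \<tau> A (Poly_Mapping.single e c) a \<in> hpart E (e + d)"
  unfolding E_simps using assms
  by (intro generate.incl CollectI exI[of _ e] exI[of _ c] exI[of _ a]) simp

lemma group_quotient: "group (F Mod Rel)"
  by (rule normal.factorgroup_is_group[OF normal_Rel])

lemma hpart_E_carrier: "hpart E d \<subseteq> carrier E"
proof -
  have "{tens \<sigma> \<tau> A (Poly_Mapping.single e c) a | e c a. e \<in> degs \<tau> \<and> a \<in> hpart A (d - e)} \<subseteq> carrier E"
    using hpart_carrier tens_carrier single_in_locR by blast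
  then have "hpart E d \<subseteq> carrier (F Mod Rel)"
    unfolding E_simps by (intro group.generate_incl[OF group_quotient])
  then show ?thesis by (simp add: E_simps)
qed

lemma E_closed:
  "\<lbrakk>X \<in> carrier E; Y \<in> carrier E\<rbrakk> \<Longrightarrow> X \<oplus>\<^bsub>E\<^esub> Y \<in> carrier E"
  "\<lbrakk>Poly_Mapping.keys r \<subseteq> degs \<tau>; X \<in> carrier E\<rbrakk> \<Longrightarrow> r \<odot>\<^bsub>E\<^esub> X \<in> carrier E"
proof -
  show "\<lbrakk>X \<in> carrier E; Y \<in> carrier E\<rbrakk> \<Longrightarrow> X \<oplus>\<^bsub>E\<^esub> Y \<in> carrier E"
    unfolding E_simps by (rule monoid.m_closed[OF group.is_monoid[OF group_quotient]])
  assume r: "Poly_Mapping.keys r \<subseteq> degs \<tau>" and X: "X \<in> carrier E"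
  obtain N a where "a \<in> carrier A" "X = tens \<sigma> \<tau> A (u N) a" by (rule ext_scalars_elem[OF X])
  then show "r \<odot>\<^bsub>E\<^esub> X \<in> carrier E"
    using r by (simp add: smult_tens tens_carrier mult_in_locR)
qed

lemma E_zero_carrier: "\<zero>\<^bsub>E\<^esub> \<in> carrier E"
  unfolding cls_zero by (rule cls_carrier) simp

lemma E_add_zero: "X \<in> carrier E \<Longrightarrow> X \<oplus>\<^bsub>E\<^esub> \<zero>\<^bsub>E\<^esub> = X"
  unfolding E_simps by (rule monoid.r_one[OF group.is_monoid[OF group_quotient]])

text \<open>The canonical map \<open>A \<rightarrow> R\<^sub>\<tau> \<otimes> A\<close> is a localization by \<open>ext_scalars_elem\<close> and \<open>tens_eq_zero\<close>, and isomorphic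
  targets inherit this.\<close>

lemma localizes_of_graded_iso:
  assumes B: "graded_module \<tau> B" and h: "h \<in> graded_iso \<tau> E B"
  shows "localizes \<sigma> \<tau> A B (\<lambda>a. h (tens \<sigma> \<tau> A 1 a))"
proof -
  interpret B: graded_module \<tau> B by (rule B)
  have one: "Poly_Mapping.keys (1 :: 'k laurent) \<subseteq> degs \<tau>" by (rule one_in_locR)
  have hh: "h \<in> graded_hom \<tau> E B" using h by (simp add: graded_iso_def)
  obtain g where g: "g \<in> graded_hom \<tau> B E" "\<And>X. X \<in> carrier E \<Longrightarrow> g (h X) = X"
    "\<And>y. y \<in> carrier B \<Longrightarrow> h (g y) = y" by (rule graded_isoE[OF h]) blast
  have hz: "h \<zero>\<^bsub>E\<^esub> = \<zero>\<^bsub>B\<^esub>"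
    using graded_homD(1)[OF hh E_zero_carrier] graded_homD(2)[OF hh E_zero_carrier E_zero_carrier]
      E_add_zero[OF E_zero_carrier] by simp
  have "(\<lambda>a. h (tens \<sigma> \<tau> A 1 a)) \<in> graded_hom \<sigma> A B"
  proof (rule graded_homI)
    fix a assume a: "a \<in> carrier A"
    then show "h (tens \<sigma> \<tau> A 1 a) \<in> carrier B" by (intro graded_homD(1)[OF hh] tens_carrier one)
    fix r :: "'k laurent" assume r: "Poly_Mapping.keys r \<subseteq> degs \<sigma>"
    have "tens \<sigma> \<tau> A 1 (r \<odot>\<^bsub>A\<^esub> a) = r \<odot>\<^bsub>E\<^esub> tens \<sigma> \<tau> A 1 a"
      using tens_balance[OF one r a] smult_tens[OF keys_sub[OF r], of 1 a] by simp
    then show "h (tens \<sigma> \<tau> A 1 (r \<odot>\<^bsub>A\<^esub> a)) = r \<odot>\<^bsub>B\<^esub> h (tens \<sigma> \<tau> A 1 a)"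
      using graded_homD(3)[OF hh keys_sub[OF r] tens_carrier[OF one a]] by simp
  next
    fix a b assume "a \<in> carrier A" "b \<in> carrier A"
    then show "h (tens \<sigma> \<tau> A 1 (a \<oplus>\<^bsub>A\<^esub> b)) = h (tens \<sigma> \<tau> A 1 a) \<oplus>\<^bsub>B\<^esub> h (tens \<sigma> \<tau> A 1 b)"
      by (simp add: tens_add[OF one] graded_homD(2)[OF hh] tens_carrier[OF one])
  next
    fix d a assume "a \<in> hpart A d"
    then show "h (tens \<sigma> \<tau> A 1 a) \<in> hpart B d"
      using graded_homD(4)[OF hh] tens_hpart[of 0 a d 1] by simp
  qed
  moreover have "\<exists>N. tpow A (inv_deg \<sigma> \<tau> N) a = \<zero>\<^bsub>A\<^esub>"
    if a: "a \<in> carrier A" and z: "h (tens \<sigma> \<tau> A 1 a) = \<zero>\<^bsub>B\<^esub>" for a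
  proof -
    have "tens \<sigma> \<tau> A 1 a = \<zero>\<^bsub>E\<^esub>"
      using g(2)[OF tens_carrier[OF one a]] g(2)[OF E_zero_carrier] z hz by simp
    moreover have "u 0 = 1" by (simp add: inv_deg_def zero_prod_def[symmetric])
    ultimately show ?thesis using tens_eq_zero[OF a, of 0] by metis
  qed
  moreover have "\<exists>N. \<exists>a\<in>carrier A. tpow B (inv_deg \<sigma> \<tau> N) y = h (tens \<sigma> \<tau> A 1 a)"
    if y: "y \<in> carrier B" for y
  proof -
    obtain N a where a: "a \<in> carrier A" "g y = tens \<sigma> \<tau> A (u N) a"
      by (rule ext_scalars_elem[OF graded_homD(1)[OF g(1) y]])
    have k: "Poly_Mapping.keys (Poly_Mapping.single (inv_deg \<sigma> \<tau> N) (1::'k)) \<subseteq> degs \<tau>" by simp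
    have "tpow B (inv_deg \<sigma> \<tau> N) y = tpow B (inv_deg \<sigma> \<tau> N) (h (g y))" using g(3)[OF y] by simp
    also have "\<dots> = h (Poly_Mapping.single (inv_deg \<sigma> \<tau> N) 1 \<odot>\<^bsub>E\<^esub> g y)"
      unfolding tpow_def using graded_homD(3)[OF hh k graded_homD(1)[OF g(1) y]] by simp
    also have "\<dots> = h (tens \<sigma> \<tau> A 1 a)"
      using smult_tens[OF k, of "u N" a] by (simp add: a(2) mult_single)
    finally show ?thesis using a(1) by blast
  qed
  ultimately show ?thesis unfolding localizes_def by blast
qed

text \<open>Conversely a localization is an extension of scalars: \<open>r \<otimes> a \<mapsto> r \<psi>(a)\<close> respects the relators, and it is bijective
  because both sides consist of fractions with the same criterion for vanishing.\<close>

lemma graded_iso_of_localizes: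
  assumes B: "graded_module \<tau> B" and loc: "localizes \<sigma> \<tau> A B \<psi>"
  obtains h where "h \<in> graded_iso \<tau> E B"
    "\<And>r a. \<lbrakk>Poly_Mapping.keys r \<subseteq> degs \<tau>; a \<in> carrier A\<rbrakk> \<Longrightarrow> h (tens \<sigma> \<tau> A r a) = r \<odot>\<^bsub>B\<^esub> \<psi> a"
proof -
  interpret AB: graded_module_pair \<sigma> A \<tau> B
    using B sub graded_module_axioms by (simp add: graded_module_pair_def graded_module_pair_axioms_def)
  note B_abelian = AB.B.abelian_group_axioms
  have \<psi>: "\<psi> \<in> graded_hom \<sigma> A B" using loc by (simp add: localizes_def)
  note \<psi>D = graded_homD[OF \<psi>]
  have "(\<lambda>(r, a). r \<odot>\<^bsub>B\<^esub> \<psi> a) ` pairs \<subseteq> carrier (add_monoid B)"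
    using \<psi>D(1) by auto
  from comm_group.free_Abelian_group_universal[OF AB.B.a_comm_group this]
  obtain H where "H \<in> hom F (add_monoid B)"
    and H': "\<And>p. p \<in> pairs \<Longrightarrow> H (frag_of p) = (\<lambda>(r, a). r \<odot>\<^bsub>B\<^esub> \<psi> a) p"
    unfolding tensor_free_def by metis
  then have Hhom: "H \<in> hom (free_Abelian_group pairs) (add_monoid B)" by (simp add: tensor_free_def)
  note hd = hom_free[OF B_abelian Hhom] and hr = hom_free_relator[OF B_abelian Hhom]
  have H: "H (frag_of (r, a)) = r \<odot>\<^bsub>B\<^esub> \<psi> a" if "Poly_Mapping.keys r \<subseteq> degs \<tau>" "a \<in> carrier A" for r a
    using H'[of "(r, a)"] that by simp
  have HRel: "H x = \<zero>\<^bsub>B\<^esub>" if "x \<in> Rel" for x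
    using that
  proof (induction rule: Rel_induct)
    case (relator x)
    then show ?case
    proof (cases rule: relators_cases)
      case (left r r' a)
      then have "H (frag_of (r + r', a)) = H (frag_of (r, a)) \<oplus>\<^bsub>B\<^esub> H (frag_of (r', a))"
        using AB.B.smult_l_distr[of r r' "\<psi> a"] \<psi>D(1) by (simp add: H add_in_locR)
      then show ?thesis
        unfolding left(4) using left by (intro hr(2) keys_frag_pairs add_in_locR)
    next
      case (right r a b)
      then have "H (frag_of (r, a \<oplus>\<^bsub>A\<^esub> b)) = H (frag_of (r, a)) \<oplus>\<^bsub>B\<^esub> H (frag_of (r, b))"
        using \<psi>D(1,2) by (simp add: H AB.B.smult_r_distr)
      then show ?thesis
        unfolding right(4) using right by (intro hr(2) keys_frag_pairs a_closed)
    next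
      case (balance r t a)
      then have "H (frag_of (r * t, a)) = H (frag_of (r, t \<odot>\<^bsub>A\<^esub> a))"
        using AB.B.smult_assoc1[of r t "\<psi> a"] \<psi>D(1,3) by (simp add: H mult_in_locR keys_sub)
      then show ?thesis
        unfolding balance(4) using balance
        by (intro hr(1)[OF keys_frag_pairs[OF mult_in_locR[OF balance(1) keys_sub[OF balance(2)]]
            balance(3)] keys_frag_pairs[OF balance(1) smult_closed]]) simp_all
    qed
  next
    case zero
    then show ?case using hd(3)[of 0 0] by simp
  next
    case (add x y)
    then show ?case using hd(4)[OF Rel_closed(4)[OF add(1)] Rel_closed(4)[OF add(2)]] by simp
  next
    case (uminus x)
    then show ?case using hd(5)[OF Rel_closed(4)[OF uminus(1)], of 0] by simp
  qed
  define h where "h X = H (SOME x. x \<in> X)" for X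
  have hcls: "h (cls x) = H x" if x: "Poly_Mapping.keys x \<subseteq> pairs" for x
  proof -
    have "x \<in> cls x" using in_cls Rel_closed(1) by simp
    then have "(SOME x'. x' \<in> cls x) \<in> cls x" by (rule someI)
    then have y: "(SOME x'. x' \<in> cls x) - x \<in> Rel" (is "?y - x \<in> Rel") using in_cls by blast
    have "H ((?y - x) + x) = H (?y - x) \<oplus>\<^bsub>B\<^esub> H x" using hd(4)[OF Rel_closed(4)[OF y] x] .
    then show ?thesis using HRel[OF y] hd(2)[OF x x] by (simp add: h_def)
  qed
  have ht: "h (tens \<sigma> \<tau> A r a) = r \<odot>\<^bsub>B\<^esub> \<psi> a"
    if "Poly_Mapping.keys r \<subseteq> degs \<tau>" "a \<in> carrier A" for r a
    unfolding tens_def using that by (simp add: hcls[OF keys_frag_pairs] H)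
  have hc: "h X \<in> carrier B" if "X \<in> carrier E" for X
    using that hcls hd(2) E_carrier by (metis)
  have hadd: "h (X \<oplus>\<^bsub>E\<^esub> Y) = h X \<oplus>\<^bsub>B\<^esub> h Y" if XY: "X \<in> carrier E" "Y \<in> carrier E" for X Y
  proof -
    obtain x y where xy: "Poly_Mapping.keys x \<subseteq> pairs" "X = cls x" "Poly_Mapping.keys y \<subseteq> pairs" "Y = cls y"
      using XY E_carrier by metis
    then show ?thesis using cls_add[OF xy(1,3)] hd(4)[OF xy(1,3)] keys_add_subset[OF xy(1,3)]
      by (simp add: hcls)
  qed
  have hz: "h \<zero>\<^bsub>E\<^esub> = \<zero>\<^bsub>B\<^esub>" unfolding cls_zero using hd(3)[of 0 0] by (simp add: hcls)
  have "h \<in> graded_hom \<tau> E B"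
  proof (rule graded_homI[OF hc hadd])
    fix r :: "'k laurent" and X assume r: "Poly_Mapping.keys r \<subseteq> degs \<tau>" and X: "X \<in> carrier E"
    obtain N a where a: "a \<in> carrier A" "X = tens \<sigma> \<tau> A (u N) a" by (rule ext_scalars_elem[OF X])
    have "h (r \<odot>\<^bsub>E\<^esub> X) = (r * u N) \<odot>\<^bsub>B\<^esub> \<psi> a"
      unfolding a(2) smult_tens[OF r] by (rule ht[OF mult_in_locR[OF r keys_u] a(1)])
    also have "\<dots> = r \<odot>\<^bsub>B\<^esub> (u N \<odot>\<^bsub>B\<^esub> \<psi> a)"
      using AB.B.smult_assoc1[of r "u N" "\<psi> a"] r \<psi>D(1)[OF a(1)] by simp
    finally show "h (r \<odot>\<^bsub>E\<^esub> X) = r \<odot>\<^bsub>B\<^esub> h X" unfolding a(2) ht[OF keys_u a(1)] .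
  next
    fix d X assume "X \<in> hpart E d"
    then have "X \<in> generate (F Mod Rel)
         {tens \<sigma> \<tau> A (Poly_Mapping.single e c) a | e c a. e \<in> degs \<tau> \<and> a \<in> hpart A (d - e)}"
      (is "X \<in> generate _ ?G") by (simp add: E_simps)
    then show "h X \<in> hpart B d"
    proof (induction rule: generate.induct)
      case one
      then show ?case using hz by (simp add: E_simps)
    next
      case (incl X)
      then obtain e c a where X: "X = tens \<sigma> \<tau> A (Poly_Mapping.single e c) a" "e \<in> degs \<tau>" "a \<in> hpart A (d - e)"
        by blast
      then show ?case
        using ht[OF single_in_locR[OF X(2)] hpart_carrier[OF X(3)]]
          AB.B.hpart_smult[OF X(2) \<psi>D(4)[OF X(3)]] by simp
    next
      case (inv X)
      then obtain e c a where X: "X = tens \<sigma> \<tau> A (Poly_Mapping.single e c) a" "e \<in> degs \<tau>" "a \<in> hpart A (d - e)"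
        by blast
      have XE: "X \<in> carrier E" using X hpart_carrier by (simp add: tens_carrier)
      interpret Q: group "F Mod Rel" by (rule group_quotient)
      have inv: "inv\<^bsub>F Mod Rel\<^esub> X \<in> carrier E" "X \<oplus>\<^bsub>E\<^esub> inv\<^bsub>F Mod Rel\<^esub> X = \<zero>\<^bsub>E\<^esub>"
        using XE Q.r_inv by (simp_all add: E_simps)
      have "h X \<oplus>\<^bsub>B\<^esub> h (inv\<^bsub>F Mod Rel\<^esub> X) = \<zero>\<^bsub>B\<^esub>" using hadd[OF XE inv(1)] inv(2) hz by simp
      then have eq: "h (inv\<^bsub>F Mod Rel\<^esub> X) = \<ominus>\<^bsub>B\<^esub> h X"
        using hc[OF XE] hc[OF inv(1)] AB.B.minus_equality AB.B.a_comm by metis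
      have "h X \<in> hpart B d"
        using ht[OF single_in_locR[OF X(2)] hpart_carrier[OF X(3)]]
          AB.B.hpart_smult[OF X(2) \<psi>D(4)[OF X(3)]] by (simp add: X(1))
      then show ?case unfolding eq
        using subgroup.m_inv_closed[OF AB.B.hpart_subgroup] by (simp add: a_inv_def)
    next
      case (eng X Y)
      then have "X \<in> carrier E" "Y \<in> carrier E" using hpart_E_carrier[of d] by (auto simp: E_simps)
      then show ?case using hadd[of X Y] eng AB.B.hpart_add by (simp add: E_simps)
    qed
  qed
  then have "h \<in> graded_iso \<tau> E B"
  proof (rule graded_isoI)
    show "inj_on h (carrier E)"
    proof (rule inj_onI)
      fix X Y assume XY: "X \<in> carrier E" "Y \<in> carrier E" "h X = h Y"
      obtain x y where xy: "Poly_Mapping.keys x \<subseteq> pairs" "X = cls x" "Poly_Mapping.keys y \<subseteq> pairs" "Y = cls y"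
        using XY E_carrier by metis
      have d: "Poly_Mapping.keys (x - y) \<subseteq> pairs" by (rule keys_diff_subset[OF xy(1,3)])
      obtain N a where a: "a \<in> carrier A" "cls (x - y) = tens \<sigma> \<tau> A (u N) a"
        by (rule ext_scalars_elem[OF cls_carrier[OF d]])
      have "H x = H y" using XY(3) xy by (simp add: hcls)
      then have "\<zero>\<^bsub>B\<^esub> = h (cls (x - y))" using hr(1)[OF xy(1,3)] by (simp add: hcls[OF d])
      also have "\<dots> = tpow B (- inv_deg \<sigma> \<tau> N) (\<psi> a)"
        unfolding a(2) ht[OF keys_u a(1)] by (simp add: tpow_def)
      finally have "tpow B (inv_deg \<sigma> \<tau> N) \<zero>\<^bsub>B\<^esub> = \<psi> a"
        using AB.B.tpow_cancel(2)[of "inv_deg \<sigma> \<tau> N" "\<psi> a"] \<psi>D(1)[OF a(1)] by simp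
      then have "\<psi> a = \<zero>\<^bsub>B\<^esub>" by simp
      then obtain M where M: "tpow A (inv_deg \<sigma> \<tau> M) a = \<zero>\<^bsub>A\<^esub>"
        using loc a(1) unfolding localizes_def by blast
      have "cls (x - y) = \<zero>\<^bsub>E\<^esub>" unfolding a(2) tens_shift[OF a(1), of N M] M by (rule tens_zero[OF keys_u])
      then show "X = Y" using xy by (simp add: cls_zero cls_eq_iff)
    qed
    have surj: "\<exists>N a. a \<in> carrier A \<and> tpow B (inv_deg \<sigma> \<tau> N) y = \<psi> a \<and> h (tens \<sigma> \<tau> A (u N) a) = y"
      if y: "y \<in> carrier B" for y
    proof -
      obtain N a where a: "a \<in> carrier A" "tpow B (inv_deg \<sigma> \<tau> N) y = \<psi> a"
        using loc y unfolding localizes_def by blast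
      have "h (tens \<sigma> \<tau> A (u N) a) = tpow B (- inv_deg \<sigma> \<tau> N) (\<psi> a)"
        unfolding ht[OF keys_u a(1)] by (simp add: tpow_def)
      also have "\<dots> = y" unfolding a(2)[symmetric] using y by (simp add: AB.B.tpow_cancel)
      finally show ?thesis using a by blast
    qed
    show "carrier B \<subseteq> h ` carrier E"
    proof
      fix y assume "y \<in> carrier B"
      from surj[OF this] show "y \<in> h ` carrier E" using tens_carrier[OF keys_u] by blast
    qed
    fix d
    show "hpart B d \<subseteq> h ` hpart E d"
    proof
      fix y assume y: "y \<in> hpart B d"
      obtain N a where a: "a \<in> carrier A" "tpow B (inv_deg \<sigma> \<tau> N) y = \<psi> a"
        using surj[OF AB.B.hpart_carrier[OF y]] by metis
      define e where "e = inv_deg \<sigma> \<tau> N + d"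
      define b where "b = hcomp A e a"
      have b: "b \<in> hpart A e" unfolding b_def by (rule hcomp_decomposition(1)[OF a(1)])
      have "\<psi> b = hcomp B e (\<psi> a)" unfolding b_def using AB.hcomp_graded_hom[OF \<psi> a(1)] by simp
      also have "\<dots> = tpow B (inv_deg \<sigma> \<tau> N) y"
        unfolding a(2)[symmetric] e_def using AB.B.hcomp_hpart[OF AB.B.tpow_hpart[OF inv_deg_in_degs(1) y]] by simp
      finally have "h (tens \<sigma> \<tau> A (u N) b) = y"
        unfolding ht[OF keys_u hpart_carrier[OF b]]
        using AB.B.hpart_carrier[OF y] AB.B.tpow_cancel(1)[of "inv_deg \<sigma> \<tau> N" y] by (simp add: tpow_def)
      moreover have "tens \<sigma> \<tau> A (u N) b \<in> hpart E d"
        using tens_hpart[OF _ b, of "- inv_deg \<sigma> \<tau> N" 1] by (simp add: e_def)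
      ultimately show "y \<in> h ` hpart E d" by blast
    qed
    show "hpart E d \<subseteq> carrier E" by (rule hpart_E_carrier)
  qed (use E_closed in auto)
  then show thesis using ht that by blast
qed

end

text \<open>Relators over \<open>R\<^sub>\<tau>\<close> are relators over \<open>R\<^sub>\<tau>\<^sub>'\<close>, so all representatives of a class go to one class.\<close>

lemma ext_map_tens:
  assumes A: "graded_module \<sigma> A" and sub: "\<sigma> \<subseteq> \<tau>" "\<tau> \<subseteq> \<tau>'"
  shows "ext_map \<sigma> \<tau>' A (tens \<sigma> \<tau> A r a) = tens \<sigma> \<tau>' A r a"
proof -
  interpret E1: scalar_extension \<sigma> A \<tau>
    using A sub by (simp add: scalar_extension_def scalar_extension_axioms_def)
  interpret E2: scalar_extension \<sigma> A \<tau>'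
    using A sub by (simp add: scalar_extension_def scalar_extension_axioms_def)
  have k: "Poly_Mapping.keys (p :: 'b laurent) \<subseteq> degs \<tau>'" if "Poly_Mapping.keys p \<subseteq> degs \<tau>" for p
    using that degs_mono[OF sub(2)] by blast
  have rel: "x \<in> E2.Rel" if "x \<in> E1.Rel" for x
    using that
  proof (induction rule: E1.Rel_induct)
    case (relator x)
    then show ?case
      by (cases rule: E1.relators_cases) (use k E2.relator_left E2.relator_right E2.relator_balance in auto)
  qed (auto simp: E2.Rel_closed)
  have "E2.cls x = E2.cls (frag_of (r, a))" if "x \<in> E1.cls (frag_of (r, a))" for x
    using that rel E1.in_cls E2.cls_eq_iff by blast
  moreover have "frag_of (r, a) \<in> E1.cls (frag_of (r, a))" using E1.in_cls E1.Rel_closed(1) by simp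
  ultimately show ?thesis unfolding ext_map_def tens_def by blast
qed

text \<open>Three graded isomorphisms that commute with the structure maps suffice, as the inverses then commute
  as well.\<close>

lemma LK2_isomorphicI:
  assumes f1: "f1 \<in> graded_iso {1} (mod1 M) (mod1 N)" and f2: "f2 \<in> graded_iso {2} (mod2 M) (mod2 N)"
    and f12: "f12 \<in> graded_iso {1, 2} (mod12 M) (mod12 N)"
    and map: "\<And>x. x \<in> carrier (mod1 M) \<Longrightarrow> map1 M x \<in> carrier (mod12 M)"
      "\<And>x. x \<in> carrier (mod2 M) \<Longrightarrow> map2 M x \<in> carrier (mod12 M)"
    and c1: "\<And>x. x \<in> carrier (mod1 M) \<Longrightarrow> f12 (map1 M x) = map1 N (f1 x)"
    and c2: "\<And>x. x \<in> carrier (mod2 M) \<Longrightarrow> f12 (map2 M x) = map2 N (f2 x)"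
  shows "LK2_isomorphic M N"
proof -
  obtain g1 where g1: "g1 \<in> graded_hom {1} (mod1 N) (mod1 M)"
    "\<And>x. x \<in> carrier (mod1 M) \<Longrightarrow> g1 (f1 x) = x" "\<And>y. y \<in> carrier (mod1 N) \<Longrightarrow> f1 (g1 y) = y"
    by (rule graded_isoE[OF f1]) blast
  obtain g2 where g2: "g2 \<in> graded_hom {2} (mod2 N) (mod2 M)"
    "\<And>x. x \<in> carrier (mod2 M) \<Longrightarrow> g2 (f2 x) = x" "\<And>y. y \<in> carrier (mod2 N) \<Longrightarrow> f2 (g2 y) = y"
    by (rule graded_isoE[OF f2]) blast
  obtain g12 where g12: "g12 \<in> graded_hom {1, 2} (mod12 N) (mod12 M)"
    "\<And>x. x \<in> carrier (mod12 M) \<Longrightarrow> g12 (f12 x) = x" "\<And>y. y \<in> carrier (mod12 N) \<Longrightarrow> f12 (g12 y) = y"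
    by (rule graded_isoE[OF f12]) blast
  have "(f1, f2, f12) \<in> LK2_hom M N"
    using f1 f2 f12 c1 c2 by (simp add: LK2_hom_def graded_iso_def)
  moreover have "g12 (map1 N y) = map1 M (g1 y)" if y: "y \<in> carrier (mod1 N)" for y
    using c1[OF graded_homD(1)[OF g1(1) y]] g1(3)[OF y] g12(2)[OF map(1)[OF graded_homD(1)[OF g1(1) y]]]
    by simp
  moreover have "g12 (map2 N y) = map2 M (g2 y)" if y: "y \<in> carrier (mod2 N)" for y
    using c2[OF graded_homD(1)[OF g2(1) y]] g2(3)[OF y] g12(2)[OF map(2)[OF graded_homD(1)[OF g2(1) y]]]
    by simp
  ultimately show ?thesis
    using g1 g2 g12 unfolding LK2_isomorphic_def LK2_hom_def by blast
qed

section \<open>Finite-dimensional homogeneous parts\<close>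

definition k_subspace :: "('k::field laurent, 'm) gmodule \<Rightarrow> 'm set \<Rightarrow> bool" where
  "k_subspace A W \<longleftrightarrow> W \<subseteq> carrier A \<and> \<zero>\<^bsub>A\<^esub> \<in> W \<and> (\<forall>x\<in>W. \<forall>y\<in>W. x \<oplus>\<^bsub>A\<^esub> y \<in> W) \<and>
     (\<forall>c. \<forall>x\<in>W. kmul A c x \<in> W)"

definition kspace :: "('k::field laurent, 'm) gmodule \<Rightarrow> 'm set \<Rightarrow> ('k, 'm) module" where
  "kspace A W = \<lparr>carrier = W, mult = undefined, one = undefined, zero = \<zero>\<^bsub>A\<^esub>, add = (\<oplus>\<^bsub>A\<^esub>),
      smult = (\<lambda>c x. Poly_Mapping.single 0 c \<odot>\<^bsub>A\<^esub> x)\<rparr>"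

lemma kspace_simps [simp]:
  "carrier (kspace A W) = W" "zero (kspace A W) = \<zero>\<^bsub>A\<^esub>" "add (kspace A W) = add A"
  "smult (kspace A W) = kmul A"
  by (simp_all add: kspace_def kmul_def fun_eq_iff)

lemma dim_k_kspace: "dim_k A W = vectorspace.dim class_ring (kspace A W)"
  by (simp add: dim_k_def kspace_def)

context graded_module
begin

lemma k_subspace_hpart: "k_subspace A (hpart A d)"
  unfolding k_subspace_def using hpart_carrier hpart_add kmul_hpart hpart_zero by blast

lemma k_subspace_inter: "k_subspace A W \<Longrightarrow> k_subspace A W' \<Longrightarrow> k_subspace A (W \<inter> W')"
  by (auto simp: k_subspace_def)

lemma kmul_kmul: "x \<in> carrier A \<Longrightarrow> kmul A b (kmul A c x) = kmul A (b * c) x"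
  unfolding kmul_def by (subst smult_assoc1[symmetric]) (auto simp: mult_single)

lemma kmul_one: "x \<in> carrier A \<Longrightarrow> kmul A 1 x = x"
  unfolding kmul_def using smult_one[of x] by simp

lemma kmul_l_distr: "x \<in> carrier A \<Longrightarrow> kmul A (b + c) x = kmul A b x \<oplus>\<^bsub>A\<^esub> kmul A c x"
  unfolding kmul_def using smult_l_distr[of "Poly_Mapping.single 0 b" "Poly_Mapping.single 0 c" x]
  by (simp add: single_add)

lemma kmul_0: "x \<in> carrier A \<Longrightarrow> kmul A 0 x = \<zero>\<^bsub>A\<^esub>"
  unfolding kmul_def using smult_l_null[of x] by simp

lemma vectorspace_kspace:
  assumes "k_subspace A W"
  shows "vectorspace class_ring (kspace A W)"
proof (rule vs_criteria)
  have W: "x \<in> carrier A" if "x \<in> W" for x using assms that by (auto simp: k_subspace_def)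
  show "field (class_ring :: 'k ring)" by (rule class_field.field_axioms)
  show "\<forall>v\<in>carrier (kspace A W). \<exists>neg_v\<in>carrier (kspace A W). v \<oplus>\<^bsub>kspace A W\<^esub> neg_v = \<zero>\<^bsub>kspace A W\<^esub>"
  proof
    fix v assume "v \<in> carrier (kspace A W)"
    then have v: "v \<in> W" by simp
    have "v \<oplus>\<^bsub>A\<^esub> kmul A (- 1) v = \<zero>\<^bsub>A\<^esub>"
      using kmul_l_distr[of v 1 "- 1"] kmul_one[of v] kmul_0[of v] W[OF v] by simp
    then show "\<exists>neg_v\<in>carrier (kspace A W). v \<oplus>\<^bsub>kspace A W\<^esub> neg_v = \<zero>\<^bsub>kspace A W\<^esub>"
      using v assms by (auto simp: k_subspace_def)
  qed
qed (use assms in \<open>auto simp: k_subspace_def kmul_kmul kmul_one kmul_l_distr kmul_add subset_iff a_ac\<close>)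

text \<open>The part \<open>A(c)\<close> is spanned by the finitely many \<open>t\<^sup>c\<^sup>-\<^sup>d x\<^sub>d\<close>, where \<open>x\<^sub>d\<close> runs through the homogeneous components of the
  generators.  The elements all of whose components lie in these spans form a submodule.\<close>

lemma fin_dim_hpart:
  assumes X: "finite X" "X \<subseteq> carrier A" "span X = carrier A"
  shows "vectorspace.fin_dim class_ring (kspace A (hpart A c))"
proof -
  define Y where "Y c = (\<Union>x\<in>X. (\<lambda>d. tpow A (c - d) (hcomp A d x)) `
      {d. hcomp A d x \<noteq> \<zero>\<^bsub>A\<^esub> \<and> c - d \<in> degs \<sigma>})" for c
  have fin: "finite (Y c)"
    unfolding Y_def using X hcomp_decomposition(2) by (intro finite_UN_I finite_imageI) auto
  have Yh: "Y c \<subseteq> hpart A c" for c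
  proof
    fix y assume "y \<in> Y c"
    then obtain x d where xd: "x \<in> X" "y = tpow A (c - d) (hcomp A d x)" "c - d \<in> degs \<sigma>"
      unfolding Y_def by blast
    have "x \<in> carrier A" using xd(1) X(2) by blast
    then show "y \<in> hpart A c"
      using tpow_hpart[OF xd(3) hcomp_decomposition(1)[of x d]] unfolding xd(2) by simp
  qed
  \<comment> \<open>The span of \<open>Y c\<close> appears here as the intersection of all subspaces that contain \<open>Y c\<close>.\<close>
  define N where "N = {y \<in> carrier A. \<forall>c W. k_subspace A W \<and> Y c \<subseteq> W \<longrightarrow> hcomp A c y \<in> W}"
  have "submodule (locR \<sigma>) N A"
  proof (rule submoduleI_tpow)
    fix e y assume e: "e \<in> degs \<sigma>" and y: "y \<in> N"
    have yc: "y \<in> carrier A" using y by (simp add: N_def)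
    have "hcomp A c (tpow A e y) \<in> W" if W: "k_subspace A W" "Y c \<subseteq> W" for c W
    proof -
      define W' where "W' = {x \<in> carrier A. tpow A e x \<in> W}"
      have "k_subspace A W'"
        using W(1) e by (auto simp: W'_def k_subspace_def tpow_add tpow_kmul)
      moreover have "Y (c - e) \<subseteq> W'"
      proof
        fix z assume "z \<in> Y (c - e)"
        then obtain x d where xd: "x \<in> X" "z = tpow A (c - e - d) (hcomp A d x)"
          "hcomp A d x \<noteq> \<zero>\<^bsub>A\<^esub>" "c - e - d \<in> degs \<sigma>" unfolding Y_def by blast
        have xc: "x \<in> carrier A" using xd(1) X(2) by blast
        have "e + (c - e - d) = c - d" by simp
        then have "tpow A e z = tpow A (c - d) (hcomp A d x)" "c - d \<in> degs \<sigma>"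
          using tpow_tpow[OF e xd(4) hcomp_carrier[OF xc], of d] add_in_degs[OF e xd(4)] xd(2) by simp_all
        then have "tpow A e z \<in> Y c" using xd unfolding Y_def by blast
        then show "z \<in> W'" using W(2) xd xc by (auto simp: W'_def)
      qed
      ultimately have "hcomp A (c - e) y \<in> W'" using y by (auto simp: N_def)
      then show ?thesis by (simp add: W'_def hcomp_tpow[OF yc e])
    qed
    then show "tpow A e y \<in> N" using e yc by (simp add: N_def)
  qed (auto simp: N_def hcomp_add hcomp_kmul k_subspace_def)
  moreover have "X \<subseteq> N"
  proof
    fix x assume x: "x \<in> X"
    have xc: "x \<in> carrier A" using x X(2) by blast
    have "hcomp A c x \<in> W" if W: "k_subspace A W" "Y c \<subseteq> W" for c W
    proof (cases "hcomp A c x = \<zero>\<^bsub>A\<^esub>")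
      case True
      then show ?thesis using W by (simp add: k_subspace_def)
    next
      case False
      then have "tpow A (c - c) (hcomp A c x) \<in> Y c"
        unfolding Y_def using x by (intro UN_I[OF x] imageI) simp
      then show ?thesis using W(2) xc by auto
    qed
    then show "x \<in> N" using xc by (simp add: N_def)
  qed
  ultimately have "span X \<subseteq> N" by (intro span_is_subset)
  then have N: "carrier A \<subseteq> N" using X(3) by simp
  interpret V: vectorspace class_ring "kspace A (hpart A c)"
    by (rule vectorspace_kspace[OF k_subspace_hpart])
  have Yc: "Y c \<subseteq> carrier (kspace A (hpart A c))" using Yh by simp
  have sm: "submodule class_ring (V.span (Y c)) (kspace A (hpart A c))"
    by (rule V.span_is_submodule[OF Yc])
  then have "k_subspace A (V.span (Y c))"
    using subset_trans[OF _ k_subspace_hpart[of c, unfolded k_subspace_def, THEN conjunct1]]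
      submodule.subset[OF sm] submodule.m_closed[OF sm] submodule.zero_closed[OF sm]
      submodule.smult_closed[OF sm] by (simp add: k_subspace_def)
  moreover have "Y c \<subseteq> V.span (Y c)" by (rule V.in_own_span[OF Yc])
  ultimately have "x \<in> V.span (Y c)" if "x \<in> hpart A c" for x
    using N that hcomp_hpart[OF that, of c] hpart_carrier[OF that] unfolding N_def by force
  then have "V.span (Y c) = carrier (kspace A (hpart A c))"
    using V.span_is_subset2[OF Yc] by auto
  then show ?thesis using fin Yc by (auto simp: V.fin_dim_def)
qed

text \<open>If the generators have degrees at most \<open>(n, n)\<close>, then every element of degree \<open>d\<close> is a monomial times an element of
  degree \<open>min d (n, n)\<close>: the elements whose components have this property form a submodule, since
  \<open>min\<close> is monotone, and it contains the generators.\<close>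

lemma hpart_generated_below:
  assumes \<sigma>: "\<sigma> = {}" and X: "finite X" "X \<subseteq> carrier A" "span X = carrier A"
  obtains n :: nat where "\<And>d. hpart A d \<subseteq>
    tpow A (d - (min (fst d) (int n), min (snd d) (int n))) ` hpart A (min (fst d) (int n), min (snd d) (int n))"
proof -
  define D where "D = (\<Union>x\<in>X. {d. hcomp A d x \<noteq> \<zero>\<^bsub>A\<^esub>})"
  have "finite D" unfolding D_def using X hcomp_decomposition(2) by (intro finite_UN_I) auto
  then obtain n :: nat where n: "\<And>d. d \<in> D \<Longrightarrow> fst d \<le> int n \<and> snd d \<le> int n"
  proof -
    assume fin: "finite D" and that: "\<And>n. (\<And>d. d \<in> D \<Longrightarrow> fst d \<le> int n \<and> snd d \<le> int n) \<Longrightarrow> thesis"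
    define b where "b = Max (insert 0 ((\<lambda>d. nat (fst d) + nat (snd d)) ` D))"
    show thesis
    proof (rule that)
      fix d assume "d \<in> D"
      then have "nat (fst d) + nat (snd d) \<le> b" unfolding b_def using fin by (intro Max_ge) auto
      then show "fst d \<le> int b \<and> snd d \<le> int b" by linarith
    qed
  qed
  define m where "m d = (min (fst d) (int n), min (snd d) (int n))" for d :: "int \<times> int"
  have pos: "d - m d \<in> degs \<sigma>" for d using \<sigma> by (cases d) (auto simp: degs_def m_def)
  define N where "N = {y \<in> carrier A. \<forall>d. hcomp A d y \<in> tpow A (d - m d) ` hpart A (m d)}"
  have N_iff: "y \<in> N \<longleftrightarrow> y \<in> carrier A \<and> (\<forall>d. \<exists>z\<in>hpart A (m d). hcomp A d y = tpow A (d - m d) z)" for y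
    by (auto simp: N_def)
  have "submodule (locR \<sigma>) N A"
  proof (rule submoduleI_tpow)
    show "N \<subseteq> carrier A" by (auto simp: N_def)
    show "\<zero>\<^bsub>A\<^esub> \<in> N" unfolding N_iff using pos by (auto intro!: bexI[OF _ hpart_zero])
    fix x assume x: "x \<in> N"
    show "kmul A c x \<in> N" for c
    proof -
      have "\<exists>z\<in>hpart A (m d). hcomp A d (kmul A c x) = tpow A (d - m d) z" for d
      proof -
        obtain z where "z \<in> hpart A (m d)" "hcomp A d x = tpow A (d - m d) z" using x N_iff by blast
        then show ?thesis using x pos[of d]
          by (intro bexI[of _ "kmul A c z"]) (auto simp: N_iff hcomp_kmul tpow_kmul kmul_hpart hpart_carrier)
      qed
      then show ?thesis using x by (simp add: N_iff)
    qed
    show "x \<oplus>\<^bsub>A\<^esub> y \<in> N" if y: "y \<in> N" for y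
    proof -
      have "\<exists>z\<in>hpart A (m d). hcomp A d (x \<oplus>\<^bsub>A\<^esub> y) = tpow A (d - m d) z" for d
      proof -
        obtain z where "z \<in> hpart A (m d)" "hcomp A d x = tpow A (d - m d) z" using x N_iff by blast
        moreover obtain w where "w \<in> hpart A (m d)" "hcomp A d y = tpow A (d - m d) w" using y N_iff by blast
        ultimately show ?thesis using x y pos[of d]
          by (intro bexI[of _ "z \<oplus>\<^bsub>A\<^esub> w"]) (auto simp: N_iff hcomp_add tpow_add hpart_add hpart_carrier)
      qed
      then show ?thesis using x y by (simp add: N_iff)
    qed
    show "tpow A e x \<in> N" if e: "e \<in> degs \<sigma>" for e
    proof -
      have "\<exists>z\<in>hpart A (m d). hcomp A d (tpow A e x) = tpow A (d - m d) z" for d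
      proof -
        obtain z where z: "z \<in> hpart A (m (d - e))" "hcomp A (d - e) x = tpow A (d - e - m (d - e)) z"
          using x N_iff by blast
        have q: "m d - m (d - e) \<in> degs \<sigma>" using \<sigma> e by (cases d; cases e) (auto simp: degs_def m_def)
        have "tpow A (m d - m (d - e)) z \<in> hpart A (m d)" using tpow_hpart[OF q z(1)] by simp
        moreover have "e + (d - e - m (d - e)) = (d - m d) + (m d - m (d - e))" by simp
        then have "hcomp A d (tpow A e x) = tpow A (d - m d) (tpow A (m d - m (d - e)) z)"
          using x z e q pos[of "d - e"] pos[of d] hpart_carrier[OF z(1)]
          by (simp only: N_iff hcomp_tpow tpow_tpow)
        ultimately show ?thesis by blast
      qed
      then show ?thesis using x e by (simp add: N_iff)
    qed
  qed
  moreover have "X \<subseteq> N"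
  proof
    fix x assume x: "x \<in> X"
    have xc: "x \<in> carrier A" using x X(2) by blast
    have "\<exists>z\<in>hpart A (m d). hcomp A d x = tpow A (d - m d) z" for d
    proof (cases "hcomp A d x = \<zero>\<^bsub>A\<^esub>")
      case True
      then show ?thesis using pos by (intro bexI[OF _ hpart_zero]) simp
    next
      case False
      then have "d \<in> D" unfolding D_def using x by blast
      then have "m d = d" using n[of d] by (cases d) (auto simp: m_def)
      then show ?thesis using hcomp_decomposition(1)[OF xc, of d] xc by (intro bexI[of _ "hcomp A d x"]) simp_all
    qed
    then show "x \<in> N" using xc by (simp add: N_iff)
  qed
  ultimately have "span X \<subseteq> N" by (intro span_is_subset)
  then have N: "carrier A \<subseteq> N" using X(3) by simp
  have "hpart A d \<subseteq> tpow A (d - m d) ` hpart A (m d)" for d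
  proof
    fix x assume x: "x \<in> hpart A d"
    then have "x \<in> N" using N hpart_carrier by blast
    then have "hcomp A d x \<in> tpow A (d - m d) ` hpart A (m d)" unfolding N_def by blast
    then show "x \<in> tpow A (d - m d) ` hpart A (m d)" using hcomp_hpart[OF x, of d] by simp
  qed
  then show thesis using that unfolding m_def by blast
qed

end

lemma fg_graded_moduleE:
  assumes "fg_graded_module \<sigma> A"
  obtains X where "graded_module \<sigma> A" "finite X" "X \<subseteq> carrier A" "LinearCombinations.module.span (locR \<sigma>) A X = carrier A"
  using assms unfolding fg_graded_module_def by blast

text \<open>Coordinates on one homogeneous part; the bound \<open>n\<close> keeps all images in a fixed finite-dimensional space.\<close>

locale coordinates = graded_module \<sigma> A
  for \<sigma> :: "nat set" and A :: "('k::field laurent, 'm) gmodule" (structure) +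
  fixes d :: "int \<times> int" and \<phi> :: "'m \<Rightarrow> nat \<Rightarrow> 'k" and n :: nat
  assumes lin: "linear_coordinates (kspace A (hpart A d)) \<phi>"
    and bound: "\<And>v i. v \<in> hpart A d \<Longrightarrow> n \<le> i \<Longrightarrow> \<phi> v i = 0"
begin

lemma co_add: "\<lbrakk>v \<in> hpart A d; w \<in> hpart A d\<rbrakk> \<Longrightarrow> \<phi> (v \<oplus>\<^bsub>A\<^esub> w) = \<phi> v + \<phi> w"
  using linear_coordinates.add[OF lin] by simp

lemma co_kmul: "v \<in> hpart A d \<Longrightarrow> \<phi> (kmul A c v) = kscale c (\<phi> v)"
  using linear_coordinates.scale[OF lin] by simp

lemma co_inj: "inj_on \<phi> (hpart A d)"
  using linear_coordinates.inj[OF lin] by simp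

lemma co_zero: "\<phi> \<zero>\<^bsub>A\<^esub> = 0"
  using linear_coordinates.zero[OF lin] by simp

lemma co_span: "W \<subseteq> hpart A d \<Longrightarrow> \<phi> ` W \<subseteq> kv.span (unit_vec ` {..<n})"
  using finite_coordinates_span[of n] bound by blast

lemma co_subspace: "k_subspace A W \<Longrightarrow> W \<subseteq> hpart A d \<Longrightarrow> kv.subspace (\<phi> ` W)"
proof (rule kv.subspaceI)
  assume W: "k_subspace A W" "W \<subseteq> hpart A d"
  show "0 \<in> \<phi> ` W" using W(1) co_zero by (metis image_eqI k_subspace_def)
  fix x assume "x \<in> \<phi> ` W"
  then obtain v where v: "v \<in> W" "x = \<phi> v" by blast
  show "kscale c x \<in> \<phi> ` W" for c
    using co_kmul[of v c] v W by (metis image_eqI k_subspace_def subsetD)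
  fix y assume "y \<in> \<phi> ` W"
  then obtain w where w: "w \<in> W" "y = \<phi> w" by blast
  have "v \<oplus>\<^bsub>A\<^esub> w \<in> W" using W(1) v w by (simp add: k_subspace_def)
  moreover have "\<phi> (v \<oplus>\<^bsub>A\<^esub> w) = x + y" using co_add[of v w] v w W(2) by blast
  ultimately show "x + y \<in> \<phi> ` W" by (metis image_eqI)
qed

lemma co_eq_iff: "W \<subseteq> hpart A d \<Longrightarrow> W' \<subseteq> hpart A d \<Longrightarrow> \<phi> ` W \<subseteq> \<phi> ` W' \<longleftrightarrow> W \<subseteq> W'"
proof
  assume W: "W \<subseteq> hpart A d" "W' \<subseteq> hpart A d" and "\<phi> ` W \<subseteq> \<phi> ` W'"
  then show "W \<subseteq> W'" using inj_on_image_mem_iff[OF co_inj] by blast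
qed blast

text \<open>An increasing chain of subspaces of a finite-dimensional homogeneous part becomes stationary.\<close>

lemma chain_stabilises:
  assumes "\<And>N::nat. k_subspace A (W N)" "\<And>N. W N \<subseteq> hpart A d" "mono W"
  shows "\<exists>N0. \<forall>N. W N \<subseteq> W N0"
proof -
  have "\<exists>N0. \<forall>N. \<phi> ` W N \<subseteq> \<phi> ` W N0"
  proof (rule kv.subspace_chain_stabilises[of "\<lambda>N. \<phi> ` W N"])
    show "kv.subspace (\<phi> ` W N)" for N using assms by (intro co_subspace)
    show "mono (\<lambda>N. \<phi> ` W N)" using assms(3) by (auto simp: mono_def)
    show "\<phi> ` W N \<subseteq> kv.span (unit_vec ` {..<n})" for N using assms(2) by (rule co_span)
  qed simp
  then show ?thesis by (simp add: co_eq_iff[OF assms(2) assms(2)])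
qed

end

lemma coordinates_exist:
  assumes "fg_graded_module \<sigma> A"
  obtains \<phi> n where "coordinates \<sigma> A d \<phi> n"
proof -
  obtain X where X: "graded_module \<sigma> A" "finite X" "X \<subseteq> carrier A" "LinearCombinations.module.span (locR \<sigma>) A X = carrier A"
    using assms by (rule fg_graded_moduleE)
  interpret graded_module \<sigma> A by (rule X(1))
  obtain \<phi> n where "linear_coordinates (kspace A (hpart A d)) \<phi>"
    "\<And>v i. v \<in> carrier (kspace A (hpart A d)) \<Longrightarrow> n \<le> i \<Longrightarrow> \<phi> v i = 0"
    using linear_coordinates_exist[OF vectorspace_kspace[OF k_subspace_hpart] fin_dim_hpart[OF X(2-4)]]
    by metis
  then have "coordinates \<sigma> A d \<phi> n"
    using X(1) by (simp add: coordinates_def coordinates_axioms_def)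
  then show thesis by (rule that)
qed

section \<open>Graded submodules of a module over the Laurent polynomials\<close>

text \<open>Over \<open>k[t\<^sub>1\<^sup>\<plusminus>\<^sup>1, t\<^sub>2\<^sup>\<plusminus>\<^sup>1]\<close> all homogeneous parts of \<open>C\<close> are identified with \<open>C(0)\<close> by monomials; this is the
  image of \<open>A(d)\<close> under \<open>\<psi>\<close>, seen inside \<open>C(0)\<close>.\<close>

definition deg0_image :: "('k::field laurent, 'm) gmodule \<Rightarrow> ('k laurent, 'n) gmodule \<Rightarrow> ('m \<Rightarrow> 'n) \<Rightarrow>
    int \<times> int \<Rightarrow> 'n set" where
  "deg0_image A C \<psi> d = (\<lambda>x. tpow C (- d) (\<psi> x)) ` hpart A d"

locale laurent_map = graded_module_pair \<sigma> A "{1, 2}" C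
  for \<sigma> :: "nat set" and A :: "('k::field laurent, 'm) gmodule" and C :: "('k laurent, 'n) gmodule" +
  fixes \<psi> :: "'m \<Rightarrow> 'n"
  assumes hom: "\<psi> \<in> graded_hom \<sigma> A C"
begin

lemmas homD = graded_homD[OF hom] graded_hom_tpow_kmul[OF hom]

lemma shift_hpart: "x \<in> hpart A d \<Longrightarrow> tpow C (- d) (\<psi> x) \<in> hpart C 0"
  using B.tpow_hpart[of "- d" "\<psi> x" d] homD(4) by simp

lemma shift_add: "\<lbrakk>x \<in> hpart A d; y \<in> hpart A d\<rbrakk> \<Longrightarrow>
    tpow C (- d) (\<psi> (x \<oplus>\<^bsub>A\<^esub> y)) = tpow C (- d) (\<psi> x) \<oplus>\<^bsub>C\<^esub> tpow C (- d) (\<psi> y)"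
  using homD(1,2) A.hpart_carrier by (simp add: B.tpow_add)

lemma shift_kmul: "x \<in> hpart A d \<Longrightarrow> tpow C (- d) (\<psi> (kmul A c x)) = kmul C c (tpow C (- d) (\<psi> x))"
  using homD(1,6) A.hpart_carrier by (simp add: B.tpow_kmul)

lemma shift_tpow: "\<lbrakk>x \<in> hpart A d; e \<in> degs \<sigma>\<rbrakk> \<Longrightarrow>
    tpow C (- (e + d)) (\<psi> (tpow A e x)) = tpow C (- d) (\<psi> x)"
  using homD(1,5) A.hpart_carrier by (simp add: B.tpow_tpow)

lemma deg0_image_subset: "deg0_image A C \<psi> d \<subseteq> hpart C 0"
  unfolding deg0_image_def using shift_hpart by blast

lemma k_subspace_deg0_image: "k_subspace C (deg0_image A C \<psi> d)"
  unfolding k_subspace_def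
proof (intro conjI ballI allI)
  show "deg0_image A C \<psi> d \<subseteq> carrier C" using deg0_image_subset B.hpart_carrier by blast
  show "\<zero>\<^bsub>C\<^esub> \<in> deg0_image A C \<psi> d"
    unfolding deg0_image_def using graded_hom_zero[OF hom] by (intro image_eqI[of _ _ "\<zero>\<^bsub>A\<^esub>"]) auto
  fix x assume "x \<in> deg0_image A C \<psi> d"
  then obtain v where v: "v \<in> hpart A d" "x = tpow C (- d) (\<psi> v)" by (auto simp: deg0_image_def)
  show "kmul C c x \<in> deg0_image A C \<psi> d" for c
    unfolding deg0_image_def using v A.kmul_hpart[OF v(1)] shift_kmul[OF v(1)] by (metis image_eqI)
  fix y assume "y \<in> deg0_image A C \<psi> d"
  then obtain w where w: "w \<in> hpart A d" "y = tpow C (- d) (\<psi> w)" by (auto simp: deg0_image_def)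
  show "x \<oplus>\<^bsub>C\<^esub> y \<in> deg0_image A C \<psi> d"
    unfolding deg0_image_def using v w A.hpart_add[OF v(1) w(1)] shift_add[OF v(1) w(1)] by (metis image_eqI)
qed

lemma deg0_image_mono: "e \<in> degs \<sigma> \<Longrightarrow> deg0_image A C \<psi> d \<subseteq> deg0_image A C \<psi> (e + d)"
proof
  fix v assume e: "e \<in> degs \<sigma>" and "v \<in> deg0_image A C \<psi> d"
  then obtain x where x: "x \<in> hpart A d" "v = tpow C (- d) (\<psi> x)" by (auto simp: deg0_image_def)
  then show "v \<in> deg0_image A C \<psi> (e + d)"
    unfolding deg0_image_def using A.tpow_hpart[OF e x(1)] shift_tpow[OF x(1) e] by (metis image_eqI)
qed

text \<open>Along an invertible variable of \<open>A\<close> the image does not change, so it depends on the other coordinate of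
  the degree only.\<close>

lemma deg0_image_shift:
  assumes "e \<in> degs \<sigma>" "- e \<in> degs \<sigma>"
  shows "deg0_image A C \<psi> (e + d) = deg0_image A C \<psi> d"
  using deg0_image_mono[OF assms(1), of d] deg0_image_mono[OF assms(2), of "e + d"] by (simp add: add.assoc[symmetric])

lemma in_deg0_image: "v \<in> hpart C 0 \<Longrightarrow> v \<in> deg0_image A C \<psi> d \<longleftrightarrow> tpow C d v \<in> \<psi> ` hpart A d"
proof
  assume v: "v \<in> hpart C 0"
  note vc = B.hpart_carrier[OF v]
  {
    assume "v \<in> deg0_image A C \<psi> d"
    then obtain x where x: "x \<in> hpart A d" "v = tpow C (- d) (\<psi> x)" by (auto simp: deg0_image_def)
    then have "tpow C d v = \<psi> x" using homD(1)[OF A.hpart_carrier[OF x(1)]] by (simp add: B.tpow_cancel)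
    then show "tpow C d v \<in> \<psi> ` hpart A d" using x by blast
  }
  assume "tpow C d v \<in> \<psi> ` hpart A d"
  then obtain x where x: "x \<in> hpart A d" "tpow C d v = \<psi> x" by blast
  have "v = tpow C (- d) (\<psi> x)" unfolding x(2)[symmetric] using vc by (simp add: B.tpow_cancel)
  then show "v \<in> deg0_image A C \<psi> d" using x(1) by (auto simp: deg0_image_def)
qed

end

subsection \<open>Maps determined by their homogeneous parts\<close>

lemma laurent_mapI:
  assumes "graded_module \<sigma> A" "graded_module {1, 2} C" "\<sigma> \<subseteq> {1, 2}" "\<psi> \<in> graded_hom \<sigma> A C"
  shows "laurent_map \<sigma> A C \<psi>"
  using assms by (simp add: laurent_map_def laurent_map_axioms_def graded_module_pair_def graded_module_pair_axioms_def)

text \<open>A graded homomorphism into \<open>B\<close> is the same as a compatible family of linear maps \<open>\<kappa> d\<close> from \<open>A(d)\<close> into \<open>C(0)\<close> with values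
  in the image of \<open>B(d)\<close>, provided that \<open>B\<close> embeds into \<open>C\<close>.\<close>

lemma factor_through_deg0:
  fixes A :: "('k::field laurent, 'm) gmodule" and B :: "('k laurent, 'n) gmodule"
    and C :: "('k laurent, 'p) gmodule"
  assumes A: "graded_module \<sigma> A" and B: "laurent_map \<tau> B C m" and inj: "inj_on m (carrier B)"
    and sub: "\<sigma> \<subseteq> \<tau>"
    and deg0_image: "\<And>d x. x \<in> hpart A d \<Longrightarrow> \<kappa> d x \<in> deg0_image B C m d"
    and add: "\<And>d x y. \<lbrakk>x \<in> hpart A d; y \<in> hpart A d\<rbrakk> \<Longrightarrow> \<kappa> d (x \<oplus>\<^bsub>A\<^esub> y) = \<kappa> d x \<oplus>\<^bsub>C\<^esub> \<kappa> d y"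
    and kmul: "\<And>d x c. x \<in> hpart A d \<Longrightarrow> \<kappa> d (kmul A c x) = kmul C c (\<kappa> d x)"
    and tpow: "\<And>d x e. \<lbrakk>e \<in> degs \<sigma>; x \<in> hpart A d\<rbrakk> \<Longrightarrow> \<kappa> (e + d) (tpow A e x) = \<kappa> d x"
  obtains f where "f \<in> graded_hom \<sigma> A B" "\<And>d x. x \<in> hpart A d \<Longrightarrow> m (f x) = tpow C d (\<kappa> d x)"
proof -
  interpret m: laurent_map \<tau> B C m by (rule B)
  interpret AB: graded_module_pair \<sigma> A \<tau> B
    using A m.A.graded_module_axioms sub by (simp add: graded_module_pair_def graded_module_pair_axioms_def)
  define \<theta> where "\<theta> d x = inv_into (hpart B d) m (tpow C d (\<kappa> d x))" for d x
  have \<kappa>0: "\<kappa> d x \<in> hpart C 0" if "x \<in> hpart A d" for d x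
    using deg0_image[OF that] m.deg0_image_subset by blast
  note \<kappa>c = m.B.hpart_carrier[OF \<kappa>0]
  have \<theta>: "\<theta> d x \<in> hpart B d" "m (\<theta> d x) = tpow C d (\<kappa> d x)" if "x \<in> hpart A d" for d x
  proof -
    have "tpow C d (\<kappa> d x) \<in> m ` hpart B d" using m.in_deg0_image[OF \<kappa>0[OF that]] deg0_image[OF that] by blast
    then show "\<theta> d x \<in> hpart B d" "m (\<theta> d x) = tpow C d (\<kappa> d x)"
      unfolding \<theta>_def by (rule inv_into_into, rule f_inv_into_f)
  qed
  note \<theta>c = m.A.hpart_carrier[OF \<theta>(1)]
  have eqI: "y = z" if "y \<in> carrier B" "z \<in> carrier B" "m y = m z" for y z
    using inj that by (auto dest: inj_onD)
  obtain f where f: "f \<in> graded_hom \<sigma> A B" "\<And>d x. x \<in> hpart A d \<Longrightarrow> f x = \<theta> d x"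
  proof (rule AB.graded_hom_extension)
    show "\<theta> d x \<in> hpart B d" if "x \<in> hpart A d" for d x using \<theta>(1)[OF that] .
    show "\<theta> d (x \<oplus>\<^bsub>A\<^esub> y) = \<theta> d x \<oplus>\<^bsub>B\<^esub> \<theta> d y" if "x \<in> hpart A d" "y \<in> hpart A d" for d x y
    proof (rule eqI)
      show "m (\<theta> d (x \<oplus>\<^bsub>A\<^esub> y)) = m (\<theta> d x \<oplus>\<^bsub>B\<^esub> \<theta> d y)"
        using that AB.A.hpart_add[OF that] \<theta>c
        by (simp add: m.homD(2) \<theta> add m.B.tpow_add \<kappa>c)
    qed (use that AB.A.hpart_add[OF that] \<theta>c in auto)
    show "\<theta> (e + d) (tpow A e x) = tpow B e (\<theta> d x)" if e: "e \<in> degs \<sigma>" and x: "x \<in> hpart A d" for d e x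
    proof (rule eqI)
      show "m (\<theta> (e + d) (tpow A e x)) = m (tpow B e (\<theta> d x))"
        using m.homD(5)[OF AB.degs_sub[OF e] \<theta>c[OF x]]
        by (simp add: \<theta>(2)[OF AB.A.tpow_hpart[OF e x]] \<theta>(2)[OF x] tpow[OF e x] m.B.tpow_tpow \<kappa>c[OF x])
    qed (use AB.degs_sub[OF e] \<theta>c[OF AB.A.tpow_hpart[OF e x]] \<theta>c[OF x] in auto)
    show "\<theta> d (kmul A c x) = kmul B c (\<theta> d x)" if x: "x \<in> hpart A d" for d c x
    proof (rule eqI)
      show "m (\<theta> d (kmul A c x)) = m (kmul B c (\<theta> d x))"
        using m.homD(6)[OF \<theta>c[OF x]]
        by (simp add: \<theta>(2)[OF AB.A.kmul_hpart[OF x]] \<theta>(2)[OF x] kmul[OF x] m.B.tpow_kmul \<kappa>c[OF x])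
    qed (use \<theta>c[OF AB.A.kmul_hpart[OF x]] \<theta>c[OF x] in auto)
  qed blast
  with \<theta>(2) that show thesis by metis
qed

definition k_hom :: "('k::field laurent, 'm) gmodule \<Rightarrow> ('k laurent, 'n) gmodule \<Rightarrow> ('m \<Rightarrow> 'n) \<Rightarrow> bool" where
  "k_hom C C' \<theta> \<longleftrightarrow> (\<forall>v\<in>hpart C 0. \<theta> v \<in> hpart C' 0) \<and>
     (\<forall>v\<in>hpart C 0. \<forall>w\<in>hpart C 0. \<theta> (v \<oplus>\<^bsub>C\<^esub> w) = \<theta> v \<oplus>\<^bsub>C'\<^esub> \<theta> w) \<and>
     (\<forall>c. \<forall>v\<in>hpart C 0. \<theta> (kmul C c v) = kmul C' c (\<theta> v))"

lemma graded_hom_id: "(\<lambda>x. x) \<in> graded_hom \<sigma> A A"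
  by (rule graded_homI) auto

lemma graded_hom_comp: "f \<in> graded_hom \<sigma> A B \<Longrightarrow> g \<in> graded_hom \<sigma> B C \<Longrightarrow> (\<lambda>x. g (f x)) \<in> graded_hom \<sigma> A C"
  by (rule graded_homI) (simp_all add: graded_homD)

lemma graded_hom_restrict:
  fixes A :: "('k::field laurent, 'm) gmodule"
  shows "f \<in> graded_hom \<tau> A B \<Longrightarrow> \<sigma> \<subseteq> \<tau> \<Longrightarrow> f \<in> graded_hom \<sigma> A B"
proof (rule graded_homI)
  assume f: "f \<in> graded_hom \<tau> A B" and sub: "\<sigma> \<subseteq> \<tau>"
  show "x \<in> carrier A \<Longrightarrow> f x \<in> carrier B" for x by (rule graded_homD(1)[OF f])
  show "\<lbrakk>x \<in> carrier A; y \<in> carrier A\<rbrakk> \<Longrightarrow> f (x \<oplus>\<^bsub>A\<^esub> y) = f x \<oplus>\<^bsub>B\<^esub> f y" for x y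
    by (rule graded_homD(2)[OF f])
  show "x \<in> hpart A d \<Longrightarrow> f x \<in> hpart B d" for x d by (rule graded_homD(4)[OF f])
  fix r :: "'k laurent" and x assume "Poly_Mapping.keys r \<subseteq> degs \<sigma>" "x \<in> carrier A"
  then show "f (r \<odot>\<^bsub>A\<^esub> x) = r \<odot>\<^bsub>B\<^esub> f x"
    using degs_mono[OF sub] by (intro graded_homD(3)[OF f]) blast+
qed

lemma extend_deg0_hom:
  assumes B: "laurent_map \<tau> B C m" and B': "laurent_map \<tau> B' C' m'" and inj': "inj_on m' (carrier B')"
    and \<theta>: "k_hom C C' \<theta>" and deg0_image: "\<And>d. \<theta> ` deg0_image B C m d \<subseteq> deg0_image B' C' m' d"
  obtains f where "f \<in> graded_hom \<tau> B B'"
    "\<And>d x. x \<in> hpart B d \<Longrightarrow> m' (f x) = tpow C' d (\<theta> (tpow C (- d) (m x)))"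
proof -
  interpret m: laurent_map \<tau> B C m by (rule B)
  show thesis
  proof (rule factor_through_deg0[OF m.A.graded_module_axioms B' inj' subset_refl,
        of "\<lambda>d x. \<theta> (tpow C (- d) (m x))"])
    show "\<theta> (tpow C (- d) (m x)) \<in> deg0_image B' C' m' d" if "x \<in> hpart B d" for d x
      using deg0_image that unfolding deg0_image_def by blast
    show "\<theta> (tpow C (- d) (m (x \<oplus>\<^bsub>B\<^esub> y))) = \<theta> (tpow C (- d) (m x)) \<oplus>\<^bsub>C'\<^esub> \<theta> (tpow C (- d) (m y))"
      if "x \<in> hpart B d" "y \<in> hpart B d" for d x y
      using \<theta> that by (simp add: m.shift_add m.shift_hpart k_hom_def)
    show "\<theta> (tpow C (- d) (m (kmul B c x))) = kmul C' c (\<theta> (tpow C (- d) (m x)))"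
      if "x \<in> hpart B d" for d x c
      using \<theta> that by (simp add: m.shift_kmul m.shift_hpart k_hom_def)
    show "\<theta> (tpow C (- (e + d)) (m (tpow B e x))) = \<theta> (tpow C (- d) (m x))"
      if "e \<in> degs \<tau>" "x \<in> hpart B d" for d x e
      using that by (simp only: m.shift_tpow)
  qed (use that in blast)
qed

text \<open>A linear isomorphism \<open>\<theta>\<close> of the parts of degree \<open>0\<close> that matches the images of \<open>B(d)\<close> and \<open>B'(d)\<close> for all \<open>d\<close> lifts to \<open>B\<close>: both
  \<open>\<theta>\<close> and its inverse extend, and the composites are the identity on homogeneous elements.\<close>

lemma graded_iso_of_deg0_iso:
  assumes B: "laurent_map \<tau> B C m" "inj_on m (carrier B)"
    and B': "laurent_map \<tau> B' C' m'" "inj_on m' (carrier B')"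
    and \<theta>: "k_hom C C' \<theta>" "\<And>d. \<theta> ` deg0_image B C m d \<subseteq> deg0_image B' C' m' d"
    and \<eta>: "k_hom C' C \<eta>" "\<And>d. \<eta> ` deg0_image B' C' m' d \<subseteq> deg0_image B C m d"
    and inv: "\<And>v. v \<in> hpart C 0 \<Longrightarrow> \<eta> (\<theta> v) = v" "\<And>w. w \<in> hpart C' 0 \<Longrightarrow> \<theta> (\<eta> w) = w"
  obtains f where "f \<in> graded_iso \<tau> B B'"
    "\<And>d x. x \<in> hpart B d \<Longrightarrow> m' (f x) = tpow C' d (\<theta> (tpow C (- d) (m x)))"
proof -
  obtain f where f: "f \<in> graded_hom \<tau> B B'"
    "\<And>d x. x \<in> hpart B d \<Longrightarrow> m' (f x) = tpow C' d (\<theta> (tpow C (- d) (m x)))"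
    using extend_deg0_hom[OF B(1) B' \<theta>] by metis
  obtain g where g: "g \<in> graded_hom \<tau> B' B"
    "\<And>d x. x \<in> hpart B' d \<Longrightarrow> m (g x) = tpow C d (\<eta> (tpow C' (- d) (m' x)))"
    using extend_deg0_hom[OF B'(1) B \<eta>] by metis
  have cancel: "g (f x) = x"
    if B: "laurent_map \<tau> B C m" "inj_on m (carrier B)" and C': "graded_module {1, 2} C'"
      and f: "f \<in> graded_hom \<tau> B B'"
      "\<And>d x. x \<in> hpart B d \<Longrightarrow> m' (f x) = tpow C' d (\<theta> (tpow C (- d) (m x)))"
      and g: "g \<in> graded_hom \<tau> B' B"
      "\<And>d x. x \<in> hpart B' d \<Longrightarrow> m (g x) = tpow C d (\<eta> (tpow C' (- d) (m' x)))"
      and \<theta>: "k_hom C C' \<theta>" and inv: "\<And>v. v \<in> hpart C 0 \<Longrightarrow> \<eta> (\<theta> v) = v" and x: "x \<in> carrier B"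
    for B :: "('k::field laurent, 'x) gmodule" and C :: "('k laurent, 'y) gmodule"
      and B' :: "('k laurent, 'z) gmodule" and C' :: "('k laurent, 'w) gmodule"
      and m m' f g \<theta> \<eta> x
  proof -
    interpret m: laurent_map \<tau> B C m by (rule B)
    interpret C': graded_module "{1, 2}" C' by (rule C')
    interpret BB: graded_module_pair \<tau> B \<tau> B
      by (simp add: graded_module_pair_def graded_module_pair_axioms_def m.A.graded_module_axioms)
    have hom: "g (f x) = x" if x: "x \<in> hpart B d" for d x
    proof (rule inj_onD[OF B(2)])
      have v: "tpow C (- d) (m x) \<in> hpart C 0" by (rule m.shift_hpart[OF x])
      then have w: "\<theta> (tpow C (- d) (m x)) \<in> carrier C'" using \<theta> C'.hpart_carrier unfolding k_hom_def by blast
      have "m (g (f x)) = tpow C d (\<eta> (\<theta> (tpow C (- d) (m x))))"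
        using g(2)[OF graded_homD(4)[OF f(1) x]] f(2)[OF x] w by (simp add: C'.tpow_cancel)
      also have "\<dots> = m x"
        using inv[OF v] m.homD(1)[OF m.A.hpart_carrier[OF x]] by (simp add: m.B.tpow_cancel)
      finally show "m (g (f x)) = m x" .
      show "g (f x) \<in> carrier B" "x \<in> carrier B"
        using m.A.hpart_carrier[OF x] graded_homD(1)[OF f(1)] graded_homD(1)[OF g(1)] by auto
    qed
    show ?thesis
      using BB.graded_hom_eq_onI[OF graded_hom_comp[OF f(1) g(1)] graded_hom_id hom x] .
  qed
  interpret m: laurent_map \<tau> B C m by (rule B)
  interpret m': laurent_map \<tau> B' C' m' by (rule B')
  have "f \<in> graded_iso \<tau> B B'"
    using f(1) g(1) cancel[OF B m'.B.graded_module_axioms f g \<theta>(1) inv(1)]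
      cancel[OF B' m.B.graded_module_axioms g f \<eta>(1) inv(2)]
    unfolding graded_iso_def by blast
  then show thesis using f(2) that by blast
qed

lemma laurent_map_id: "graded_module {1, 2} C \<Longrightarrow> laurent_map {1, 2} C C (\<lambda>x. x)"
  by (rule laurent_mapI) (auto simp: graded_hom_id)

lemma deg0_image_id: 
  assumes "graded_module {1, 2} C"
  shows "deg0_image C C (\<lambda>x. x) d = hpart C 0"
proof -
  interpret laurent_map "{1, 2}" C C "\<lambda>x. x" by (rule laurent_map_id[OF assms])
  show ?thesis
  proof
    show "hpart C 0 \<subseteq> deg0_image C C (\<lambda>x. x) d"
    proof
      fix v assume v: "v \<in> hpart C 0"
      then show "v \<in> deg0_image C C (\<lambda>x. x) d" using in_deg0_image[OF v, of d] A.tpow_hpart[OF _ v, of d] by simp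
    qed
  qed (rule deg0_image_subset)
qed

text \<open>Surjectivity up to powers of \<open>s\<close> passes from homogeneous elements to their sums by taking a common power.\<close>

lemma localizesI_homogeneous:
  assumes AB: "graded_module_pair \<sigma> A \<tau> B" and \<psi>: "\<psi> \<in> graded_hom \<sigma> A B"
    and inj: "\<And>d x. x \<in> hpart A d \<Longrightarrow> \<psi> x = \<zero>\<^bsub>B\<^esub> \<Longrightarrow> x = \<zero>\<^bsub>A\<^esub>"
    and surj: "\<And>d y. y \<in> hpart B d \<Longrightarrow> \<exists>N. \<exists>x\<in>carrier A. tpow B (inv_deg \<sigma> \<tau> N) y = \<psi> x"
  shows "localizes \<sigma> \<tau> A B \<psi>"
proof -
  interpret graded_module_pair \<sigma> A \<tau> B by (rule AB)
  have "x = \<zero>\<^bsub>A\<^esub>" if x: "x \<in> carrier A" "\<psi> x = \<zero>\<^bsub>B\<^esub>" for x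
  proof (rule A.hcomp_ext)
    fix d
    have "\<psi> (hcomp A d x) = \<zero>\<^bsub>B\<^esub>" using hcomp_graded_hom[OF \<psi> x(1), of d] x(2) by simp
    then have "hcomp A d x = \<zero>\<^bsub>A\<^esub>" by (rule inj[OF A.hcomp_decomposition(1)[OF x(1)]])
    then show "hcomp A d x = hcomp A d \<zero>\<^bsub>A\<^esub>" by simp
  qed (use x in auto)
  then have "\<exists>N. tpow A (inv_deg \<sigma> \<tau> N) x = \<zero>\<^bsub>A\<^esub>" if "x \<in> carrier A" "\<psi> x = \<zero>\<^bsub>B\<^esub>" for x
    using that A.tpow_zero[OF inv_deg_in_degs(1)] by blast
  moreover have "\<exists>N. \<exists>x\<in>carrier A. tpow B (inv_deg \<sigma> \<tau> N) y = \<psi> x" if "y \<in> carrier B" for y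
    using that
  proof (induction rule: B.graded_induct)
    case (hom d y)
    then show ?case by (rule surj)
  next
    case (add y z)
    then obtain N M v w where *: "v \<in> carrier A" "tpow B (inv_deg \<sigma> \<tau> N) y = \<psi> v"
      "w \<in> carrier A" "tpow B (inv_deg \<sigma> \<tau> M) z = \<psi> w" by blast
    have "tpow B (inv_deg \<sigma> \<tau> (M + N)) y = \<psi> (tpow A (inv_deg \<sigma> \<tau> M) v)"
      using *(1) add(1) by (simp add: inv_deg_add graded_hom_tpow_kmul[OF \<psi>] *(2)[symmetric] B.tpow_tpow)
    moreover have "tpow B (inv_deg \<sigma> \<tau> (M + N)) z = \<psi> (tpow A (inv_deg \<sigma> \<tau> N) w)"
      using *(3) add(2)
      by (simp add: inv_deg_add graded_hom_tpow_kmul[OF \<psi>] *(4)[symmetric] B.tpow_tpow add.commute)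
    ultimately have "tpow B (inv_deg \<sigma> \<tau> (M + N)) (y \<oplus>\<^bsub>B\<^esub> z)
        = \<psi> (tpow A (inv_deg \<sigma> \<tau> M) v \<oplus>\<^bsub>A\<^esub> tpow A (inv_deg \<sigma> \<tau> N) w)"
      using * add by (simp add: B.tpow_add graded_homD(2)[OF \<psi>])
    moreover have "tpow A (inv_deg \<sigma> \<tau> M) v \<oplus>\<^bsub>A\<^esub> tpow A (inv_deg \<sigma> \<tau> N) w \<in> carrier A"
      using * by simp
    ultimately show ?case by blast
  qed
  ultimately show ?thesis using \<psi> unfolding localizes_def by blast
qed

section \<open>The stabilized intersection rank invariant\<close>

lemma inv_deg_values:
  "inv_deg {} {1, 2} N = (int N, int N)" "inv_deg {} {1} N = (int N, 0)" "inv_deg {} {2} N = (0, int N)"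
  by (simp_all add: inv_deg_def)

lemma in_degs_empty: "d \<in> degs {} \<longleftrightarrow> 0 \<le> fst d \<and> 0 \<le> snd d"
  by (cases d) (simp add: degs_def)

text \<open>Let \<open>c = (n0, n0)\<close> bound the degrees of the generators.  The elements of \<open>A(c)\<close> that die in the localization are
  killed by a single power \<open>t\<^sup>(\<^sup>N\<^sup>0\<^sup>,\<^sup>N\<^sup>0\<^sup>)\<close>, because the kernels of the powers form a chain in a finite-dimensional space.
  In degrees above \<open>(n0 + N0, n0 + N0)\<close> every element is \<open>t\<^sup>(\<^sup>N\<^sup>0\<^sup>,\<^sup>N\<^sup>0\<^sup>)\<close> times a monomial times an element of \<open>A(c)\<close>, so
  nothing in the kernel survives.\<close>

lemma localization_injective_above:
  assumes fg: "fg_graded_module {} A" and C: "graded_module {1, 2} C" and loc: "localizes {} {1, 2} A C \<psi>"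
  obtains n :: nat where
    "\<And>d x. \<lbrakk>int n \<le> fst d; int n \<le> snd d; x \<in> hpart A d; \<psi> x = \<zero>\<^bsub>C\<^esub>\<rbrakk> \<Longrightarrow> x = \<zero>\<^bsub>A\<^esub>"
proof -
  obtain X where X: "graded_module {} A" "finite X" "X \<subseteq> carrier A"
    "LinearCombinations.module.span (locR {}) A X = carrier A"
    using fg by (rule fg_graded_moduleE)
  interpret laurent_map "{}" A C \<psi>
    using X(1) C loc by (intro laurent_mapI) (auto simp: localizes_def)
  obtain n0 :: nat where n0: "\<And>d. hpart A d \<subseteq> tpow A (d - (min (fst d) (int n0), min (snd d) (int n0))) `
      hpart A (min (fst d) (int n0), min (snd d) (int n0))"
    using A.hpart_generated_below[OF refl X(2-4)] by metis
  define c where "c = (int n0, int n0)"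
  obtain \<phi> n where "coordinates {} A c \<phi> n" using coordinates_exist[OF fg] by metis
  then interpret coordinates "{}" A c \<phi> n .
  define W where "W N = {z \<in> hpart A c. tpow A (int N, int N) z = \<zero>\<^bsub>A\<^esub>}" for N :: nat
  have deg: "(int N, int N) \<in> degs {}" for N by (simp add: in_degs_empty)
  have W_mono: "W M \<subseteq> W N" if "M \<le> N" for M N
  proof
    fix z assume z: "z \<in> W M"
    then have "z \<in> hpart A c" by (simp add: W_def)
    then have zc: "z \<in> carrier A" by (rule A.hpart_carrier)
    have "tpow A (int N, int N) z = tpow A (int (N - M), int (N - M)) (tpow A (int M, int M) z)"
      using that A.tpow_tpow[OF deg deg zc, of "N - M" M] by simp
    then show "z \<in> W N" using z A.tpow_zero[OF deg] by (simp add: W_def)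
  qed
  have "\<exists>N0. \<forall>N. W N \<subseteq> W N0"
  proof (rule chain_stabilises)
    show "k_subspace A (W N)" for N
      unfolding k_subspace_def W_def
      using A.hpart_carrier[of _ c] A.hpart_add[of _ c] A.kmul_hpart[of _ c] A.tpow_zero[OF deg] A.tpow_add[OF deg] A.tpow_kmul[OF deg]
      by auto
    show "W N \<subseteq> hpart A c" for N by (auto simp: W_def)
    show "mono W" using W_mono by (auto simp: mono_def)
  qed
  then obtain N0 where N0: "\<And>N. W N \<subseteq> W N0" by blast
  show thesis
  proof (rule that)
    fix d x assume d: "int (n0 + N0) \<le> fst d" "int (n0 + N0) \<le> snd d"
      and x: "x \<in> hpart A d" "\<psi> x = \<zero>\<^bsub>C\<^esub>"
    have "(min (fst d) (int n0), min (snd d) (int n0)) = c" using d by (simp add: c_def)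
    then obtain z where z: "z \<in> hpart A c" "x = tpow A (d - c) z" using n0[of d] x(1) by auto
    have dc: "d - c \<in> degs {}" "d - c - (int N0, int N0) \<in> degs {}"
      using d by (auto simp: in_degs_empty c_def)
    have zc: "z \<in> carrier A" using z(1) by (rule A.hpart_carrier)
    have "tpow C (d - c) (\<psi> z) = \<zero>\<^bsub>C\<^esub>" using homD(5)[OF dc(1) zc] x(2) z(2) by simp
    then have "\<psi> z = \<zero>\<^bsub>C\<^esub>"
      using B.tpow_cancel(1)[of "d - c" "\<psi> z"] homD(1)[OF zc] by simp
    then obtain N where "tpow A (int N, int N) z = \<zero>\<^bsub>A\<^esub>"
      using loc zc unfolding localizes_def inv_deg_values by blast
    then have "z \<in> W N0" using N0[of N] z(1) by (auto simp: W_def)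
    then have "tpow A (int N0, int N0) z = \<zero>\<^bsub>A\<^esub>" by (simp add: W_def)
    moreover have "x = tpow A (d - c - (int N0, int N0)) (tpow A (int N0, int N0) z)"
      unfolding z(2) using A.tpow_tpow[OF dc(2) deg zc] by simp
    ultimately show "x = \<zero>\<^bsub>A\<^esub>" using A.tpow_zero[OF dc(2)] by simp
  qed
qed

lemma mon_image_eq: "mon_image A a c = tpow A (int_deg c - int_deg a) ` hpart A (int_deg a)"
  by (simp add: mon_image_def tpow_def)

text \<open>For large \<open>c\<close> the space \<open>A(c)\<close> embeds into \<open>C(0)\<close>, and the image of \<open>A(a)\<close> in \<open>A(c)\<close> is carried to the image of \<open>A(a)\<close> in
  \<open>C(0)\<close>; injective maps commute with intersections and preserve dimensions.\<close>

lemma irk_eventually: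
  assumes fg: "fg_graded_module {} A" and loc: "localizes {} {1, 2} A C \<psi>"
    and co: "coordinates {1, 2} C 0 \<phi> n"
  shows "\<exists>N. \<forall>c1\<ge>N. \<forall>c2\<ge>N. irk A a b (c1, c2) =
    kv.dim (\<phi> ` (deg0_image A C \<psi> (int_deg a) \<inter> deg0_image A C \<psi> (int_deg b)))"
proof -
  have C: "graded_module {1, 2} C" by (rule coordinates.axioms(1)[OF co])
  have A: "graded_module {} A" using fg by (rule fg_graded_moduleE)
  interpret laurent_map "{}" A C \<psi>
    using A C loc by (intro laurent_mapI) (auto simp: localizes_def)
  interpret co: coordinates "{1, 2}" C 0 \<phi> n by (rule co)
  obtain n0 :: nat where n0:
    "\<And>d x. \<lbrakk>int n0 \<le> fst d; int n0 \<le> snd d; x \<in> hpart A d; \<psi> x = \<zero>\<^bsub>C\<^esub>\<rbrakk> \<Longrightarrow> x = \<zero>\<^bsub>A\<^esub>"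
    using localization_injective_above[OF fg C loc] by metis
  \<comment> \<open>The sum is a convenient upper bound for \<open>n0\<close> and for the coordinates of \<open>a\<close> and \<open>b\<close>.\<close>
  define N where "N = n0 + fst a + snd a + fst b + snd b"
  have "irk A a b (c1, c2) = kv.dim (\<phi> ` (deg0_image A C \<psi> (int_deg a) \<inter> deg0_image A C \<psi> (int_deg b)))"
    if c: "c1 \<ge> N" "c2 \<ge> N" for c1 c2
  proof -
    define d where "d = int_deg (c1, c2)"
    define \<chi> where "\<chi> x = tpow C (- d) (\<psi> x)" for x
    define W where "W = mon_image A a (c1, c2) \<inter> mon_image A b (c1, c2)"
    have inj: "inj_on \<chi> (hpart A d)"
    proof (rule inj_onI)
      fix x y assume xy: "x \<in> hpart A d" "y \<in> hpart A d" "\<chi> x = \<chi> y"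
      note xyc = A.hpart_carrier[OF xy(1)] A.hpart_carrier[OF xy(2)]
      have "\<psi> x = \<psi> y"
        using arg_cong[OF xy(3), of "tpow C d"] homD(1)[OF xyc(1)] homD(1)[OF xyc(2)]
        by (simp add: \<chi>_def B.tpow_cancel)
      moreover have kc: "kmul A (- 1) y \<in> hpart A d" by (rule A.kmul_hpart[OF xy(2)])
      moreover have "kmul C (- 1) (\<psi> y) \<oplus>\<^bsub>C\<^esub> \<psi> y = \<zero>\<^bsub>C\<^esub>"
        using B.kmul_l_distr[of "\<psi> y" "- 1" 1] B.kmul_one[of "\<psi> y"] B.kmul_0[of "\<psi> y"]
          homD(1)[OF xyc(2)] by simp
      ultimately have "\<psi> (kmul A (- 1) y \<oplus>\<^bsub>A\<^esub> x) = \<zero>\<^bsub>C\<^esub>"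
        using homD(2)[OF A.hpart_carrier[OF kc] xyc(1)] homD(6)[OF xyc(2)] by simp
      then have z: "kmul A (- 1) y \<oplus>\<^bsub>A\<^esub> x = \<zero>\<^bsub>A\<^esub>"
        using A.hpart_add[OF kc xy(1)] c by (intro n0[of d]) (auto simp: d_def int_deg_def N_def)
      have z': "kmul A (- 1) y \<oplus>\<^bsub>A\<^esub> y = \<zero>\<^bsub>A\<^esub>"
        using A.kmul_l_distr[of y "- 1" 1] A.kmul_one[of y] A.kmul_0[of y] xyc(2) by simp
      show "x = y"
        using A.minus_equality[OF z xyc(1) A.hpart_carrier[OF kc]]
          A.minus_equality[OF z' xyc(2) A.hpart_carrier[OF kc]] A.minus_minus xyc by metis
    qed
    have mon: "mon_image A e (c1, c2) \<subseteq> hpart A d" "\<chi> ` mon_image A e (c1, c2) = deg0_image A C \<psi> (int_deg e)"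
      "k_subspace A (mon_image A e (c1, c2))"
      if e: "fst e \<le> N" "snd e \<le> N" for e
    proof -
      have q: "d - int_deg e \<in> degs {}" using e c by (auto simp: in_degs_empty d_def int_deg_def)
      show "mon_image A e (c1, c2) \<subseteq> hpart A d"
        unfolding mon_image_eq d_def[symmetric]
      proof
        fix y assume "y \<in> tpow A (d - int_deg e) ` hpart A (int_deg e)"
        then obtain x where "x \<in> hpart A (int_deg e)" "y = tpow A (d - int_deg e) x" by blast
        then show "y \<in> hpart A d" using A.tpow_hpart[OF q, of x "int_deg e"] by simp
      qed
      show "\<chi> ` mon_image A e (c1, c2) = deg0_image A C \<psi> (int_deg e)"
        unfolding mon_image_eq d_def[symmetric] deg0_image_def image_image
      proof (rule image_cong[OF refl])
        fix x assume "x \<in> hpart A (int_deg e)"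
        from shift_tpow[OF this q] show "\<chi> (tpow A (d - int_deg e) x) = tpow C (- int_deg e) (\<psi> x)"
          by (simp add: \<chi>_def)
      qed
      show "k_subspace A (mon_image A e (c1, c2))"
        unfolding k_subspace_def mon_image_eq d_def[symmetric]
      proof (intro conjI ballI allI)
        show "tpow A (d - int_deg e) ` hpart A (int_deg e) \<subseteq> carrier A"
          using A.tpow_closed[OF q] A.hpart_carrier by blast
        show "\<zero>\<^bsub>A\<^esub> \<in> tpow A (d - int_deg e) ` hpart A (int_deg e)"
          by (rule image_eqI[where x = "\<zero>\<^bsub>A\<^esub>"]) (simp_all add: A.tpow_zero[OF q])
        fix x assume "x \<in> tpow A (d - int_deg e) ` hpart A (int_deg e)"
        then obtain v where v: "v \<in> hpart A (int_deg e)" "x = tpow A (d - int_deg e) v" by blast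
        show "kmul A c x \<in> tpow A (d - int_deg e) ` hpart A (int_deg e)" for c
          by (rule image_eqI[OF _ A.kmul_hpart[OF v(1)]])
            (simp add: v(2) A.tpow_kmul[OF q A.hpart_carrier[OF v(1)]])
        fix y assume "y \<in> tpow A (d - int_deg e) ` hpart A (int_deg e)"
        then obtain w where w: "w \<in> hpart A (int_deg e)" "y = tpow A (d - int_deg e) w" by blast
        show "x \<oplus>\<^bsub>A\<^esub> y \<in> tpow A (d - int_deg e) ` hpart A (int_deg e)"
          by (rule image_eqI[OF _ A.hpart_add[OF v(1) w(1)]])
            (simp add: v(2) w(2) A.tpow_add[OF q A.hpart_carrier[OF v(1)] A.hpart_carrier[OF w(1)]])
      qed
    qed
    have ab: "fst a \<le> N" "snd a \<le> N" "fst b \<le> N" "snd b \<le> N" by (auto simp: N_def)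
    have W: "W \<subseteq> hpart A d" "k_subspace A W"
      unfolding W_def using mon(1)[OF ab(1,2)] A.k_subspace_inter[OF mon(3)[OF ab(1,2)] mon(3)[OF ab(3,4)]]
      by blast+
    have \<chi>W: "\<chi> ` W = deg0_image A C \<psi> (int_deg a) \<inter> deg0_image A C \<psi> (int_deg b)"
      unfolding W_def using inj_on_image_Int[OF inj mon(1)[OF ab(1,2)] mon(1)[OF ab(3,4)]]
      by (simp add: mon(2) ab)
    have \<chi>0: "\<chi> x \<in> hpart C 0" if "x \<in> W" for x
      unfolding \<chi>_def using W(1) that by (intro shift_hpart) blast
    have "linear_coordinates (kspace A W) (\<lambda>x. \<phi> (\<chi> x))"
      unfolding linear_coordinates_def linear_coordinates_axioms_def
    proof (intro conjI allI impI)
      show "vectorspace class_ring (kspace A W)" by (rule A.vectorspace_kspace[OF W(2)])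
      show "inj_on (\<lambda>x. \<phi> (\<chi> x)) (carrier (kspace A W))"
      proof (rule inj_onI)
        fix x y assume "x \<in> carrier (kspace A W)" "y \<in> carrier (kspace A W)" "\<phi> (\<chi> x) = \<phi> (\<chi> y)"
        then have xy: "x \<in> W" "y \<in> W" "\<phi> (\<chi> x) = \<phi> (\<chi> y)" by simp_all
        from inj_onD[OF co.co_inj xy(3) \<chi>0[OF xy(1)] \<chi>0[OF xy(2)]]
        show "x = y" using inj W(1) xy(1,2) by (auto dest: inj_onD)
      qed
    next
      fix v w assume "v \<in> carrier (kspace A W)" "w \<in> carrier (kspace A W)"
      then have vw: "v \<in> W" "w \<in> W" by simp_all
      then show "\<phi> (\<chi> (v \<oplus>\<^bsub>kspace A W\<^esub> w)) = \<phi> (\<chi> v) + \<phi> (\<chi> w)"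
        using shift_add[OF subsetD[OF W(1) vw(1)] subsetD[OF W(1) vw(2)]]
          co.co_add[OF \<chi>0[OF vw(1)] \<chi>0[OF vw(2)]] by (simp add: \<chi>_def)
    next
      fix v k assume "v \<in> carrier (kspace A W)"
      then have v: "v \<in> W" by simp
      then show "\<phi> (\<chi> (k \<odot>\<^bsub>kspace A W\<^esub> v)) = kscale k (\<phi> (\<chi> v))"
        using shift_kmul[OF subsetD[OF W(1) v]] co.co_kmul[OF \<chi>0[OF v]] by (simp add: \<chi>_def)
    qed
    from linear_coordinates.dim_eq[OF this, of "unit_vec ` {..<n}"]
    have "dim_k A W = kv.dim ((\<lambda>x. \<phi> (\<chi> x)) ` W)"
      using co.co_span[of "\<chi> ` W"] \<chi>0 by (simp add: dim_k_kspace image_image image_subset_iff)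
    also have "(\<lambda>x. \<phi> (\<chi> x)) ` W = \<phi> ` (\<chi> ` W)" by (simp add: image_image)
    finally show ?thesis by (simp add: irk_def W_def[symmetric] \<chi>W)
  qed
  then show ?thesis by blast
qed

lemma deg0_image_cong:
  assumes "graded_module \<sigma> A" "\<And>x. x \<in> carrier A \<Longrightarrow> \<psi> x = \<psi>' x"
  shows "deg0_image A C \<psi> d = deg0_image A C \<psi>' d"
  unfolding deg0_image_def using assms(2) graded_module.hpart_carrier[OF assms(1)] by (intro image_cong) auto

text \<open>The images of \<open>A(d + N e)\<close> increase with \<open>N\<close> inside the image of \<open>B(d)\<close>, and each element of the latter is reached
  for some \<open>N\<close> since \<open>B\<close> is a localization of \<open>A\<close>; finite-dimensionality gives one \<open>N\<close> for all.\<close>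

lemma deg0_image_stabilises:
  assumes A: "graded_module {} A" and loc: "localizes {} \<tau> A B \<psi>" and m: "laurent_map \<tau> B C m"
    and co: "coordinates {1, 2} C 0 \<phi> n"
  shows "\<exists>N0. \<forall>N\<ge>N0. deg0_image A C (\<lambda>x. m (\<psi> x)) (inv_deg {} \<tau> N + d) = deg0_image B C m d"
proof -
  interpret m: laurent_map \<tau> B C m by (rule m)
  interpret co: coordinates "{1, 2}" C 0 \<phi> n by (rule co)
  have \<psi>: "\<psi> \<in> graded_hom {} A B" using loc by (simp add: localizes_def)
  interpret AB: graded_module_pair "{}" A \<tau> B
    using A m.A.graded_module_axioms by (simp add: graded_module_pair_def graded_module_pair_axioms_def)
  have \<psi>': "(\<lambda>x. m (\<psi> x)) \<in> graded_hom {} A C"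
    by (rule graded_hom_comp[OF \<psi> graded_hom_restrict[OF m.hom]]) simp
  interpret \<psi>': laurent_map "{}" A C "\<lambda>x. m (\<psi> x)"
    using A m.B.graded_module_axioms \<psi>' by (intro laurent_mapI) auto
  define W where "W N = deg0_image A C (\<lambda>x. m (\<psi> x)) (inv_deg {} \<tau> N + d)" for N
  have W_mono: "W M \<subseteq> W N" if "M \<le> N" for M N
  proof -
    have "inv_deg {} \<tau> N + d = inv_deg {} \<tau> (N - M) + (inv_deg {} \<tau> M + d)"
      using that inv_deg_add[of "{}" \<tau> "N - M" M] by (simp add: add.assoc)
    then show ?thesis unfolding W_def using \<psi>'.deg0_image_mono[OF inv_deg_in_degs(1)] by metis
  qed
  have "\<exists>N0. \<forall>N. W N \<subseteq> W N0"
    unfolding W_def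
    by (rule co.chain_stabilises[OF \<psi>'.k_subspace_deg0_image \<psi>'.deg0_image_subset])
      (use W_mono in \<open>auto simp: W_def mono_def\<close>)
  then obtain N0 where N0: "\<And>N. W N \<subseteq> W N0" by blast
  have WB: "W N \<subseteq> deg0_image B C m d" for N
  proof -
    have "W N \<subseteq> deg0_image B C m (inv_deg {} \<tau> N + d)"
      unfolding W_def deg0_image_def using graded_homD(4)[OF \<psi>] by blast
    then show ?thesis using m.deg0_image_shift[of "inv_deg {} \<tau> N" d] by simp
  qed
  have BW: "deg0_image B C m d \<subseteq> W N0"
  proof
    fix v assume v: "v \<in> deg0_image B C m d"
    then obtain y where y: "y \<in> hpart B d" "v = tpow C (- d) (m y)" by (auto simp: deg0_image_def)
    obtain N x where x: "x \<in> carrier A" "tpow B (inv_deg {} \<tau> N) y = \<psi> x"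
      using loc m.A.hpart_carrier[OF y(1)] unfolding localizes_def by blast
    define e where "e = inv_deg {} \<tau> N + d"
    have ye: "tpow B (inv_deg {} \<tau> N) y \<in> hpart B e"
      unfolding e_def by (rule m.A.tpow_hpart[OF inv_deg_in_degs(1) y(1)])
    have xe: "hcomp A e x \<in> hpart A e" by (rule AB.A.hcomp_decomposition(1)[OF x(1)])
    have "\<psi> (hcomp A e x) = tpow B (inv_deg {} \<tau> N) y"
      using AB.hcomp_graded_hom[OF \<psi> x(1), of e] m.A.hcomp_hpart[OF ye, of e] x(2) by simp
    moreover have "v = tpow C (- e) (m (tpow B (inv_deg {} \<tau> N) y))"
      using m.shift_tpow[OF y(1), of "inv_deg {} \<tau> N"] y(2) by (simp add: e_def)
    ultimately have "v \<in> W N" unfolding W_def e_def[symmetric] deg0_image_def using xe by (intro image_eqI[OF _ xe]) simp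
    then show "v \<in> W N0" using N0 by blast
  qed
  have "W N = deg0_image B C m d" if "N \<ge> N0" for N
    using WB[of N] BW W_mono[OF that] by blast
  then show ?thesis unfolding W_def by blast
qed

text \<open>The values are natural numbers, so a limit is an eventual value.\<close>

lemma Lim_pair_eventually_const:
  fixes f :: "nat \<Rightarrow> nat \<Rightarrow> nat"
  assumes "\<And>i j. i \<ge> N \<Longrightarrow> j \<ge> N \<Longrightarrow> f i j = l"
  shows "Lim (sequentially \<times>\<^sub>F sequentially) (\<lambda>(i, j). f i j) = l"
proof (rule tendsto_Lim)
  show "\<not> trivial_limit (sequentially \<times>\<^sub>F sequentially)"
    by (simp add: prod_filter_eq_bot)
  have "eventually (\<lambda>p. (case p of (i, j) \<Rightarrow> f i j) = l) (sequentially \<times>\<^sub>F sequentially)"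
    unfolding eventually_prod_sequentially using assms by (intro exI[of _ N]) auto
  then show "((\<lambda>(i, j). f i j) \<longlongrightarrow> l) (sequentially \<times>\<^sub>F sequentially)"
    by (rule tendsto_eventually)
qed

text \<open>The inner limit is \<open>irk_eventually\<close>, the outer one \<open>deg0_image_stabilises\<close> at \<open>t\<^sub>2\<close> for \<open>a\<close> and at \<open>t\<^sub>1\<close> for \<open>b\<close>.\<close>

lemma sirk_eq:
  assumes fg: "fg_graded_module {} A" and loc: "localizes {} {1, 2} A C \<psi>"
    and loc1: "localizes {} {1} A B1 \<psi>1" and loc2: "localizes {} {2} A B2 \<psi>2"
    and m1: "laurent_map {1} B1 C m1" and m2: "laurent_map {2} B2 C m2"
    and eq: "\<And>x. x \<in> carrier A \<Longrightarrow> \<psi> x = m1 (\<psi>1 x)" "\<And>x. x \<in> carrier A \<Longrightarrow> \<psi> x = m2 (\<psi>2 x)"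
    and co: "coordinates {1, 2} C 0 \<phi> n"
  shows "sirk A (i, j) = kv.dim (\<phi> ` deg0_image B2 C m2 (int i, 0) \<inter> \<phi> ` deg0_image B1 C m1 (0, int j))"
proof -
  interpret co: coordinates "{1, 2}" C 0 \<phi> n by (rule co)
  interpret m1: laurent_map "{1}" B1 C m1 by (rule m1)
  interpret m2: laurent_map "{2}" B2 C m2 by (rule m2)
  have A: "graded_module {} A" using fg by (rule fg_graded_moduleE)
  have c1: "deg0_image A C \<psi> d = deg0_image A C (\<lambda>x. m1 (\<psi>1 x)) d" for d by (rule deg0_image_cong[OF A eq(1)])
  have c2: "deg0_image A C \<psi> d = deg0_image A C (\<lambda>x. m2 (\<psi>2 x)) d" for d by (rule deg0_image_cong[OF A eq(2)])
  obtain N1 where "\<forall>N\<ge>N1. deg0_image A C \<psi> (inv_deg {} {1} N + (0, int j)) = deg0_image B1 C m1 (0, int j)"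
    unfolding c1 using deg0_image_stabilises[OF A loc1 m1 co] by (rule exE)
  then have N1: "deg0_image A C \<psi> (int_deg (N, j)) = deg0_image B1 C m1 (0, int j)" if "N \<ge> N1" for N
    using that by (simp only: inv_deg_values int_deg_def) simp
  obtain N2 where "\<forall>N\<ge>N2. deg0_image A C \<psi> (inv_deg {} {2} N + (int i, 0)) = deg0_image B2 C m2 (int i, 0)"
    unfolding c2 using deg0_image_stabilises[OF A loc2 m2 co] by (rule exE)
  then have N2: "deg0_image A C \<psi> (int_deg (i, N)) = deg0_image B2 C m2 (int i, 0)" if "N \<ge> N2" for N
    using that by (simp only: inv_deg_values int_deg_def) simp
  define D where "D a2 b1 = kv.dim (\<phi> ` (deg0_image A C \<psi> (int_deg (i, a2)) \<inter> deg0_image A C \<psi> (int_deg (b1, j))))" for a2 b1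
  have inner: "Lim (sequentially \<times>\<^sub>F sequentially) (\<lambda>(c1, c2). irk A (i, a2) (b1, j) (c1, c2)) = D a2 b1" for a2 b1
  proof -
    obtain N where "\<And>c1 c2. c1 \<ge> N \<Longrightarrow> c2 \<ge> N \<Longrightarrow> irk A (i, a2) (b1, j) (c1, c2) = D a2 b1"
      using irk_eventually[OF fg loc co, of "(i, a2)" "(b1, j)"] unfolding D_def by blast
    then show ?thesis by (rule Lim_pair_eventually_const)
  qed
  have "D a2 b1 = kv.dim (\<phi> ` deg0_image B2 C m2 (int i, 0) \<inter> \<phi> ` deg0_image B1 C m1 (0, int j))"
    if "a2 \<ge> max N1 N2" "b1 \<ge> max N1 N2" for a2 b1
    using N1[of b1] N2[of a2] that inj_on_image_Int[OF co.co_inj m2.deg0_image_subset m1.deg0_image_subset]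
    by (simp add: D_def)
  then have "Lim (sequentially \<times>\<^sub>F sequentially) (\<lambda>(a2, b1). D a2 b1) =
      kv.dim (\<phi> ` deg0_image B2 C m2 (int i, 0) \<inter> \<phi> ` deg0_image B1 C m1 (0, int j))"
    by (rule Lim_pair_eventually_const)
  moreover have "Lim (sequentially \<times>\<^sub>F sequentially) (irk A (i, a2) (b1, j)) = D a2 b1" for a2 b1
    using inner[of a2 b1] by simp
  ultimately show ?thesis by (simp add: sirk_def)
qed

section \<open>The graded module of a monotone family of coordinate subspaces\<close>

text \<open>An element of \<open>k[t\<^sub>1\<^sup>\<plusminus>\<^sup>1, t\<^sub>2\<^sup>\<plusminus>\<^sup>1]\<^sup>n\<close> is a finite family of vectors of coefficients, one for each degree; the submodule
  attached to \<open>H\<close> consists of the elements whose coefficient vector in degree \<open>d\<close> lies in \<open>H d\<close>.\<close>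

definition slice :: "(nat \<Rightarrow> 'k::field laurent) \<Rightarrow> int \<times> int \<Rightarrow> nat \<Rightarrow> 'k" where
  "slice f d = (\<lambda>i. Poly_Mapping.lookup (f i) d)"

definition homog :: "int \<times> int \<Rightarrow> (nat \<Rightarrow> 'k::field) \<Rightarrow> nat \<Rightarrow> 'k laurent" where
  "homog d u = (\<lambda>i. Poly_Mapping.single d (u i))"

definition family_module :: "(int \<times> int \<Rightarrow> (nat \<Rightarrow> 'k::field) set) \<Rightarrow> ('k laurent, nat \<Rightarrow> 'k laurent) gmodule" where
  "family_module H = \<lparr>carrier = {f. \<forall>d. slice f d \<in> H d}, mult = undefined, one = undefined,
     zero = (\<lambda>i. 0), add = (\<lambda>f g i. f i + g i), smult = (\<lambda>r f i. r * f i),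
     hpart = (\<lambda>d. {f. slice f d \<in> H d \<and> (\<forall>e. e \<noteq> d \<longrightarrow> slice f e = 0)})\<rparr>"

lemma slice_add: "slice (\<lambda>i. f i + g i) d = slice f d + slice g d"
  by (simp add: slice_def lookup_add fun_eq_iff)

lemma slice_zero [simp]: "slice (\<lambda>i. 0) d = 0"
  by (simp add: slice_def fun_eq_iff)

lemma lookup_single_mult: "Poly_Mapping.lookup (Poly_Mapping.single e c * p) d = c * Poly_Mapping.lookup p (d - e)"
  for p :: "'k::field laurent"
proof -
  have "Poly_Mapping.keys p \<subseteq> degs {1, 2}" by simp
  then show ?thesis
  proof (induction rule: locR_induct)
    case (single e' c')
    have "e + e' = d \<longleftrightarrow> e' = d - e" by (auto simp: algebra_simps)
    then show ?case by (simp add: mult_single lookup_single when_def)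
  next
    case (add p q)
    then show ?case by (simp add: distrib_left lookup_add)
  qed
qed

lemma slice_single_mult: "slice (\<lambda>i. Poly_Mapping.single e c * f i) d = kscale c (slice f (d - e))"
  by (simp add: slice_def kscale_def lookup_single_mult)

lemma slice_homog: "slice (homog d u) e = (if e = d then u else 0)"
  by (auto simp: slice_def homog_def lookup_single fun_eq_iff when_def)

lemma slice_ext: "(\<And>d. slice f d = slice g d) \<Longrightarrow> f = g"
  by (rule ext, rule poly_mapping_eqI) (simp add: slice_def fun_eq_iff)

text \<open>Monotonicity makes the submodule closed under monomials; the bound \<open>n\<close> makes the degrees of an element a finite set.\<close>

locale subspace_family =
  fixes H :: "int \<times> int \<Rightarrow> (nat \<Rightarrow> 'k::field) set" and n :: nat
  assumes subspace: "kv.subspace (H d)"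
    and bound: "u \<in> H d \<Longrightarrow> n \<le> i \<Longrightarrow> u i = 0"
    and mono: "e \<in> degs {} \<Longrightarrow> H d \<subseteq> H (e + d)"
    and outside: "d \<notin> degs {} \<Longrightarrow> H d = {0}"
begin

abbreviation A :: "('k laurent, nat \<Rightarrow> 'k laurent) gmodule" where
  "A \<equiv> family_module H"

lemma A_simps:
  "f \<in> carrier A \<longleftrightarrow> (\<forall>d. slice f d \<in> H d)" "zero A = (\<lambda>i. 0)" "add A = (\<lambda>f g i. f i + g i)"
  "smult A = (\<lambda>r f i. r * f i)" "f \<in> hpart A d \<longleftrightarrow> slice f d \<in> H d \<and> (\<forall>e. e \<noteq> d \<longrightarrow> slice f e = 0)"
  by (simp_all add: family_module_def)

lemma H_zero: "0 \<in> H d"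
  using subspace by (rule kv.subspace_0)

lemma hpart_in_carrier: "f \<in> hpart A d \<Longrightarrow> f \<in> carrier A"
  unfolding A_simps using H_zero by metis

lemma finite_support:
  assumes "f \<in> carrier A"
  shows "finite {d. slice f d \<noteq> 0}"
proof (rule finite_subset)
  show "{d. slice f d \<noteq> 0} \<subseteq> (\<Union>i<n. Poly_Mapping.keys (f i))"
  proof
    fix d assume "d \<in> {d. slice f d \<noteq> 0}"
    then obtain i where i: "slice f d i \<noteq> 0" by (auto simp: fun_eq_iff)
    then have "i < n" using bound[of "slice f d" d i] assms by (simp add: A_simps) (meson not_less)
    then show "d \<in> (\<Union>i<n. Poly_Mapping.keys (f i))" using i by (auto simp: slice_def in_keys_iff)
  qed
qed simp

lemma closed_add: "f \<in> carrier A \<Longrightarrow> g \<in> carrier A \<Longrightarrow> (\<lambda>i. f i + g i) \<in> carrier A"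
  by (simp add: A_simps slice_add kv.subspace_add[OF subspace])

lemma closed_single:
  assumes "e \<in> degs {}" "f \<in> carrier A"
  shows "(\<lambda>i. Poly_Mapping.single e c * f i) \<in> carrier A"
proof -
  have "slice f (d - e) \<in> H d" for d
    using mono[OF assms(1), of "d - e"] assms(2) by (auto simp: A_simps)
  then show ?thesis by (simp add: A_simps slice_single_mult kv.subspace_scale[OF subspace])
qed

lemma closed_smult:
  assumes "Poly_Mapping.keys r \<subseteq> degs {}" "f \<in> carrier A"
  shows "(\<lambda>i. r * f i) \<in> carrier A"
  using assms(1)
proof (induction rule: locR_induct)
  case (single e c)
  then show ?case using assms(2) by (rule closed_single)
next
  case (add p q)
  then show ?case using closed_add[OF add.IH] by (simp add: distrib_right)
qed

lemma abelian_group_A: "abelian_group A"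
proof (rule abelian_groupI)
  fix f assume f: "f \<in> carrier A"
  have "(\<lambda>i. Poly_Mapping.single 0 (- 1) * f i) \<in> carrier A" using f by (intro closed_single) simp_all
  moreover have "(\<lambda>i. Poly_Mapping.single 0 (- 1) * f i + f i) = (\<lambda>i. 0)"
  proof
    fix i
    have "Poly_Mapping.single 0 (- 1) * f i + f i = (Poly_Mapping.single 0 (- 1) + Poly_Mapping.single 0 1) * f i"
      by (simp add: distrib_right)
    also have "\<dots> = 0" by (simp add: single_add[symmetric] del: single_one)
    finally show "Poly_Mapping.single 0 (- 1) * f i + f i = 0" .
  qed
  ultimately show "\<exists>g\<in>carrier A. g \<oplus>\<^bsub>A\<^esub> f = \<zero>\<^bsub>A\<^esub>"
    unfolding A_simps(2,3) by (intro bexI[where x = "\<lambda>i. Poly_Mapping.single 0 (- 1) * f i"])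
qed (simp_all add: A_simps(2,3) closed_add ac_simps, simp add: A_simps H_zero)

lemma module_A: "Module.module (locR {}) A"
proof (rule moduleI[OF cring_locR abelian_group_A])
qed (simp_all add: A_simps(3,4) closed_smult distrib_left distrib_right mult.assoc)

interpretation mod: Module.module "locR {} :: 'k laurent ring" A
  by (rule module_A)

lemma finsum_A:
  assumes "finite S" "\<And>d. d \<in> S \<Longrightarrow> g d \<in> carrier A"
  shows "(\<Oplus>\<^bsub>A\<^esub>d\<in>S. g d) = (\<lambda>i. \<Sum>d\<in>S. g d i)"
  using assms
proof (induction S)
  case empty
  then show ?case by (simp add: A_simps(2))
next
  case (insert d S)
  have "(\<Oplus>\<^bsub>A\<^esub>d\<in>insert d S. g d) = g d \<oplus>\<^bsub>A\<^esub> (\<Oplus>\<^bsub>A\<^esub>d\<in>S. g d)"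
    using insert by (intro mod.finsum_insert) auto
  then show ?case using insert by (simp add: A_simps(3))
qed

lemma slice_sum: "slice (\<lambda>i. \<Sum>d\<in>S. g d i) e = (\<Sum>d\<in>S. slice (g d) e)"
  by (simp add: slice_def lookup_sum sum_fun_apply fun_eq_iff)

lemma homog_hpart: "u \<in> H d \<Longrightarrow> homog d u \<in> hpart A d"
  by (simp add: A_simps slice_homog)

lemma hpart_homog: "f \<in> hpart A d \<Longrightarrow> f = homog d (slice f d)"
  by (rule slice_ext) (simp add: A_simps slice_homog)

lemma graded_module_A: "graded_module {} A"
proof (intro graded_module.intro graded_module_axioms.intro module_A)
  fix d
  show "subgroup (hpart A d) (add_monoid A)"
  proof (rule group.subgroupI)
    show "group (add_monoid A)" using mod.a_comm_group by (simp add: comm_group_def)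
    show "hpart A d \<subseteq> carrier (add_monoid A)" using hpart_in_carrier[of _ d] by auto
    show "hpart A d \<noteq> {}" using homog_hpart[OF H_zero] by blast
    fix f assume f: "f \<in> hpart A d"
    have "\<ominus>\<^bsub>A\<^esub> f = (\<lambda>i. - f i)"
    proof (rule mod.minus_equality)
      show "(\<lambda>i. - f i) \<oplus>\<^bsub>A\<^esub> f = \<zero>\<^bsub>A\<^esub>" by (simp add: A_simps(2,3))
      show "f \<in> carrier A" using f by (rule hpart_in_carrier)
      show "(\<lambda>i. - f i) \<in> carrier A"
      proof -
        have "slice (\<lambda>i. - f i) e = - slice f e" for e by (simp add: slice_def fun_eq_iff)
        then show ?thesis using hpart_in_carrier[OF f] kv.subspace_neg[OF subspace] by (simp add: A_simps)
      qed
    qed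
    then have inv: "inv\<^bsub>add_monoid A\<^esub> f = (\<lambda>i. - f i)" unfolding a_inv_def .
    have "slice (\<lambda>i. - f i) e = - slice f e" for e by (simp add: slice_def fun_eq_iff)
    then show "inv\<^bsub>add_monoid A\<^esub> f \<in> hpart A d"
      unfolding inv using f kv.subspace_neg[OF subspace] by (simp add: A_simps)
    fix g assume "g \<in> hpart A d"
    moreover have "f \<otimes>\<^bsub>add_monoid A\<^esub> g = (\<lambda>i. f i + g i)" by (simp add: A_simps(3))
    ultimately show "f \<otimes>\<^bsub>add_monoid A\<^esub> g \<in> hpart A d"
      using f kv.subspace_add[OF subspace] by (simp add: A_simps(5) slice_add)
  qed
next
  fix e d f c assume e: "e \<in> degs {}" and f: "f \<in> hpart A d"
  have "slice f (e + d - e) \<in> H (e + d)" using mono[OF e, of d] f by (auto simp: A_simps)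
  moreover have "e' - e \<noteq> d" if "e' \<noteq> e + d" for e' using that by (auto simp: algebra_simps)
  ultimately show "Poly_Mapping.single e c \<odot>\<^bsub>A\<^esub> f \<in> hpart A (e + d)"
    using f by (simp add: A_simps slice_single_mult kv.subspace_scale[OF subspace])
next
  fix d assume "d \<notin> degs {}"
  then have "H d = {0}" by (rule outside)
  then have *: "f \<in> hpart A d \<longleftrightarrow> (\<forall>e. slice f e = 0)" for f
    unfolding A_simps(5) by (metis singleton_iff)
  have "f \<in> hpart A d \<longleftrightarrow> f = (\<lambda>i. 0)" for f
    unfolding * using slice_ext[of f "\<lambda>i. 0"] by (metis slice_zero)
  then show "hpart A d = {\<zero>\<^bsub>A\<^esub>}" unfolding A_simps(2) by blast
next
  fix f assume f: "f \<in> carrier A"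
  let ?P = "\<lambda>g. (\<forall>d. g d \<in> hpart A d) \<and> finite {d. g d \<noteq> \<zero>\<^bsub>A\<^esub>} \<and>
      f = (\<Oplus>\<^bsub>A\<^esub>d\<in>{d. g d \<noteq> \<zero>\<^bsub>A\<^esub>}. g d)"
  have uniq: "g d = homog d (slice f d)" if g: "?P g" for g d
  proof -
    have "slice f d = (\<Sum>e\<in>{e. g e \<noteq> \<zero>\<^bsub>A\<^esub>}. slice (g e) d)"
      using g finsum_A[of "{e. g e \<noteq> \<zero>\<^bsub>A\<^esub>}" g] hpart_in_carrier by (metis slice_sum)
    also have "\<dots> = (\<Sum>e\<in>{e. g e \<noteq> \<zero>\<^bsub>A\<^esub>}. if e = d then slice (g d) d else 0)"
      using g by (intro sum.cong) (auto simp: A_simps(5))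
    also have "\<dots> = slice (g d) d"
      using g by (simp add: A_simps(2))
    finally show ?thesis using g hpart_homog[of "g d" d] by metis
  qed
  have z: "homog d (slice f d) \<noteq> \<zero>\<^bsub>A\<^esub> \<longleftrightarrow> slice f d \<noteq> 0" for d
  proof
    show "homog d (slice f d) \<noteq> \<zero>\<^bsub>A\<^esub> \<Longrightarrow> slice f d \<noteq> 0"
      by (rule contrapos_nn[of "homog d (slice f d) = \<zero>\<^bsub>A\<^esub>"]) (simp_all add: homog_def A_simps(2))
    assume "slice f d \<noteq> 0"
    then have "slice (homog d (slice f d)) d \<noteq> slice \<zero>\<^bsub>A\<^esub> d" by (simp add: slice_homog A_simps(2))
    then show "homog d (slice f d) \<noteq> \<zero>\<^bsub>A\<^esub>" by metis
  qed
  have "f = (\<Oplus>\<^bsub>A\<^esub>d\<in>{d. slice f d \<noteq> 0}. homog d (slice f d))"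
  proof (rule slice_ext)
    fix d
    have "(\<Oplus>\<^bsub>A\<^esub>d\<in>{d. slice f d \<noteq> 0}. homog d (slice f d)) = (\<lambda>i. \<Sum>d\<in>{d. slice f d \<noteq> 0}. homog d (slice f d) i)"
      using finite_support[OF f] f by (intro finsum_A hpart_in_carrier[OF homog_hpart]) (auto simp: A_simps)
    then show "slice f d = slice (\<Oplus>\<^bsub>A\<^esub>d\<in>{d. slice f d \<noteq> 0}. homog d (slice f d)) d"
      using finite_support[OF f] by (simp add: slice_sum slice_homog)
  qed
  then have P: "?P (\<lambda>d. homog d (slice f d))"
    unfolding z using finite_support[OF f] f homog_hpart by (simp add: A_simps(1))
  show "\<exists>!g. ?P g"
  proof (rule ex1I[where a = "\<lambda>d. homog d (slice f d)"])
    show "?P (\<lambda>d. homog d (slice f d))" by (rule P)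
    fix g assume "?P g"
    then show "g = (\<lambda>d. homog d (slice f d))" by (intro ext uniq)
  qed
qed

lemma homog_add: "homog d (u + v) = homog d u \<oplus>\<^bsub>A\<^esub> homog d v"
  by (simp add: homog_def A_simps(3) single_add fun_eq_iff)

lemma homog_scale: "homog d (kscale c u) = kmul A c (homog d u)"
  by (simp add: homog_def kmul_def A_simps(4) kscale_def mult_single fun_eq_iff)

lemma homog_tpow: "homog (e + d) u = tpow A e (homog d u)"
  by (simp add: homog_def tpow_def A_simps(4) mult_single fun_eq_iff)

text \<open>When \<open>H\<close> is constant beyond \<open>N\<close> in either direction, bases of the finitely many \<open>H d\<close> with \<open>d\<close> in the square \<open>[0, N]\<^sup>2\<close>
  generate.\<close>

lemma fg_A:
  assumes stable: "\<And>d. d \<in> degs {} \<Longrightarrow> H d = H (min (fst d) (int N), min (snd d) (int N))"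
  shows "fg_graded_module {} A"
proof -
  interpret graded_module "{}" A by (rule graded_module_A)
  have "\<exists>B. finite B \<and> B \<subseteq> H d \<and> H d \<subseteq> kv.span B" for d
  proof -
    have "H d \<subseteq> kv.span (unit_vec ` {..<n})" using bound finite_coordinates_span[of n] by blast
    then show ?thesis using kv.finite_basis_of_subset[of "unit_vec ` {..<n}" "H d"] by (metis finite_imageI finite_lessThan)
  qed
  then obtain B where B: "\<And>d. finite (B d)" "\<And>d. B d \<subseteq> H d" "\<And>d. H d \<subseteq> kv.span (B d)" by metis
  define X where "X = (\<Union>d\<in>{0..int N} \<times> {0..int N}. homog d ` B d)"
  have fin: "finite X" unfolding X_def using B(1) by blast
  have X: "X \<subseteq> carrier A" unfolding X_def using B(2) homog_hpart hpart_in_carrier by blast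
  have sm: "submodule (locR {}) (mod.span X) A" by (rule mod.span_is_submodule[OF X])
  have "mod.span X = carrier A"
  proof (rule submodule_eq_carrier[OF sm])
    fix d f assume f: "f \<in> hpart A d"
    have smult: "r \<odot>\<^bsub>A\<^esub> x \<in> mod.span X" if "Poly_Mapping.keys r \<subseteq> degs {}" "x \<in> mod.span X" for r x
      using submodule.smult_closed[OF sm] that by simp
    have zero: "\<zero>\<^bsub>A\<^esub> \<in> mod.span X" using submodule.zero_closed[OF sm] .
    show "f \<in> mod.span X"
    proof (cases "d \<in> degs {}")
      case False
      then show ?thesis using hpart_outside[OF False] f zero by simp
    next
      case True
      define m where "m = (min (fst d) (int N), min (snd d) (int N))"
      have m: "m \<in> {0..int N} \<times> {0..int N}" "d - m \<in> degs {}"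
        using True by (cases d, auto simp: m_def in_degs_empty)+
      have "kv.subspace {u. homog m u \<in> mod.span X}"
      proof (rule kv.subspaceI)
        have "homog m (0 :: nat \<Rightarrow> 'k) = \<zero>\<^bsub>A\<^esub>" by (simp add: homog_def A_simps(2))
        then show "0 \<in> {u. homog m u \<in> mod.span X}" using zero by simp
      next
        fix u v assume "u \<in> {u. homog m u \<in> mod.span X}" "v \<in> {u. homog m u \<in> mod.span X}"
        then show "u + v \<in> {u. homog m u \<in> mod.span X}"
          using submodule.m_closed[OF sm] by (simp add: homog_add)
      next
        fix c u assume "u \<in> {u. homog m u \<in> mod.span X}"
        then show "kscale c u \<in> {u. homog m u \<in> mod.span X}"
          using smult by (simp add: homog_scale kmul_def)
      qed
      moreover have "B m \<subseteq> {u. homog m u \<in> mod.span X}"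
        using mod.in_own_span[OF X] m(1) unfolding X_def by blast
      ultimately have "kv.span (B m) \<subseteq> {u. homog m u \<in> mod.span X}" by (intro kv.span_minimal)
      moreover have "slice f d \<in> H m" using f stable[OF True] by (simp add: A_simps m_def)
      ultimately have "homog m (slice f d) \<in> mod.span X" using B(3) by blast
      then have "tpow A (d - m) (homog m (slice f d)) \<in> mod.span X"
        unfolding tpow_def using smult m(2) by simp
      then show ?thesis using homog_tpow[of "d - m" m "slice f d"] hpart_homog[OF f] by simp
    qed
  qed
  then show ?thesis using fin X graded_module_A unfolding fg_graded_module_def by blast
qed

text \<open>Coefficient vectors are read as elements of \<open>C(0)\<close> through the coordinates \<open>\<phi>\<close>, which defines a map to \<open>B\<close> as soon as
  \<open>H d\<close> lies in the image of \<open>B(d)\<close>.  It is a localization if each element of the image of \<open>B(d)\<close> lies in some later \<open>H\<close>.\<close>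

lemma family_module_localizes:
  assumes m: "laurent_map \<tau> B C m" and inj: "inj_on m (carrier B)" and co: "coordinates {1, 2} C 0 \<phi> n"
    and sub: "\<And>d. H d \<subseteq> \<phi> ` deg0_image B C m d"
    and exh: "\<And>d v. v \<in> deg0_image B C m d \<Longrightarrow> \<exists>N. \<phi> v \<in> H (inv_deg {} \<tau> N + d)"
  obtains \<psi> where "localizes {} \<tau> A B \<psi>"
    "\<And>d f. f \<in> hpart A d \<Longrightarrow> m (\<psi> f) = tpow C d (inv_into (hpart C 0) \<phi> (slice f d))"
proof -
  interpret m: laurent_map \<tau> B C m by (rule m)
  interpret co: coordinates "{1, 2}" C 0 \<phi> n by (rule co)
  interpret AB: graded_module_pair "{}" A \<tau> B
    using graded_module_A m.A.graded_module_axioms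
    by (simp add: graded_module_pair_def graded_module_pair_axioms_def)
  define \<delta> where "\<delta> = inv_into (hpart C 0) \<phi>"
  have \<delta>\<phi>: "\<delta> (\<phi> v) = v" if "v \<in> hpart C 0" for v
    unfolding \<delta>_def using inv_into_f_f[OF co.co_inj that] .
  have \<delta>: "\<delta> u \<in> deg0_image B C m d \<and> \<phi> (\<delta> u) = u" if "u \<in> H d" for u d
  proof -
    obtain v where "v \<in> deg0_image B C m d" "u = \<phi> v" using sub \<open>u \<in> H d\<close> by blast
    then show ?thesis using \<delta>\<phi>[of v] m.deg0_image_subset[of d] by auto
  qed
  have \<delta>0: "\<delta> u \<in> hpart C 0" if "u \<in> H d" for u d
    using \<delta>[OF that] m.deg0_image_subset by blast
  have sl: "slice f d \<in> H d" if "f \<in> hpart A d" for f d using that by (simp add: A_simps)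
  have \<delta>add: "\<delta> (u + v) = \<delta> u \<oplus>\<^bsub>C\<^esub> \<delta> v" if "u \<in> H d" "v \<in> H d" for u v d
    using co.co_add[OF \<delta>0[OF that(1)] \<delta>0[OF that(2)]] \<delta>[OF that(1)] \<delta>[OF that(2)]
      \<delta>\<phi>[OF m.B.hpart_add[OF \<delta>0[OF that(1)] \<delta>0[OF that(2)]]] by simp
  have \<delta>scale: "\<delta> (kscale c u) = kmul C c (\<delta> u)" if "u \<in> H d" for u c d
    using co.co_kmul[OF \<delta>0[OF that], of c] \<delta>[OF that] \<delta>\<phi>[OF m.B.kmul_hpart[OF \<delta>0[OF that]], of c] by simp
  obtain \<psi> where \<psi>: "\<psi> \<in> graded_hom {} A B" "\<And>d f. f \<in> hpart A d \<Longrightarrow> m (\<psi> f) = tpow C d (\<delta> (slice f d))"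
  proof (rule factor_through_deg0[OF graded_module_A m inj empty_subsetI, of "\<lambda>d f. \<delta> (slice f d)"])
    show "\<delta> (slice f d) \<in> deg0_image B C m d" if "f \<in> hpart A d" for f d using \<delta>[OF sl[OF that]] by simp
    show "\<delta> (slice (f \<oplus>\<^bsub>A\<^esub> g) d) = \<delta> (slice f d) \<oplus>\<^bsub>C\<^esub> \<delta> (slice g d)"
      if "f \<in> hpart A d" "g \<in> hpart A d" for f g d
      using \<delta>add[OF sl[OF that(1)] sl[OF that(2)]] by (simp add: A_simps(3) slice_add)
    show "\<delta> (slice (kmul A c f) d) = kmul C c (\<delta> (slice f d))" if "f \<in> hpart A d" for f c d
      using \<delta>scale[OF sl[OF that]] by (simp add: kmul_def A_simps(4) slice_single_mult)
    show "\<delta> (slice (tpow A e f) (e + d)) = \<delta> (slice f d)" if "e \<in> degs {}" "f \<in> hpart A d" for e f d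
      by (simp add: tpow_def A_simps(4) slice_single_mult kscale_def)
  qed auto
  have "localizes {} \<tau> A B \<psi>"
  proof (rule localizesI_homogeneous[OF AB.graded_module_pair_axioms \<psi>(1)])
    fix d f assume f: "f \<in> hpart A d" "\<psi> f = \<zero>\<^bsub>B\<^esub>"
    have "tpow C d (\<delta> (slice f d)) = \<zero>\<^bsub>C\<^esub>"
      using \<psi>(2)[OF f(1)] f(2) m.graded_hom_zero[OF m.hom] by simp
    then have "\<delta> (slice f d) = \<zero>\<^bsub>C\<^esub>"
      using m.B.tpow_cancel(1)[of d "\<delta> (slice f d)"] m.B.hpart_carrier[OF \<delta>0[OF sl[OF f(1)]]] by simp
    then have "slice f d = 0" using \<delta>[OF sl[OF f(1)]] co.co_zero by metis
    then show "f = \<zero>\<^bsub>A\<^esub>" using hpart_homog[OF f(1)] by (simp add: homog_def A_simps(2))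
  next
    fix d y assume y: "y \<in> hpart B d"
    define v where "v = tpow C (- d) (m y)"
    have v: "v \<in> deg0_image B C m d" unfolding v_def deg0_image_def using y by blast
    obtain N where N: "\<phi> v \<in> H (inv_deg {} \<tau> N + d)" using exh[OF v] by blast
    define e where "e = inv_deg {} \<tau> N + d"
    have f: "homog e (\<phi> v) \<in> hpart A e" using N by (simp add: homog_hpart e_def)
    have te: "inv_deg {} \<tau> N \<in> degs \<tau>" by simp
    note yc = m.A.hpart_carrier[OF y]
    have "m (\<psi> (homog e (\<phi> v))) = tpow C e v"
      using \<psi>(2)[OF f] \<delta>\<phi>[OF subsetD[OF m.deg0_image_subset v]] by (simp add: slice_homog)
    also have "\<dots> = tpow C (inv_deg {} \<tau> N) (m y)"
      unfolding v_def e_def using m.homD(1)[OF yc] by (simp add: m.B.tpow_tpow)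
    also have "\<dots> = m (tpow B (inv_deg {} \<tau> N) y)" using m.homD(5)[OF te yc] by simp
    finally have "tpow B (inv_deg {} \<tau> N) y = \<psi> (homog e (\<phi> v))"
      using inj graded_homD(1)[OF \<psi>(1) hpart_in_carrier[OF f]] m.A.tpow_closed[OF te yc]
      by (auto dest: inj_onD)
    then show "\<exists>N. \<exists>x\<in>carrier A. tpow B (inv_deg {} \<tau> N) y = \<psi> x"
      using hpart_in_carrier[OF f] by blast
  qed
  then show thesis using \<psi>(2) that unfolding \<delta>_def by blast
qed

end

section \<open>Torsion-free objects\<close>

lemma localizes_of_induces_iso:
  assumes A: "graded_module \<sigma> A" and B: "graded_module \<tau> B" and sub: "\<sigma> \<subseteq> \<tau>"
    and \<phi>: "\<phi> \<in> graded_hom \<sigma> A B" and iso: "induces_iso \<sigma> \<tau> A B \<phi>"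
  shows "localizes \<sigma> \<tau> A B \<phi>"
proof -
  interpret scalar_extension \<sigma> A \<tau>
    using A sub by (simp add: scalar_extension_def scalar_extension_axioms_def)
  interpret B: graded_module \<tau> B by (rule B)
  obtain h where h: "h \<in> graded_iso \<tau> (ext_scalars \<sigma> \<tau> A) B"
    "\<And>r a. \<lbrakk>r \<in> carrier (locR \<tau>); a \<in> carrier A\<rbrakk> \<Longrightarrow> h (tens \<sigma> \<tau> A r a) = r \<odot>\<^bsub>B\<^esub> \<phi> a"
    using iso unfolding induces_iso_def by blast
  have "h (tens \<sigma> \<tau> A 1 a) = \<phi> a" if "a \<in> carrier A" for a
    using h(2)[of 1 a] that B.smult_one[of "\<phi> a"] graded_homD(1)[OF \<phi> that] by simp
  with localizes_of_graded_iso[OF B h(1)] \<phi> show ?thesis by (simp add: localizes_def)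
qed

text \<open>A localization of a module on which \<open>s\<close> acts injectively is injective.\<close>

lemma localization_injective:
  assumes A: "graded_module_pair \<sigma> A \<tau> B" and loc: "localizes \<sigma> \<tau> A B \<psi>"
    and e: "\<And>N. inv_deg \<sigma> \<tau> (Suc N) = e + inv_deg \<sigma> \<tau> N" "e \<in> degs \<sigma>"
    and inj: "inj_on (\<lambda>x. Poly_Mapping.single e 1 \<odot>\<^bsub>A\<^esub> x) (carrier A)"
  shows "inj_on \<psi> (carrier A)"
proof (rule inj_onI)
  interpret graded_module_pair \<sigma> A \<tau> B by (rule A)
  have \<psi>: "\<psi> \<in> graded_hom \<sigma> A B" using loc by (simp add: localizes_def)
  have tors: "z = \<zero>\<^bsub>A\<^esub>" if "z \<in> carrier A" "tpow A (inv_deg \<sigma> \<tau> N) z = \<zero>\<^bsub>A\<^esub>" for z N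
    using that(2)
  proof (induction N)
    case 0
    have "inv_deg \<sigma> \<tau> 0 = 0" by (auto simp: inv_deg_def zero_prod_def)
    then show ?case using 0 that(1) by simp
  next
    case (Suc N)
    have "tpow A e (tpow A (inv_deg \<sigma> \<tau> N) z) = tpow A e \<zero>\<^bsub>A\<^esub>"
      using Suc.prems that(1) e(2) by (simp add: e(1) A.tpow_tpow)
    then have "tpow A (inv_deg \<sigma> \<tau> N) z = \<zero>\<^bsub>A\<^esub>"
      using inj_onD[OF inj, of "tpow A (inv_deg \<sigma> \<tau> N) z" "\<zero>\<^bsub>A\<^esub>"] that(1) by (simp add: tpow_def[of A e])
    then show ?case by (rule Suc.IH)
  qed
  fix x y assume xy: "x \<in> carrier A" "y \<in> carrier A" "\<psi> x = \<psi> y"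
  have "\<psi> (kmul A (- 1) y) \<oplus>\<^bsub>B\<^esub> \<psi> y = \<zero>\<^bsub>B\<^esub>"
    using graded_homD(2)[OF \<psi>, of "kmul A (- 1) y" y] A.kmul_l_distr[of y "- 1" 1] A.kmul_one[of y]
      A.kmul_0[of y] xy(2) graded_hom_zero[OF \<psi>] by simp
  then have "\<psi> (kmul A (- 1) y \<oplus>\<^bsub>A\<^esub> x) = \<zero>\<^bsub>B\<^esub>"
    using graded_homD(2)[OF \<psi>, of "kmul A (- 1) y" x] xy by simp
  then have z: "kmul A (- 1) y \<oplus>\<^bsub>A\<^esub> x = \<zero>\<^bsub>A\<^esub>"
    using loc xy tors[of "kmul A (- 1) y \<oplus>\<^bsub>A\<^esub> x"] unfolding localizes_def
    by (metis A.a_closed A.kmul_closed)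
  have z': "kmul A (- 1) y \<oplus>\<^bsub>A\<^esub> y = \<zero>\<^bsub>A\<^esub>"
    using A.kmul_l_distr[of y "- 1" 1] A.kmul_one[of y] A.kmul_0[of y] xy(2) by simp
  show "x = y"
    using A.minus_equality[OF z xy(1) A.kmul_closed[OF xy(2)]]
      A.minus_equality[OF z' xy(2) A.kmul_closed[OF xy(2)]] A.minus_minus xy by metis
qed

lemma LK2_isomorphicE:
  assumes "LK2_isomorphic M N"
  obtains f1 f2 f12 where "f1 \<in> graded_iso {1} (mod1 M) (mod1 N)" "f2 \<in> graded_iso {2} (mod2 M) (mod2 N)"
    "f12 \<in> graded_iso {1, 2} (mod12 M) (mod12 N)"
    "\<And>x. x \<in> carrier (mod1 M) \<Longrightarrow> f12 (map1 M x) = map1 N (f1 x)"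
    "\<And>x. x \<in> carrier (mod2 M) \<Longrightarrow> f12 (map2 M x) = map2 N (f2 x)"
proof -
  from assms obtain f1 f2 f12 g1 g2 g12 where
    f: "(f1, f2, f12) \<in> LK2_hom M N" and g: "(g1, g2, g12) \<in> LK2_hom N M"
    and inv: "\<forall>x\<in>carrier (mod1 M). g1 (f1 x) = x" "\<forall>y\<in>carrier (mod1 N). f1 (g1 y) = y"
      "\<forall>x\<in>carrier (mod2 M). g2 (f2 x) = x" "\<forall>y\<in>carrier (mod2 N). f2 (g2 y) = y"
      "\<forall>x\<in>carrier (mod12 M). g12 (f12 x) = x" "\<forall>y\<in>carrier (mod12 N). f12 (g12 y) = y"
    unfolding LK2_isomorphic_def by (elim exE conjE)
  show thesis
  proof (rule that)
    show "f1 \<in> graded_iso {1} (mod1 M) (mod1 N)" "f2 \<in> graded_iso {2} (mod2 M) (mod2 N)"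
      "f12 \<in> graded_iso {1, 2} (mod12 M) (mod12 N)"
      using f g inv by (auto simp: graded_iso_def LK2_hom_def)
  qed (use f in \<open>auto simp: LK2_hom_def\<close>)
qed

lemma L_functor_simps [simp]:
  "mod1 (L_functor A) = ext_scalars {} {1} A" "mod2 (L_functor A) = ext_scalars {} {2} A"
  "mod12 (L_functor A) = ext_scalars {} {1, 2} A"
  "map1 (L_functor A) = ext_map {} {1, 2} A" "map2 (L_functor A) = ext_map {} {1, 2} A"
  by (simp_all add: L_functor_def)

text \<open>The two filtrations of a torsion-free object, in coordinates: \<open>filt1\<close> comes from \<open>M\<^sub>1\<close> and is indexed by the exponent of
  \<open>t\<^sub>2\<close>, and \<open>filt2\<close> comes from \<open>M\<^sub>2\<close> and is indexed by the exponent of \<open>t\<^sub>1\<close>.\<close>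

locale torsion_free_object =
  fixes M :: "('k::field laurent, 'a, 'b, 'c) LK2_object"
    and \<phi> :: "'c \<Rightarrow> nat \<Rightarrow> 'k" and n :: nat
  assumes LK2: "is_LK2 M" and tf: "LK2_torsion_free M"
    and co: "coordinates {1, 2} (mod12 M) 0 \<phi> n"
begin

lemma graded: "graded_module {1} (mod1 M)" "graded_module {2} (mod2 M)" "graded_module {1, 2} (mod12 M)"
  using LK2 by (auto simp: is_LK2_def fg_graded_module_def)

lemma maps: "map1 M \<in> graded_hom {1} (mod1 M) (mod12 M)" "map2 M \<in> graded_hom {2} (mod2 M) (mod12 M)"
  using LK2 by (auto simp: is_LK2_def)

lemma laurent_map1: "laurent_map {1} (mod1 M) (mod12 M) (map1 M)"
  by (rule laurent_mapI[OF graded(1,3) _ maps(1)]) simp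

lemma laurent_map2: "laurent_map {2} (mod2 M) (mod12 M) (map2 M)"
  by (rule laurent_mapI[OF graded(2,3) _ maps(2)]) simp

lemma localizes_maps:
  "localizes {1} {1, 2} (mod1 M) (mod12 M) (map1 M)" "localizes {2} {1, 2} (mod2 M) (mod12 M) (map2 M)"
  using LK2 by (auto simp: is_LK2_def fg_graded_module_def intro!: localizes_of_induces_iso)

lemma inj_map1: "inj_on (map1 M) (carrier (mod1 M))"
proof (rule localization_injective[OF _ localizes_maps(1)])
  show "graded_module_pair {1} (mod1 M) {1, 2} (mod12 M)"
    using graded by (simp add: graded_module_pair_def graded_module_pair_axioms_def)
  show "inj_on (\<lambda>x. Poly_Mapping.single (0, 1) 1 \<odot>\<^bsub>mod1 M\<^esub> x) (carrier (mod1 M))"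
    using tf by (simp add: LK2_torsion_free_def)
qed (auto simp: inv_deg_def degs_def)

lemma inj_map2: "inj_on (map2 M) (carrier (mod2 M))"
proof (rule localization_injective[OF _ localizes_maps(2)])
  show "graded_module_pair {2} (mod2 M) {1, 2} (mod12 M)"
    using graded by (simp add: graded_module_pair_def graded_module_pair_axioms_def)
  show "inj_on (\<lambda>x. Poly_Mapping.single (1, 0) 1 \<odot>\<^bsub>mod2 M\<^esub> x) (carrier (mod2 M))"
    using tf by (simp add: LK2_torsion_free_def)
qed (auto simp: inv_deg_def degs_def)

sublocale m1: laurent_map "{1}" "mod1 M" "mod12 M" "map1 M" by (rule laurent_map1)
sublocale m2: laurent_map "{2}" "mod2 M" "mod12 M" "map2 M" by (rule laurent_map2)
sublocale co: coordinates "{1, 2}" "mod12 M" 0 \<phi> n by (rule co)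

abbreviation C where "C \<equiv> mod12 M"
abbreviation image1 where "image1 \<equiv> deg0_image (mod1 M) C (map1 M)"
abbreviation image2 where "image2 \<equiv> deg0_image (mod2 M) C (map2 M)"

definition total :: "(nat \<Rightarrow> 'k) set" where "total = \<phi> ` hpart C 0"
definition filt1 :: "nat \<Rightarrow> (nat \<Rightarrow> 'k) set" where "filt1 j = \<phi> ` image1 (0, int j)"
definition filt2 :: "nat \<Rightarrow> (nat \<Rightarrow> 'k) set" where "filt2 i = \<phi> ` image2 (int i, 0)"

lemma image1_eq: "image1 (i, j) = image1 (0, j)"
  using m1.deg0_image_shift[of "(i, 0)" "(0, j)"] by (simp add: degs_def)

lemma image2_eq: "image2 (i, j) = image2 (i, 0)"
  using m2.deg0_image_shift[of "(0, j)" "(i, 0)"] by (simp add: degs_def)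

lemma image1_mono: "mono (\<lambda>j. image1 (0, int j))"
proof (rule monoI)
  fix j k :: nat assume "j \<le> k"
  then show "image1 (0, int j) \<subseteq> image1 (0, int k)"
    using m1.deg0_image_mono[of "(0, int k - int j)" "(0, int j)"] by (simp add: degs_def)
qed

lemma image2_mono: "mono (\<lambda>j. image2 (int j, 0))"
proof (rule monoI)
  fix j k :: nat assume "j \<le> k"
  then show "image2 (int j, 0) \<subseteq> image2 (int k, 0)"
    using m2.deg0_image_mono[of "(int k - int j, 0)" "(int j, 0)"] by (simp add: degs_def)
qed

text \<open>As \<open>C\<close> is a localization of \<open>B\<close>, each vector of \<open>C(0)\<close> comes from \<open>B\<close> after multiplication by a power of \<open>s\<close>.\<close>

lemma deg0_image_exhausts:
  assumes loc: "localizes \<sigma> {1, 2} B C m" and m: "laurent_map \<sigma> B C m" and v: "v \<in> hpart C 0"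
  shows "\<exists>N. v \<in> deg0_image B C m (inv_deg \<sigma> {1, 2} N)"
proof -
  interpret m: laurent_map \<sigma> B C m by (rule m)
  obtain N x where x: "x \<in> carrier B" "tpow C (inv_deg \<sigma> {1, 2} N) v = m x"
    using loc m1.B.hpart_carrier[OF v] unfolding localizes_def by blast
  define e where "e = inv_deg \<sigma> {1, 2} N"
  have "tpow C e v \<in> hpart C e" using m1.B.tpow_hpart[OF _ v, of e] by simp
  then have "m (hcomp B e x) = tpow C e v"
    using m.hcomp_graded_hom[OF m.hom x(1), of e] x(2) m1.B.hcomp_hpart[of "tpow C e v" e e] by (simp add: e_def)
  then have "tpow C e v \<in> m ` hpart B e" using m.A.hcomp_decomposition(1)[OF x(1), of e] by (metis image_eqI)
  then show ?thesis using m.in_deg0_image[OF v] unfolding e_def by blast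
qed

lemma image1_total: "\<exists>j. image1 (0, int j) = hpart C 0"
proof -
  obtain j where j: "\<And>k. image1 (0, int k) \<subseteq> image1 (0, int j)"
    using co.chain_stabilises[of "\<lambda>j. image1 (0, int j)", OF m1.k_subspace_deg0_image m1.deg0_image_subset image1_mono] by blast
  have "hpart C 0 \<subseteq> image1 (0, int j)"
  proof
    fix v assume "v \<in> hpart C 0"
    from deg0_image_exhausts[OF localizes_maps(1) laurent_map1 this] obtain N where "v \<in> image1 (0, int N)"
      by (auto simp: inv_deg_def)
    then show "v \<in> image1 (0, int j)" using j by blast
  qed
  then show ?thesis using m1.deg0_image_subset by blast
qed

lemma image2_total: "\<exists>i. image2 (int i, 0) = hpart C 0"
proof -
  obtain j where j: "\<And>k. image2 (int k, 0) \<subseteq> image2 (int j, 0)"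
    using co.chain_stabilises[of "\<lambda>j. image2 (int j, 0)", OF m2.k_subspace_deg0_image m2.deg0_image_subset image2_mono] by blast
  have "hpart C 0 \<subseteq> image2 (int j, 0)"
  proof
    fix v assume "v \<in> hpart C 0"
    from deg0_image_exhausts[OF localizes_maps(2) laurent_map2 this] obtain N where "v \<in> image2 (int N, 0)"
      by (auto simp: inv_deg_def)
    then show "v \<in> image2 (int j, 0)" using j by blast
  qed
  then show ?thesis using m2.deg0_image_subset by blast
qed

lemma filt1:
  "kv.subspace (filt1 j)" "mono filt1" "filt1 j \<subseteq> total" "\<exists>j. filt1 j = total"
proof -
  show "kv.subspace (filt1 j)"
    unfolding filt1_def by (rule co.co_subspace[OF m1.k_subspace_deg0_image m1.deg0_image_subset])
  show "mono filt1" using image1_mono unfolding filt1_def mono_def by blast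
  show "filt1 j \<subseteq> total" unfolding filt1_def total_def using m1.deg0_image_subset by blast
  show "\<exists>j. filt1 j = total" unfolding filt1_def total_def using image1_total by metis
qed

lemma filt2:
  "kv.subspace (filt2 j)" "mono filt2" "filt2 j \<subseteq> total" "\<exists>j. filt2 j = total"
proof -
  show "kv.subspace (filt2 j)"
    unfolding filt2_def by (rule co.co_subspace[OF m2.k_subspace_deg0_image m2.deg0_image_subset])
  show "mono filt2" using image2_mono unfolding filt2_def mono_def by blast
  show "filt2 j \<subseteq> total" unfolding filt2_def total_def using m2.deg0_image_subset by blast
  show "\<exists>j. filt2 j = total" unfolding filt2_def total_def using image2_total by metis
qed

lemma total_span: "total \<subseteq> kv.span (unit_vec ` {..<n})"
  unfolding total_def by (rule co.co_span) simp

text \<open>The canonical maps \<open>A \<rightarrow> L(A) \<cong> M\<close> are localizations, compatible with the structure maps of \<open>M\<close>.\<close>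

lemma sirk_of_model:
  assumes A: "fg_graded_module {} A" and iso: "LK2_isomorphic (L_functor A) M"
  shows "sirk A (i, j) = kv.dim (filt2 i \<inter> filt1 j)"
proof -
  have gA: "graded_module {} A" using A by (rule fg_graded_moduleE)
  interpret E1: scalar_extension "{}" A "{1}"
    using gA by (simp add: scalar_extension_def scalar_extension_axioms_def)
  interpret E2: scalar_extension "{}" A "{2}"
    using gA by (simp add: scalar_extension_def scalar_extension_axioms_def)
  interpret E12: scalar_extension "{}" A "{1, 2}"
    using gA by (simp add: scalar_extension_def scalar_extension_axioms_def)
  obtain f1 f2 f12 where "f1 \<in> graded_iso {1} (mod1 (L_functor A)) (mod1 M)"
    "f2 \<in> graded_iso {2} (mod2 (L_functor A)) (mod2 M)" "f12 \<in> graded_iso {1, 2} (mod12 (L_functor A)) C"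
    and c1: "\<And>x. x \<in> carrier (mod1 (L_functor A)) \<Longrightarrow> f12 (map1 (L_functor A) x) = map1 M (f1 x)"
    and c2: "\<And>x. x \<in> carrier (mod2 (L_functor A)) \<Longrightarrow> f12 (map2 (L_functor A) x) = map2 M (f2 x)"
    by (rule LK2_isomorphicE[OF iso]) (rule that)
  then have f1: "f1 \<in> graded_iso {1} (ext_scalars {} {1} A) (mod1 M)"
    and f2: "f2 \<in> graded_iso {2} (ext_scalars {} {2} A) (mod2 M)"
    and f12: "f12 \<in> graded_iso {1, 2} (ext_scalars {} {1, 2} A) C"
    by (simp_all only: L_functor_simps)
  have one: "Poly_Mapping.keys (1 :: 'k laurent) \<subseteq> degs \<rho>" for \<rho> by (rule one_in_locR)
  have ext: "ext_map {} {1, 2} A (tens {} {1} A 1 x) = tens {} {1, 2} A 1 x"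
    "ext_map {} {1, 2} A (tens {} {2} A 1 x) = tens {} {1, 2} A 1 x" for x
    by (rule ext_map_tens[OF gA]; simp)+
  have eq: "f12 (tens {} {1, 2} A 1 x) = map1 M (f1 (tens {} {1} A 1 x))"
    "f12 (tens {} {1, 2} A 1 x) = map2 M (f2 (tens {} {2} A 1 x))" if x: "x \<in> carrier A" for x
    using c1[unfolded L_functor_simps, OF E1.tens_carrier[OF one x]]
      c2[unfolded L_functor_simps, OF E2.tens_carrier[OF one x]] unfolding ext by this+
  have "sirk A (i, j) = kv.dim (\<phi> ` image2 (int i, 0) \<inter> \<phi> ` image1 (0, int j))"
    by (rule sirk_eq[OF A E12.localizes_of_graded_iso[OF graded(3) f12]
        E1.localizes_of_graded_iso[OF graded(1) f1] E2.localizes_of_graded_iso[OF graded(2) f2]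
        laurent_map1 laurent_map2 eq co])
  then show ?thesis by (simp add: filt1_def filt2_def)
qed

text \<open>The module of the family \<open>H d = filt2 d\<^sub>1 \<inter> filt1 d\<^sub>2\<close>.  Both filtrations reach all of \<open>V\<close> at some \<open>N\<close>; this makes \<open>A\<close> finitely
  generated, and it makes \<open>H (d + K e)\<close> equal to the image of \<open>M\<^sub>\<sigma>(d)\<close> for large \<open>K\<close>, when \<open>e\<close> is the exponent of the product of the
  variables inverted in \<open>R\<^sub>\<sigma>\<close> and \<open>d\<close> is a degree of \<open>R\<^sub>\<sigma>\<close>.\<close>

lemma model_exists:
  obtains A :: "('k laurent, nat \<Rightarrow> 'k laurent) gmodule"
  where "fg_graded_module {} A" "LK2_isomorphic (L_functor A) M"
proof -
  obtain i0 where i0: "filt2 i0 = total" using filt2(4) by blast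
  obtain j0 where j0: "filt1 j0 = total" using filt1(4) by blast
  define N where "N = max i0 j0"
  have top: "filt2 i = total" "filt1 i = total" if "i \<ge> N" for i
    using monoD[OF filt2(2), of i0 i] monoD[OF filt1(2), of j0 i] filt1(3)[of i] filt2(3)[of i] that
    by (auto simp: i0 j0 N_def)
  define H where "H d = (if d \<in> degs {} then filt2 (nat (fst d)) \<inter> filt1 (nat (snd d)) else {0})" for d
  interpret H: subspace_family H n
  proof
    show "kv.subspace (H d)" for d
      unfolding H_def using filt1(1) filt2(1) by (auto intro: kv.subspace_inter kv.subspace_single_0)
    show "u i = 0" if "u \<in> H d" "n \<le> i" for u d i
    proof (cases "d \<in> degs {}")
      case True
      then have "u \<in> total" using that filt1(3) by (auto simp: H_def)
      then show ?thesis using co.bound that(2) by (auto simp: total_def)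
    qed (use that in \<open>simp add: H_def\<close>)
    show "H d = {0}" if "d \<notin> degs {}" for d using that by (simp add: H_def)
    show "H d \<subseteq> H (e + d)" if e: "e \<in> degs {}" for e d
    proof (cases "d \<in> degs {}")
      case True
      then have "e + d \<in> degs {}" using e by auto
      moreover have "nat (fst d) \<le> nat (fst (e + d))" "nat (snd d) \<le> nat (snd (e + d))"
        using e by (auto simp: in_degs_empty)
      then have "filt2 (nat (fst d)) \<subseteq> filt2 (nat (fst (e + d)))" "filt1 (nat (snd d)) \<subseteq> filt1 (nat (snd (e + d)))"
        using monoD[OF filt1(2)] monoD[OF filt2(2)] by blast+
      ultimately show ?thesis unfolding H_def using True by auto
    next
      case False
      then show ?thesis using kv.subspace_0[OF kv.subspace_inter[OF filt2(1) filt1(1)]] by (simp add: H_def)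
    qed
  qed
  have "fg_graded_module {} H.A"
  proof (rule H.fg_A[of N])
    fix d :: "int \<times> int" assume d: "d \<in> degs {}"
    then have p: "(min (fst d) (int N), min (snd d) (int N)) \<in> degs {}" by (auto simp: in_degs_empty)
    have "filt2 (nat (fst d)) = filt2 (nat (min (fst d) (int N)))"
      by (cases "fst d \<le> int N") (auto simp: top min_def)
    moreover have "filt1 (nat (snd d)) = filt1 (nat (min (snd d) (int N)))"
      by (cases "snd d \<le> int N") (auto simp: top min_def)
    ultimately show "H d = H (min (fst d) (int N), min (snd d) (int N))"
      using d p by (simp add: H_def)
  qed
  moreover have "LK2_isomorphic (L_functor H.A) M"
  proof -
    have z: "0 \<in> \<phi> ` deg0_image B C m d" if "laurent_map \<sigma> B C m" for \<sigma> m d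
      and B :: "('k laurent, 'z) gmodule"
      using laurent_map.k_subspace_deg0_image[OF that, of d] co.co_zero by (metis image_eqI k_subspace_def)
    have H1: "H d \<subseteq> \<phi> ` image1 d" for d
    proof (cases "d \<in> degs {}")
      case True
      then have "image1 d = image1 (0, int (nat (snd d)))" using image1_eq[of "fst d" "snd d"] by (simp add: in_degs_empty)
      then show ?thesis using True by (simp add: H_def filt1_def)
    qed (simp add: H_def z[OF laurent_map1])
    have H2: "H d \<subseteq> \<phi> ` image2 d" for d
    proof (cases "d \<in> degs {}")
      case True
      then have "image2 d = image2 (int (nat (fst d)), 0)" using image2_eq[of "fst d" "snd d"] by (simp add: in_degs_empty)
      then show ?thesis using True by (simp add: H_def filt2_def)
    qed (simp add: H_def z[OF laurent_map2])
    have H12: "H d \<subseteq> \<phi> ` deg0_image C C (\<lambda>x. x) d" for d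
      unfolding deg0_image_id[OF graded(3)] using H1[of d] m1.deg0_image_subset by blast
    have exh1: "\<exists>K. \<phi> v \<in> H (inv_deg {} {1} K + d)" if v: "v \<in> image1 d" for d v
    proof (cases "snd d < 0")
      case True
      then have "hpart (mod1 M) d = {\<zero>\<^bsub>mod1 M\<^esub>}" by (intro m1.A.hpart_outside) (cases d, simp add: degs_def)
      then have "v = \<zero>\<^bsub>C\<^esub>" using v m1.graded_hom_zero[OF maps(1)] by (simp add: deg0_image_def)
      then show ?thesis using co.co_zero H.H_zero by metis
    next
      case False
      define e where "e = inv_deg {} {1} (N + nat \<bar>fst d\<bar>) + d"
      have e: "e \<in> degs {}" "nat (fst e) \<ge> N" "snd e = snd d"
        using False by (auto simp: e_def inv_deg_def in_degs_empty)
      have "image1 d = image1 (0, int (nat (snd e)))" using image1_eq[of "fst d" "snd d"] False e by simp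
      then have "\<phi> v \<in> H e"
        using v e top(1)[OF e(2)] subsetD[OF m1.deg0_image_subset v]
        by (auto simp: H_def filt1_def total_def)
      then show ?thesis unfolding e_def by blast
    qed
    have exh2: "\<exists>K. \<phi> v \<in> H (inv_deg {} {2} K + d)" if v: "v \<in> image2 d" for d v
    proof (cases "fst d < 0")
      case True
      then have "hpart (mod2 M) d = {\<zero>\<^bsub>mod2 M\<^esub>}" by (intro m2.A.hpart_outside) (cases d, simp add: degs_def)
      then have "v = \<zero>\<^bsub>C\<^esub>" using v m2.graded_hom_zero[OF maps(2)] by (simp add: deg0_image_def)
      then show ?thesis using co.co_zero H.H_zero by metis
    next
      case False
      define e where "e = inv_deg {} {2} (N + nat \<bar>snd d\<bar>) + d"
      have e: "e \<in> degs {}" "nat (snd e) \<ge> N" "fst e = fst d"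
        using False by (auto simp: e_def inv_deg_def in_degs_empty)
      have "image2 d = image2 (int (nat (fst e)), 0)" using image2_eq[of "fst d" "snd d"] False e by simp
      then have "\<phi> v \<in> H e"
        using v e top(2)[OF e(2)] subsetD[OF m2.deg0_image_subset v]
        by (auto simp: H_def filt2_def total_def)
      then show ?thesis unfolding e_def by blast
    qed
    have exh12: "\<exists>K. \<phi> v \<in> H (inv_deg {} {1, 2} K + d)" if v: "v \<in> deg0_image C C (\<lambda>x. x) d" for d v
    proof -
      define e where "e = inv_deg {} {1, 2} (N + nat \<bar>fst d\<bar> + nat \<bar>snd d\<bar>) + d"
      have e: "e \<in> degs {}" "nat (fst e) \<ge> N" "nat (snd e) \<ge> N"
        by (auto simp: e_def inv_deg_def in_degs_empty)
      have "\<phi> v \<in> total" using v unfolding deg0_image_id[OF graded(3)] total_def by blast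
      then have "\<phi> v \<in> H e" using e top by (simp add: H_def)
      then show ?thesis unfolding e_def by blast
    qed
    define \<delta> where "\<delta> = inv_into (hpart C 0) \<phi>"
    obtain \<psi>1 where \<psi>1: "localizes {} {1} H.A (mod1 M) \<psi>1"
      "\<And>d f. f \<in> hpart H.A d \<Longrightarrow> map1 M (\<psi>1 f) = tpow C d (\<delta> (slice f d))"
      unfolding \<delta>_def using H.family_module_localizes[OF laurent_map1 inj_map1 co H1 exh1] by blast
    obtain \<psi>2 where \<psi>2: "localizes {} {2} H.A (mod2 M) \<psi>2"
      "\<And>d f. f \<in> hpart H.A d \<Longrightarrow> map2 M (\<psi>2 f) = tpow C d (\<delta> (slice f d))"
      unfolding \<delta>_def using H.family_module_localizes[OF laurent_map2 inj_map2 co H2 exh2] by blast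
    obtain \<psi> where \<psi>: "localizes {} {1, 2} H.A C \<psi>"
      "\<And>d f. f \<in> hpart H.A d \<Longrightarrow> \<psi> f = tpow C d (\<delta> (slice f d))"
      unfolding \<delta>_def using H.family_module_localizes[OF laurent_map_id[OF graded(3)] inj_on_id2 co H12 exh12] by blast
    note homs = \<psi>1(1)[unfolded localizes_def, THEN conjunct1] \<psi>2(1)[unfolded localizes_def, THEN conjunct1]
      \<psi>(1)[unfolded localizes_def, THEN conjunct1]
    interpret AC: graded_module_pair "{}" H.A "{1, 2}" C
      using H.graded_module_A graded(3) by (simp add: graded_module_pair_def graded_module_pair_axioms_def)
    have eq1: "map1 M (\<psi>1 x) = \<psi> x" if "x \<in> carrier H.A" for x
      by (rule AC.graded_hom_eq_onI[OF graded_hom_comp[OF homs(1) graded_hom_restrict[OF maps(1)]] homs(3) _ that])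
        (simp_all add: \<psi>1(2) \<psi>(2))
    have eq2: "map2 M (\<psi>2 x) = \<psi> x" if "x \<in> carrier H.A" for x
      by (rule AC.graded_hom_eq_onI[OF graded_hom_comp[OF homs(2) graded_hom_restrict[OF maps(2)]] homs(3) _ that])
        (simp_all add: \<psi>2(2) \<psi>(2))
    interpret E1: scalar_extension "{}" H.A "{1}"
      using H.graded_module_A by (simp add: scalar_extension_def scalar_extension_axioms_def)
    interpret E2: scalar_extension "{}" H.A "{2}"
      using H.graded_module_A by (simp add: scalar_extension_def scalar_extension_axioms_def)
    interpret E12: scalar_extension "{}" H.A "{1, 2}"
      using H.graded_module_A by (simp add: scalar_extension_def scalar_extension_axioms_def)
    obtain f1 where f1: "f1 \<in> graded_iso {1} (ext_scalars {} {1} H.A) (mod1 M)"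
      "\<And>r a. \<lbrakk>Poly_Mapping.keys r \<subseteq> degs {1}; a \<in> carrier H.A\<rbrakk> \<Longrightarrow> f1 (tens {} {1} H.A r a) = r \<odot>\<^bsub>mod1 M\<^esub> \<psi>1 a"
      by (rule E1.graded_iso_of_localizes[OF graded(1) \<psi>1(1)]) blast
    obtain f2 where f2: "f2 \<in> graded_iso {2} (ext_scalars {} {2} H.A) (mod2 M)"
      "\<And>r a. \<lbrakk>Poly_Mapping.keys r \<subseteq> degs {2}; a \<in> carrier H.A\<rbrakk> \<Longrightarrow> f2 (tens {} {2} H.A r a) = r \<odot>\<^bsub>mod2 M\<^esub> \<psi>2 a"
      by (rule E2.graded_iso_of_localizes[OF graded(2) \<psi>2(1)]) blast
    obtain f12 where f12: "f12 \<in> graded_iso {1, 2} (ext_scalars {} {1, 2} H.A) C"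
      "\<And>r a. \<lbrakk>Poly_Mapping.keys r \<subseteq> degs {1, 2}; a \<in> carrier H.A\<rbrakk> \<Longrightarrow> f12 (tens {} {1, 2} H.A r a) = r \<odot>\<^bsub>C\<^esub> \<psi> a"
      by (rule E12.graded_iso_of_localizes[OF graded(3) \<psi>(1)]) blast
    have k12: "Poly_Mapping.keys (r :: 'k laurent) \<subseteq> degs {1, 2}" for r by simp
    have c1: "ext_map {} {1, 2} H.A X \<in> carrier (ext_scalars {} {1, 2} H.A) \<and>
        f12 (ext_map {} {1, 2} H.A X) = map1 M (f1 X)" if X: "X \<in> carrier (ext_scalars {} {1} H.A)" for X
    proof -
      obtain K a where a: "a \<in> carrier H.A" "X = tens {} {1} H.A (E1.u K) a" by (rule E1.ext_scalars_elem[OF X])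
      have t: "ext_map {} {1, 2} H.A X = tens {} {1, 2} H.A (E1.u K) a"
        unfolding a(2) by (rule ext_map_tens[OF H.graded_module_A]) auto
      have "map1 M (f1 X) = E1.u K \<odot>\<^bsub>C\<^esub> map1 M (\<psi>1 a)"
        unfolding a(2) f1(2)[OF E1.keys_u a(1)]
        by (rule graded_homD(3)[OF maps(1) E1.keys_u graded_homD(1)[OF homs(1) a(1)]])
      then show ?thesis
        unfolding t f12(2)[OF k12 a(1)] using E12.tens_carrier[OF k12 a(1)] by (simp add: eq1[OF a(1)])
    qed
    have c2: "ext_map {} {1, 2} H.A X \<in> carrier (ext_scalars {} {1, 2} H.A) \<and>
        f12 (ext_map {} {1, 2} H.A X) = map2 M (f2 X)" if X: "X \<in> carrier (ext_scalars {} {2} H.A)" for X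
    proof -
      obtain K a where a: "a \<in> carrier H.A" "X = tens {} {2} H.A (E2.u K) a" by (rule E2.ext_scalars_elem[OF X])
      have t: "ext_map {} {1, 2} H.A X = tens {} {1, 2} H.A (E2.u K) a"
        unfolding a(2) by (rule ext_map_tens[OF H.graded_module_A]) auto
      have "map2 M (f2 X) = E2.u K \<odot>\<^bsub>C\<^esub> map2 M (\<psi>2 a)"
        unfolding a(2) f2(2)[OF E2.keys_u a(1)]
        by (rule graded_homD(3)[OF maps(2) E2.keys_u graded_homD(1)[OF homs(2) a(1)]])
      then show ?thesis
        unfolding t f12(2)[OF k12 a(1)] using E12.tens_carrier[OF k12 a(1)] by (simp add: eq2[OF a(1)])
    qed
    show ?thesis
      by (rule LK2_isomorphicI[where ?f1.0 = f1 and ?f2.0 = f2 and ?f12.0 = f12])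
        (use f1(1) f2(1) f12(1) c1 c2 in \<open>simp_all only: L_functor_simps\<close>)
  qed
  ultimately show thesis by (rule that)
qed

lemma sirk_obj_eq: "sirk_obj M (i, j) = kv.dim (filt2 i \<inter> filt1 j)"
proof -
  define A where "A = (SOME A :: ('k laurent, nat \<Rightarrow> 'k laurent) gmodule.
     fg_graded_module {} A \<and> LK2_isomorphic (L_functor A) M)"
  have "fg_graded_module {} A \<and> LK2_isomorphic (L_functor A) M"
    unfolding A_def by (rule someI_ex) (metis model_exists)
  then show ?thesis using sirk_of_model unfolding sirk_obj_def A_def[symmetric] by blast
qed

end

lemma k_hom_inverse:
  assumes C: "graded_module {1, 2} C" and f: "k_hom C C' f"
    and g: "\<And>w. w \<in> hpart C' 0 \<Longrightarrow> g w \<in> hpart C 0"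
    and gf: "\<And>v. v \<in> hpart C 0 \<Longrightarrow> g (f v) = v" and fg: "\<And>w. w \<in> hpart C' 0 \<Longrightarrow> f (g w) = w"
  shows "k_hom C' C g"
  unfolding k_hom_def
proof (intro conjI ballI allI)
  interpret C: graded_module "{1, 2}" C by (rule C)
  fix v assume v: "v \<in> hpart C' 0"
  show "g v \<in> hpart C 0" by (rule g[OF v])
  have "f (kmul C c (g v)) = kmul C' c v" for c
    using f g[OF v] fg[OF v] by (simp add: k_hom_def)
  then show "g (kmul C' c v) = kmul C c (g v)" for c
    using gf[OF C.kmul_hpart[OF g[OF v], of c]] by simp
  fix w assume w: "w \<in> hpart C' 0"
  have "f (g v \<oplus>\<^bsub>C\<^esub> g w) = v \<oplus>\<^bsub>C'\<^esub> w"
    using f g[OF v] g[OF w] fg[OF v] fg[OF w] by (simp add: k_hom_def)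
  then show "g (v \<oplus>\<^bsub>C'\<^esub> w) = g v \<oplus>\<^bsub>C\<^esub> g w"
    using gf[OF C.hpart_add[OF g[OF v] g[OF w]]] by simp
qed

text \<open>A linear isomorphism between the coordinate images comes from one of the parts of degree \<open>0\<close>.\<close>

lemma linear_iso_of_coordinates:
  assumes co: "coordinates {1, 2} C 0 \<phi> n" and co': "coordinates {1, 2} C' 0 \<phi>' n'"
    and lin: "Vector_Spaces.linear kscale kscale \<theta>" and inj: "inj_on \<theta> (\<phi> ` hpart C 0)"
    and surj: "\<theta> ` \<phi> ` hpart C 0 = \<phi>' ` hpart C' 0"
  obtains f g where "k_hom C C' f" "k_hom C' C g" "\<And>v. v \<in> hpart C 0 \<Longrightarrow> g (f v) = v"
    "\<And>w. w \<in> hpart C' 0 \<Longrightarrow> f (g w) = w" "\<And>v. v \<in> hpart C 0 \<Longrightarrow> \<phi>' (f v) = \<theta> (\<phi> v)"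
proof -
  interpret co: coordinates "{1, 2}" C 0 \<phi> n by (rule co)
  interpret co': coordinates "{1, 2}" C' 0 \<phi>' n' by (rule co')
  interpret \<theta>: Vector_Spaces.linear kscale kscale \<theta> by (rule lin)
  define f where "f v = inv_into (hpart C' 0) \<phi>' (\<theta> (\<phi> v))" for v
  have f: "f v \<in> hpart C' 0" "\<phi>' (f v) = \<theta> (\<phi> v)" if "v \<in> hpart C 0" for v
  proof -
    have "\<theta> (\<phi> v) \<in> \<phi>' ` hpart C' 0" using that surj by blast
    then show "f v \<in> hpart C' 0" "\<phi>' (f v) = \<theta> (\<phi> v)"
      unfolding f_def by (rule inv_into_into, rule f_inv_into_f)
  qed
  have eqI: "x = y" if "x \<in> hpart C' 0" "y \<in> hpart C' 0" "\<phi>' x = \<phi>' y" for x y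
    using inj_onD[OF co'.co_inj, of x y] that by blast
  have kf: "k_hom C C' f"
    unfolding k_hom_def
  proof (intro conjI ballI allI)
    fix v assume v: "v \<in> hpart C 0"
    show "f v \<in> hpart C' 0" by (rule f(1)[OF v])
    show "f (kmul C c v) = kmul C' c (f v)" for c
    proof (rule eqI[OF f(1)[OF co.kmul_hpart[OF v]] co'.kmul_hpart[OF f(1)[OF v]]])
      show "\<phi>' (f (kmul C c v)) = \<phi>' (kmul C' c (f v))"
        unfolding f(2)[OF co.kmul_hpart[OF v]] co.co_kmul[OF v] co'.co_kmul[OF f(1)[OF v]] f(2)[OF v]
        by (rule \<theta>.scale)
    qed
    fix w assume w: "w \<in> hpart C 0"
    show "f (v \<oplus>\<^bsub>C\<^esub> w) = f v \<oplus>\<^bsub>C'\<^esub> f w"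
    proof (rule eqI[OF f(1)[OF co.hpart_add[OF v w]] co'.hpart_add[OF f(1)[OF v] f(1)[OF w]]])
      show "\<phi>' (f (v \<oplus>\<^bsub>C\<^esub> w)) = \<phi>' (f v \<oplus>\<^bsub>C'\<^esub> f w)"
        unfolding f(2)[OF co.hpart_add[OF v w]] co.co_add[OF v w] co'.co_add[OF f(1)[OF v] f(1)[OF w]]
          f(2)[OF v] f(2)[OF w] by (rule \<theta>.add)
    qed
  qed
  have bij: "bij_betw f (hpart C 0) (hpart C' 0)"
    unfolding bij_betw_def
  proof
    show "inj_on f (hpart C 0)"
    proof (rule inj_onI)
      fix x y assume xy: "x \<in> hpart C 0" "y \<in> hpart C 0" "f x = f y"
      then have "\<phi> x = \<phi> y" using inj_onD[OF inj, of "\<phi> x" "\<phi> y"] f(2)[OF xy(1)] f(2)[OF xy(2)] by simp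
      then show "x = y" using inj_onD[OF co.co_inj, of x y] xy by blast
    qed
    show "f ` hpart C 0 = hpart C' 0"
    proof
      show "hpart C' 0 \<subseteq> f ` hpart C 0"
      proof
        fix w assume w: "w \<in> hpart C' 0"
        then obtain v where v: "v \<in> hpart C 0" "\<phi>' w = \<theta> (\<phi> v)" using surj by blast
        then have "w = f v" using f[OF v(1)] w by (intro eqI) simp_all
        then show "w \<in> f ` hpart C 0" using v(1) by blast
      qed
    qed (use f(1) in blast)
  qed
  define g where "g = inv_into (hpart C 0) f"
  have gf: "g (f v) = v" if "v \<in> hpart C 0" for v
    unfolding g_def by (rule bij_betw_inv_into_left[OF bij that])
  have fg: "f (g w) = w" if "w \<in> hpart C' 0" for w
    unfolding g_def by (rule bij_betw_inv_into_right[OF bij that])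
  have g: "g w \<in> hpart C 0" if "w \<in> hpart C' 0" for w
    using bij_betw_inv_into[OF bij] that unfolding g_def by (rule bij_betwE[THEN bspec])
  have "k_hom C' C g" by (rule k_hom_inverse[OF co.graded_module_axioms kf g gf fg])
  with kf gf fg f(2) show thesis using that by blast
qed

theorem theorem10p12:
  fixes M :: "('k::field laurent, 'a, 'b, 'c) LK2_object"
    and N :: "('k laurent, 'd, 'e, 'f) LK2_object"
  assumes "is_LK2 M" and "is_LK2 N"
    and "LK2_torsion_free M" and "LK2_torsion_free N"
    and "sirk_obj M = sirk_obj N"
  shows "LK2_isomorphic M N"
proof -
  obtain \<phi> n where "coordinates {1, 2} (mod12 M) 0 \<phi> n"
    using assms(1) coordinates_exist unfolding is_LK2_def by metis
  then interpret M: torsion_free_object M \<phi> n using assms by (simp add: torsion_free_object_def)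
  obtain \<phi>' n' where "coordinates {1, 2} (mod12 N) 0 \<phi>' n'"
    using assms(2) coordinates_exist unfolding is_LK2_def by metis
  then interpret N: torsion_free_object N \<phi>' n' using assms by (simp add: torsion_free_object_def)
  obtain p q where pq: "M.filt2 p = M.total" "M.filt1 q = M.total" using M.filt1(4) M.filt2(4) by blast
  obtain p' q' where pq': "N.filt2 p' = N.total" "N.filt1 q' = N.total" using N.filt1(4) N.filt2(4) by blast
  have dim: "kv.dim (M.filt2 i \<inter> M.filt1 j) = kv.dim (N.filt2 i \<inter> N.filt1 j)" for i j
    using M.sirk_obj_eq N.sirk_obj_eq assms(5) by metis
  obtain \<theta> where \<theta>: "Vector_Spaces.linear kscale kscale \<theta>" "inj_on \<theta> M.total" "\<theta> ` M.total = N.total"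
    "\<And>i. \<theta> ` M.filt2 i = N.filt2 i" "\<And>j. \<theta> ` M.filt1 j = N.filt1 j"
    by (rule kv.filtration_pair_iso[OF M.filt2(1,2) pq(1) M.filt2(3) M.filt1(1,2) pq(2) M.filt1(3)
        finite_imageI[OF finite_lessThan] M.total_span N.filt2(1,2) pq'(1) N.filt2(3) N.filt1(1,2) pq'(2) N.filt1(3)
        finite_imageI[OF finite_lessThan] N.total_span dim]) blast
  interpret \<theta>: Vector_Spaces.linear kscale kscale \<theta> by (rule \<theta>(1))
  obtain f g where kf: "k_hom M.C N.C f" and kg: "k_hom N.C M.C g"
    and gf: "\<And>v. v \<in> hpart M.C 0 \<Longrightarrow> g (f v) = v" and fg: "\<And>w. w \<in> hpart N.C 0 \<Longrightarrow> f (g w) = w"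
    and \<phi>f: "\<And>v. v \<in> hpart M.C 0 \<Longrightarrow> \<phi>' (f v) = \<theta> (\<phi> v)"
    using linear_iso_of_coordinates[OF M.co N.co \<theta>(1) \<theta>(2,3)[unfolded M.total_def N.total_def]] by metis
  have fC: "f v \<in> hpart N.C 0" if "v \<in> hpart M.C 0" for v using kf that by (simp add: k_hom_def)
  have gC: "g w \<in> hpart M.C 0" if "w \<in> hpart N.C 0" for w using kg that by (simp add: k_hom_def)
  have transfer: "f ` L \<subseteq> L' \<and> g ` L' \<subseteq> L"
    if L: "L \<subseteq> hpart M.C 0" "L' \<subseteq> hpart N.C 0" and eq: "\<theta> ` (\<phi> ` L) = \<phi>' ` L'" for L L'
  proof -
    have sub: "f ` L \<subseteq> hpart N.C 0" using fC L(1) by blast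
    have "\<phi>' ` f ` L = \<phi>' ` L'"
      unfolding eq[symmetric] image_image by (rule image_cong[OF refl \<phi>f[OF subsetD[OF L(1)]]])
    then have fL: "f ` L = L'" by (simp add: inj_on_image_eq_iff[OF N.co.co_inj sub L(2)])
    have "g ` f ` L = (\<lambda>v. v) ` L"
      unfolding image_image by (rule image_cong[OF refl gf[OF subsetD[OF L(1)]]])
    then have "g ` L' = L" by (simp add: fL)
    with fL show ?thesis by simp
  qed
  have t1: "f ` M.image1 d \<subseteq> N.image1 d \<and> g ` N.image1 d \<subseteq> M.image1 d" for d
  proof (cases "0 \<le> snd d")
    case True
    have "\<theta> ` (\<phi> ` M.image1 (0, int (nat (snd d)))) = \<phi>' ` N.image1 (0, int (nat (snd d)))"
      using \<theta>(5)[of "nat (snd d)"] by (simp only: M.filt1_def N.filt1_def)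
    then show ?thesis
      using transfer[OF M.m1.deg0_image_subset N.m1.deg0_image_subset, of d d]
        M.image1_eq[of "fst d" "snd d"] N.image1_eq[of "fst d" "snd d"] True by simp
  next
    case False
    then have d: "d \<notin> degs {1}" by (cases d) (simp add: degs_def)
    have "M.image1 d = {\<zero>\<^bsub>M.C\<^esub>}" "N.image1 d = {\<zero>\<^bsub>N.C\<^esub>}"
      using M.m1.A.hpart_outside[OF d] N.m1.A.hpart_outside[OF d]
        M.m1.graded_hom_zero[OF M.maps(1)] N.m1.graded_hom_zero[OF N.maps(1)] by (simp_all add: deg0_image_def)
    then show ?thesis
      using transfer[of "{\<zero>\<^bsub>M.C\<^esub>}" "{\<zero>\<^bsub>N.C\<^esub>}"] M.co.co_zero N.co.co_zero \<theta>.zero by simp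
  qed
  have t2: "f ` M.image2 d \<subseteq> N.image2 d \<and> g ` N.image2 d \<subseteq> M.image2 d" for d
  proof (cases "0 \<le> fst d")
    case True
    have "\<theta> ` (\<phi> ` M.image2 (int (nat (fst d)), 0)) = \<phi>' ` N.image2 (int (nat (fst d)), 0)"
      using \<theta>(4)[of "nat (fst d)"] by (simp only: M.filt2_def N.filt2_def)
    then show ?thesis
      using transfer[OF M.m2.deg0_image_subset N.m2.deg0_image_subset, of d d]
        M.image2_eq[of "fst d" "snd d"] N.image2_eq[of "fst d" "snd d"] True by simp
  next
    case False
    then have d: "d \<notin> degs {2}" by (cases d) (simp add: degs_def)
    have "M.image2 d = {\<zero>\<^bsub>M.C\<^esub>}" "N.image2 d = {\<zero>\<^bsub>N.C\<^esub>}"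
      using M.m2.A.hpart_outside[OF d] N.m2.A.hpart_outside[OF d]
        M.m2.graded_hom_zero[OF M.maps(2)] N.m2.graded_hom_zero[OF N.maps(2)] by (simp_all add: deg0_image_def)
    then show ?thesis
      using transfer[of "{\<zero>\<^bsub>M.C\<^esub>}" "{\<zero>\<^bsub>N.C\<^esub>}"] M.co.co_zero N.co.co_zero \<theta>.zero by simp
  qed
  have t12: "f ` deg0_image M.C M.C (\<lambda>x. x) d \<subseteq> deg0_image N.C N.C (\<lambda>x. x) d"
    "g ` deg0_image N.C N.C (\<lambda>x. x) d \<subseteq> deg0_image M.C M.C (\<lambda>x. x) d" for d
    using fC gC by (auto simp: deg0_image_id[OF M.graded(3)] deg0_image_id[OF N.graded(3)])
  obtain f1 where f1: "f1 \<in> graded_iso {1} (mod1 M) (mod1 N)"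
    "\<And>d x. x \<in> hpart (mod1 M) d \<Longrightarrow> map1 N (f1 x) = tpow N.C d (f (tpow M.C (- d) (map1 M x)))"
    using graded_iso_of_deg0_iso[OF M.laurent_map1 M.inj_map1 N.laurent_map1 N.inj_map1 kf
        conjunct1[OF t1] kg conjunct2[OF t1] gf fg] by blast
  obtain f2 where f2: "f2 \<in> graded_iso {2} (mod2 M) (mod2 N)"
    "\<And>d x. x \<in> hpart (mod2 M) d \<Longrightarrow> map2 N (f2 x) = tpow N.C d (f (tpow M.C (- d) (map2 M x)))"
    using graded_iso_of_deg0_iso[OF M.laurent_map2 M.inj_map2 N.laurent_map2 N.inj_map2 kf
        conjunct1[OF t2] kg conjunct2[OF t2] gf fg] by blast
  obtain f12 where f12: "f12 \<in> graded_iso {1, 2} M.C N.C"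
    "\<And>d x. x \<in> hpart M.C d \<Longrightarrow> f12 x = tpow N.C d (f (tpow M.C (- d) x))"
    using graded_iso_of_deg0_iso[OF laurent_map_id[OF M.graded(3)] inj_on_id2 laurent_map_id[OF N.graded(3)]
        inj_on_id2 kf t12(1) kg t12(2) gf fg] by blast
  note homs = f1(1)[unfolded graded_iso_def] f2(1)[unfolded graded_iso_def] f12(1)[unfolded graded_iso_def]
  have h1: "f1 \<in> graded_hom {1} (mod1 M) (mod1 N)" and h2: "f2 \<in> graded_hom {2} (mod2 M) (mod2 N)"
    and h12: "f12 \<in> graded_hom {1, 2} M.C N.C"
    using homs by auto
  show ?thesis
  proof (rule LK2_isomorphicI[OF f1(1) f2(1) f12(1)])
    show "map1 M x \<in> carrier M.C" if "x \<in> carrier (mod1 M)" for x by (rule graded_homD(1)[OF M.maps(1) that])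
    show "map2 M x \<in> carrier M.C" if "x \<in> carrier (mod2 M)" for x by (rule graded_homD(1)[OF M.maps(2) that])
    interpret P1: graded_module_pair "{1}" "mod1 M" "{1, 2}" N.C
      using M.graded(1) N.graded(3) by (simp add: graded_module_pair_def graded_module_pair_axioms_def)
    interpret P2: graded_module_pair "{2}" "mod2 M" "{1, 2}" N.C
      using M.graded(2) N.graded(3) by (simp add: graded_module_pair_def graded_module_pair_axioms_def)
    show "f12 (map1 M x) = map1 N (f1 x)" if "x \<in> carrier (mod1 M)" for x
      by (rule P1.graded_hom_eq_onI[OF graded_hom_comp[OF M.maps(1) graded_hom_restrict[OF h12]]
            graded_hom_comp[OF h1 N.maps(1)] _ that])
        (simp_all add: f1(2) f12(2)[OF graded_homD(4)[OF M.maps(1)]])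
    show "f12 (map2 M x) = map2 N (f2 x)" if "x \<in> carrier (mod2 M)" for x
      by (rule P2.graded_hom_eq_onI[OF graded_hom_comp[OF M.maps(2) graded_hom_restrict[OF h12]]
            graded_hom_comp[OF h2 N.maps(2)] _ that])
        (simp_all add: f2(2) f12(2)[OF graded_homD(4)[OF M.maps(2)]])
  qed
qed

end
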